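(* Let $m,p,l\in\mathbb{N}_0$, with $e_j,a_k\in\mathbb{R}$, $b_i,\eta_j,\gamma_k,\alpha_k>0$, $\beta_k\in(0,1)$ such that $e_j+\eta_j>0$ and $a_k+\alpha_k>0$, for $i=1,\dots,p$, $j=1,\dots,p+m$ and $k=1,\dots,l$, and (when $p>0$) $\sum_{i=1}^pb_i>1$. Let $\phi_\iota$ be the Laplace transform of the density $\varrho_\iota$, $\iota=0,\dots,7$, defined in the context. Then the functions $\phi_\iota(s)$, $\iota=0,\dots,7$, are completely monotone for $s\in[0,\infty)$. Furthermore, if $\Delta_{\phi_\iota}>0$, then $\phi_\iota$ can be extended analytically to the entire complex plane, and for $z\in\mathbb{C}$: (C0) for $m=p=0$: $\phi_0(z)={}_0\Psi_0\left[{-\atop-}\Big|-z\right]=\sum_{n\ge0}\frac{(-z)^n}{n!}=\exp(-z)$. (C1) for $m>0$: $$\phi_1(z)=\frac1{K_1}\,{}_m\Psi_0\left[{(e_i+\eta_i,\eta_i)_{1,m}\atop-}\Big|-z\right]=\frac1{K_1}\sum_{n\ge0}\prod_{i=1}^m\Gamma(e_i+\eta_i(1+n))\frac{(-z)^n}{n!}.$$ (C2) for $p>0$: $$\phi_2(z)=\frac1{K_2}\,{}_p\Psi_p\left[{(e_i+\eta_i,\eta_i)_{1,p}\atop(e_i+b_i+\eta_i,\eta_i)_{1,p}}\Big|-z\right]=\frac1{K_2}\sum_{n\ge0}\frac{\prod_{i=1}^p\Gamma(e_i+\eta_i(1+n))}{\prod_{i=1}^p\Gamma(e_i+b_i+\eta_i(1+n))}\frac{(-z)^n}{n!}.$$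 (C3) for $p,m>0$: $$\phi_3(z)=\frac1{K_3}\,{}_{m+p}\Psi_p\left[{(e_i+\eta_i,\eta_i)_{1,m+p}\atop(e_i+b_i+\eta_i,\eta_i)_{1,p}}\Big|-z\right]=\frac1{K_3}\sum_{n\ge0}\frac{\prod_{i=1}^{m+p}\Gamma(e_i+\eta_i(1+n))}{\prod_{i=1}^p\Gamma(e_i+b_i+\eta_i(1+n))}\frac{(-z)^n}{n!}.$$ (C4) for $l>0$: $$\phi_4(z)=\frac1{K_4}\,{}_l\Psi_l\left[{(a_k+\alpha_k,\alpha_k\gamma_k)_{1,l}\atop(1+\beta_k(a_k+\alpha_k-1),\alpha_k\beta_k\gamma_k)_{1,l}}\Big|-z\right]=\frac1{K_4}\sum_{n\ge0}\frac{\prod_{k=1}^l\Gamma(a_k+\alpha_k+\alpha_k\gamma_kn)}{\prod_{k=1}^l\Gamma(1+\beta_k(a_k+\alpha_k-1)+\alpha_k\beta_k\gamma_kn)}\frac{(-z)^n}{n!}.$$ (C5) for $m,l>0$: $$\phi_5(z)=\frac1{K_5}\,{}_{m+l}\Psi_l\left[{(e_i+\eta_i,\eta_i)_{1,m},(a_k+\alpha_k,\alpha_k\gamma_k)_{1,l}\atop(1+\beta_k(a_k+\alpha_k-1),\alpha_k\beta_k\gamma_k)_{1,l}}\Big|-z\right]=\frac1{K_5}\sum_{n\ge0}\frac{\prod_{i=1}^m\Gamma(e_i+\eta_i(1+n))\prod_{k=1}^l\Gamma(a_k+\alpha_k+\alpha_k\gamma_kn)}{\prod_{k=1}^l\Gamma(1+\beta_k(a_k+\alpha_k-1)+\alpha_k\beta_k\gamma_kn)}\frac{(-z)^n}{n!}.$$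 (C6) for $p,l>0$: $$\phi_6(z)=\frac1{K_6}\,{}_{p+l}\Psi_{p+l}\left[{(e_i+\eta_i,\eta_i)_{1,p},(a_k+\alpha_k,\alpha_k\gamma_k)_{1,l}\atop(e_i+b_i+\eta_i,\eta_i)_{1,p},(1+\beta_k(a_k+\alpha_k-1),\alpha_k\beta_k\gamma_k)_{1,l}}\Big|-z\right]$$ $$=\frac1{K_6}\sum_{n\ge0}\frac{\prod_{i=1}^p\Gamma(e_i+\eta_i(1+n))\prod_{k=1}^l\Gamma(a_k+\alpha_k+\alpha_k\gamma_kn)}{\prod_{i=1}^p\Gamma(e_i+b_i+\eta_i(1+n))\prod_{k=1}^l\Gamma(1+\beta_k(a_k+\alpha_k-1)+\alpha_k\beta_k\gamma_kn)}\frac{(-z)^n}{n!}.$$ (C7) for $p,m,l>0$: $$\phi_7(z)=\frac1{K_7}\,{}_{m+p+l}\Psi_{p+l}\left[{(e_i+\eta_i,\eta_i)_{1,m+p},(a_k+\alpha_k,\alpha_k\gamma_k)_{1,l}\atop(e_i+b_i+\eta_i,\eta_i)_{1,p},(1+\beta_k(a_k+\alpha_k-1),\alpha_k\beta_k\gamma_k)_{1,l}}\Big|-z\right]$$ $$=\frac1{K_7}\sum_{n\ge0}\frac{\prod_{i=1}^{m+p}\Gamma(e_i+\eta_i(1+n))\prod_{k=1}^l\Gamma(a_k+\alpha_k+\alpha_k\gamma_kn)}{\prod_{i=1}^p\Gamma(e_i+b_i+\eta_i(1+n))\prod_{k=1}^l\Gamma(1+\beta_k(a_k+\alpha_k-1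)+\alpha_k\beta_k\gamma_kn)}\frac{(-z)^n}{n!}.$$
   Context: A function $f\in C^\infty((0,\infty))$ is completely monotone iff $(-1)^kf^{(k)}(y)\ge0$ for all $y>0$, $k\in\mathbb{N}_0$. Laplace transform: $\phi_\iota(s)=\int_0^\infty\mathrm{e}^{-sx}\varrho_\iota(x)\,\mathrm{d}x$, $s\ge0$. Generalized Wright function: ${}_M\Psi_P\left[{(A_i,\mathsf{a}_i)_{1,M}\atop(B_j,\mathsf{b}_j)_{1,P}}\Big|z\right]=\sum_{n\ge0}\frac{\prod_{i=1}^M\Gamma(A_i+\mathsf{a}_in)}{\prod_{j=1}^P\Gamma(B_j+\mathsf{b}_jn)}\frac{z^n}{n!}$; a dash denotes an empty list, empty products are $1$ and empty sums $0$. Fox-$H$ function: $H^{M,0}_{P,M}\left[x\,\Big|{(A_i,\mathsf{a}_i)_{1,P}\atop(B_j,\mathsf{b}_j)_{1,M}}\right]=\frac1{2\pi\mathrm{i}}\int_{\mathcal{L}}\frac{\prod_{j=1}^M\Gamma(B_j+s\mathsf{b}_j)}{\prod_{i=1}^P\Gamma(A_i+s\mathsf{a}_i)}x^{-s}\,\mathrm{d}s$, with $\mathcal{L}$ a contour from $\gamma-\mathrm{i}\infty$ to $\gamma+\mathrm{i}\infty$ ($\gamma\in\mathbb{R}$) having all poles of the $\Gamma(B_j+s\mathsf{b}_j)$ on its left. Densities (with $c_k:=a_k-\alpha_k\gamma_k+\alpha_k$; each class for the same ranges of $m,p,l$ as in the claim): $\varrho_0=H^{0,0}_{0,0}=\delta_1$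 (Dirac distribution at $1$); $\varrho_1(x)=\frac1{K_1}H^{m,0}_{0,m}\left[x\Big|{-\atop(e_i,\eta_i)_{1,m}}\right]$, $x>0$, $K_1=\prod_{i=1}^m\Gamma(e_i+\eta_i)$; $\varrho_2(x)=\frac1{K_2}H^{p,0}_{p,p}\left[x\Big|{(e_i+b_i,\eta_i)_{1,p}\atop(e_i,\eta_i)_{1,p}}\right]$, $x\in(0,1)$ (zero otherwise), $K_2=\prod_{i=1}^p\frac{\Gamma(e_i+\eta_i)}{\Gamma(e_i+b_i+\eta_i)}$; $\varrho_3(x)=\frac1{K_3}H^{m+p,0}_{p,m+p}\left[x\Big|{(e_i+b_i,\eta_i)_{1,p}\atop(e_i,\eta_i)_{1,p+m}}\right]$, $x>0$, $K_3=\prod_{i=1}^p\frac{\Gamma(e_i+\eta_i)}{\Gamma(e_i+b_i+\eta_i)}\prod_{i=p+1}^{p+m}\Gamma(e_i+\eta_i)$; $\varrho_4(x)=\frac1{K_4}H^{l,0}_{l,l}\left[x\Big|{(1-\beta_k+\beta_kc_k,\alpha_k\beta_k\gamma_k)_{1,l}\atop(c_k,\alpha_k\gamma_k)_{1,l}}\right]$, $x>0$, $K_4=\prod_{k=1}^l\frac{\Gamma(a_k+\alpha_k)}{\Gamma(1-\beta_k+\beta_ka_k+\beta_k\alpha_k)}$; $\varrho_5(x)=\frac1{K_5}H^{m+l,0}_{l,m+l}\left[x\Big|{(1-\beta_k+\beta_kc_k,\alpha_k\beta_k\gamma_k)_{1,l}\atop(e_i,\eta_i)_{1,m},(c_k,\alpha_k\gamma_k)_{1,l}}\right]$,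 $x>0$, $K_5=K_1K_4$; $\varrho_6(x)=\frac1{K_6}H^{p+l,0}_{p+l,p+l}\left[x\Big|{(e_i+b_i,\eta_i)_{1,p},(1-\beta_k+\beta_kc_k,\alpha_k\beta_k\gamma_k)_{1,l}\atop(e_i,\eta_i)_{1,p},(c_k,\alpha_k\gamma_k)_{1,l}}\right]$, $x>0$, $K_6=K_2K_4$; $\varrho_7(x)=\frac1{K_7}H^{m+p+l,0}_{p+l,m+p+l}\left[x\Big|{(e_i+b_i,\eta_i)_{1,p},(1-\beta_k+\beta_kc_k,\alpha_k\beta_k\gamma_k)_{1,l}\atop(e_i,\eta_i)_{1,p+m},(c_k,\alpha_k\gamma_k)_{1,l}}\right]$, $x>0$, $K_7=K_3K_4$. The quantities $\Delta_{\phi_\iota}$: with $S=\sum_{k=1}^l\alpha_k\gamma_k(1-\beta_k)$, $\Delta_{\phi_0}=1$, $\Delta_{\phi_1}=1-\sum_{i=1}^m\eta_i$, $\Delta_{\phi_2}=1$, $\Delta_{\phi_3}=1-\sum_{i=p+1}^{p+m}\eta_i$, $\Delta_{\phi_4}=1-S$, $\Delta_{\phi_5}=1-\sum_{i=1}^m\eta_i-S$, $\Delta_{\phi_6}=1-S$, $\Delta_{\phi_7}=1-\sum_{i=p+1}^{p+m}\eta_i-S$. *)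

theory Defs
  imports "HOL-Probability.Probability"
begin

definition completely_monotone :: "(real \<Rightarrow> real) \<Rightarrow> bool" where
  "completely_monotone f \<longleftrightarrow>
     (\<forall>k. \<forall>y>0. (deriv ^^ k) f differentiable (at y) \<and> (-1) ^ k * (deriv ^^ k) f y \<ge> 0)"

(* On the closed half-line: the derivative conditions in the interior, plus continuity
   up to the end point 0 (Widder's convention for half-closed intervals). *)
definition completely_monotone_nonneg :: "(real \<Rightarrow> real) \<Rightarrow> bool" where
  "completely_monotone_nonneg f \<longleftrightarrow> continuous_on {0..} f \<and> completely_monotone f"

type_synonym param = "nat \<Rightarrow> real"

(* Parameter lists (A_i, a_i)_{1,M} are lists of pairs; the dash is the empty list. *)
definition pars :: "param \<Rightarrow> param \<Rightarrow> nat \<Rightarrow> (real \<times> real) list" where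
  "pars A a M = map (\<lambda>i. (A i, a i)) [1..<Suc M]"

definition wright_term ::
  "(real \<times> real) list \<Rightarrow> (real \<times> real) list \<Rightarrow> complex \<Rightarrow> nat \<Rightarrow> complex" where
  "wright_term As Bs z n =
     complex_of_real ((\<Prod>(A, a)\<leftarrow>As. Gamma (A + a * real n)) / (\<Prod>(B, b)\<leftarrow>Bs. Gamma (B + b * real n)))
       * (z ^ n / fact n)"

definition wright :: "(real \<times> real) list \<Rightarrow> (real \<times> real) list \<Rightarrow> complex \<Rightarrow> complex" where
  "wright As Bs z = (\<Sum>n. wright_term As Bs z n)"

definition poles_left_of :: "(real \<times> real) list \<Rightarrow> real \<Rightarrow> bool" where
  "poles_left_of Bs \<sigma> \<longleftrightarrow>
     (\<forall>(B, b)\<in>set Bs. \<forall>s. of_real B + s * of_real b \<in> (\<int>\<^sub>\<le>\<^sub>0 :: complex set) \<longrightarrow> Re s < \<sigma>)"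

(* Gamma is 0 at its poles and x / 0 = 0, so a reciprocal Gamma factor correctly vanishes there. *)
definition fox_kernel :: "(real \<times> real) list \<Rightarrow> (real \<times> real) list \<Rightarrow> complex \<Rightarrow> complex" where
  "fox_kernel As Bs s =
     (\<Prod>(B, b)\<leftarrow>Bs. Gamma (of_real B + s * of_real b)) / (\<Prod>(A, a)\<leftarrow>As. Gamma (of_real A + s * of_real a))"

(* The Fox function H^{M,0}_{P,M}[x | As; Bs], with P and M the lengths of As and Bs.
   Only numerator factors Gamma (B + s b) with b > 0 occur, so the real parts of their poles
   are bounded above and the contour can be taken to be a vertical line Re s = sigma;
   s = sigma + i t turns ds into i dt.  By Cauchy's theorem the value does not depend on
   the sigma that is chosen. *)
definition fox_H :: "(real \<times> real) list \<Rightarrow> (real \<times> real) list \<Rightarrow> real \<Rightarrow> complex" where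
  "fox_H As Bs x =
     (let \<sigma> = (SOME \<sigma>. poles_left_of Bs \<sigma>) in
      1 / (2 * of_real pi * \<i>) *
      (LINT t|lborel. fox_kernel As Bs (Complex \<sigma> t) * of_real x powr (- Complex \<sigma> t) * \<i>))"

lemma poles_left_of_iff:
  assumes "\<forall>(B, b)\<in>set Bs. b > 0"
  shows "poles_left_of Bs \<sigma> \<longleftrightarrow> (\<forall>(B, b)\<in>set Bs. B + \<sigma> * b > 0)"
proof
  assume L: "poles_left_of Bs \<sigma>"
  show "\<forall>(B, b)\<in>set Bs. B + \<sigma> * b > 0"
  proof (clarify)
    fix B b assume Bb: "(B, b) \<in> set Bs"
    with assms have b: "b > 0" by auto
    have "of_real B + of_real (- B / b) * of_real b = (0 :: complex)"
    proof -
      have "of_real B + of_real (- B / b) * of_real b = (of_real (B + (- B / b) * b) :: complex)"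
        by (simp only: of_real_add of_real_mult)
      also have "B + (- B / b) * b = 0" using b by simp
      finally show ?thesis by simp
    qed
    hence "of_real B + of_real (- B / b) * of_real b \<in> (\<int>\<^sub>\<le>\<^sub>0 :: complex set)"
      by (metis zero_in_nonpos_Ints)
    with L Bb have "Re (of_real (- B / b)) < \<sigma>"
      unfolding poles_left_of_def by blast
    thus "B + \<sigma> * b > 0" using b by (simp add: field_simps)
  qed
next
  assume R: "\<forall>(B, b)\<in>set Bs. B + \<sigma> * b > 0"
  show "poles_left_of Bs \<sigma>"
    unfolding poles_left_of_def
  proof (clarify)
    fix B b s assume Bb: "(B, b) \<in> set Bs"
      and s: "of_real B + s * of_real b \<in> (\<int>\<^sub>\<le>\<^sub>0 :: complex set)"
    from Bb assms R have b: "b > 0" and pos: "B + \<sigma> * b > 0" by auto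
    from s obtain n where "of_real B + s * of_real b = (- of_nat n :: complex)"
      by (auto elim: nonpos_Ints_cases')
    hence "Re (of_real B + s * of_real b) = - real n" by simp
    hence "B + Re s * b \<le> 0" by simp
    with pos have "Re s * b < \<sigma> * b" by linarith
    thus "Re s < \<sigma>" using b by simp
  qed
qed

lemma ex_poles_left_of:
  assumes "\<forall>(B, b)\<in>set Bs. b > 0"
  shows "\<exists>\<sigma>. poles_left_of Bs \<sigma>"
proof -
  have "\<exists>\<sigma>. \<forall>(B, b)\<in>set Bs. B + \<sigma> * b > 0"
    using assms
  proof (induction Bs)
    case (Cons q Bs)
    obtain B b where q: "q = (B, b)" by (cases q)
    from Cons q have b: "b > 0" and pos: "\<forall>(B, b)\<in>set Bs. b > 0" by auto
    from Cons pos obtain \<sigma> where \<sigma>: "\<forall>(B, b)\<in>set Bs. B + \<sigma> * b > 0" by auto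
    define \<tau> where "\<tau> = max \<sigma> (1 - B / b)"
    have "B + (1 - B / b) * b > 0" using b by (simp add: field_simps)
    moreover have "(1 - B / b) * b \<le> \<tau> * b" using b by (intro mult_right_mono) (auto simp: \<tau>_def)
    ultimately have "B + \<tau> * b > 0" by linarith
    moreover have "B' + \<tau> * b' > 0" if "(B', b') \<in> set Bs" for B' b'
    proof -
      have "\<sigma> * b' \<le> \<tau> * b'" using that pos by (intro mult_right_mono) (auto simp: \<tau>_def)
      moreover have "B' + \<sigma> * b' > 0" using that \<sigma> by auto
      ultimately show ?thesis by linarith
    qed
    ultimately show ?case using q by auto
  qed auto
  thus ?thesis using poles_left_of_iff[OF assms] by blast
qed

definition laplace :: "(real \<Rightarrow> complex) \<Rightarrow> real \<Rightarrow> complex" where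
  "laplace f s = (LINT x:{0<..}|lborel. of_real (exp (- s * x)) * f x)"

definition laplace_measure :: "real measure \<Rightarrow> real \<Rightarrow> complex" where
  "laplace_measure M s = (LINT x|M. of_real (exp (- s * x)))"

definition c_par ::
  "param \<Rightarrow> param \<Rightarrow> param \<Rightarrow> nat \<Rightarrow> real" where
  "c_par a \<alpha> \<gamma> k = a k - \<alpha> k * \<gamma> k + \<alpha> k"

definition K1 :: "nat \<Rightarrow> param \<Rightarrow> param \<Rightarrow> real" where
  "K1 m e \<eta> = (\<Prod>i=1..m. Gamma (e i + \<eta> i))"

definition K2 :: "nat \<Rightarrow> param \<Rightarrow> param \<Rightarrow> param \<Rightarrow> real" where
  "K2 p e \<eta> b = (\<Prod>i=1..p. Gamma (e i + \<eta> i) / Gamma (e i + b i + \<eta> i))"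

definition K3 :: "nat \<Rightarrow> nat \<Rightarrow> param \<Rightarrow> param \<Rightarrow> param \<Rightarrow> real" where
  "K3 m p e \<eta> b =
     (\<Prod>i=1..p. Gamma (e i + \<eta> i) / Gamma (e i + b i + \<eta> i)) *
     (\<Prod>i=p+1..p+m. Gamma (e i + \<eta> i))"

definition K4 :: "nat \<Rightarrow> param \<Rightarrow> param \<Rightarrow> param \<Rightarrow> real" where
  "K4 l a \<alpha> \<beta> =
     (\<Prod>k=1..l. Gamma (a k + \<alpha> k) / Gamma (1 - \<beta> k + \<beta> k * a k + \<beta> k * \<alpha> k))"

definition K5 :: "nat \<Rightarrow> nat \<Rightarrow> param \<Rightarrow> param \<Rightarrow> param \<Rightarrow> param \<Rightarrow> param \<Rightarrow> real" where
  "K5 m l e \<eta> a \<alpha> \<beta> = K1 m e \<eta> * K4 l a \<alpha> \<beta>"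

definition K6 :: "nat \<Rightarrow> nat \<Rightarrow> param \<Rightarrow> param \<Rightarrow> param \<Rightarrow> param \<Rightarrow> param \<Rightarrow> param \<Rightarrow> real" where
  "K6 p l e \<eta> b a \<alpha> \<beta> = K2 p e \<eta> b * K4 l a \<alpha> \<beta>"

definition K7 :: "nat \<Rightarrow> nat \<Rightarrow> nat \<Rightarrow> param \<Rightarrow> param \<Rightarrow> param \<Rightarrow> param \<Rightarrow> param \<Rightarrow> param \<Rightarrow> real" where
  "K7 m p l e \<eta> b a \<alpha> \<beta> = K3 m p e \<eta> b * K4 l a \<alpha> \<beta>"

definition S_sum :: "nat \<Rightarrow> param \<Rightarrow> param \<Rightarrow> param \<Rightarrow> real" where
  "S_sum l \<alpha> \<beta> \<gamma> = (\<Sum>k=1..l. \<alpha> k * \<gamma> k * (1 - \<beta> k))"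

definition Delta0 :: real where "Delta0 = 1"
definition Delta1 :: "nat \<Rightarrow> param \<Rightarrow> real" where
  "Delta1 m \<eta> = 1 - (\<Sum>i=1..m. \<eta> i)"
definition Delta2 :: real where "Delta2 = 1"
definition Delta3 :: "nat \<Rightarrow> nat \<Rightarrow> param \<Rightarrow> real" where
  "Delta3 m p \<eta> = 1 - (\<Sum>i=p+1..p+m. \<eta> i)"
definition Delta4 :: "nat \<Rightarrow> param \<Rightarrow> param \<Rightarrow> param \<Rightarrow> real" where
  "Delta4 l \<alpha> \<beta> \<gamma> = 1 - S_sum l \<alpha> \<beta> \<gamma>"
definition Delta5 :: "nat \<Rightarrow> nat \<Rightarrow> param \<Rightarrow> param \<Rightarrow> param \<Rightarrow> param \<Rightarrow> real" where
  "Delta5 m l \<eta> \<alpha> \<beta> \<gamma> = 1 - (\<Sum>i=1..m. \<eta> i) - S_sum l \<alpha> \<beta> \<gamma>"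
definition Delta6 :: "nat \<Rightarrow> param \<Rightarrow> param \<Rightarrow> param \<Rightarrow> real" where
  "Delta6 l \<alpha> \<beta> \<gamma> = 1 - S_sum l \<alpha> \<beta> \<gamma>"
definition Delta7 :: "nat \<Rightarrow> nat \<Rightarrow> nat \<Rightarrow> param \<Rightarrow> param \<Rightarrow> param \<Rightarrow> param \<Rightarrow> real" where
  "Delta7 m p l \<eta> \<alpha> \<beta> \<gamma> = 1 - (\<Sum>i=p+1..p+m. \<eta> i) - S_sum l \<alpha> \<beta> \<gamma>"

definition beta_upper :: "nat \<Rightarrow> param \<Rightarrow> param \<Rightarrow> param \<Rightarrow> (real \<times> real) list" where
  "beta_upper p e \<eta> b = pars (\<lambda>i. e i + b i) \<eta> p"

definition stable_upper :: "nat \<Rightarrow> param \<Rightarrow> param \<Rightarrow> param \<Rightarrow> param \<Rightarrow> (real \<times> real) list" where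
  "stable_upper l a \<alpha> \<beta> \<gamma> =
     pars (\<lambda>k. 1 - \<beta> k + \<beta> k * c_par a \<alpha> \<gamma> k) (\<lambda>k. \<alpha> k * \<beta> k * \<gamma> k) l"

definition stable_lower :: "nat \<Rightarrow> param \<Rightarrow> param \<Rightarrow> param \<Rightarrow> (real \<times> real) list" where
  "stable_lower l a \<alpha> \<gamma> = pars (c_par a \<alpha> \<gamma>) (\<lambda>k. \<alpha> k * \<gamma> k) l"

(* The class of index 0 is the Dirac distribution at 1. The densities are kept complex valued,
   as the contour integrals are, so that their reality is not built in. They are only ever
   evaluated at x > 0, see laplace. *)
definition rho0 :: "real measure" where
  "rho0 = return borel 1"

definition rho1 :: "nat \<Rightarrow> param \<Rightarrow> param \<Rightarrow> real \<Rightarrow> complex" where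
  "rho1 m e \<eta> x = 1 / of_real (K1 m e \<eta>) * fox_H [] (pars e \<eta> m) x"

definition rho2 :: "nat \<Rightarrow> param \<Rightarrow> param \<Rightarrow> param \<Rightarrow> real \<Rightarrow> complex" where
  "rho2 p e \<eta> b x =
     (if 0 < x \<and> x < 1 then 1 / of_real (K2 p e \<eta> b) * fox_H (beta_upper p e \<eta> b) (pars e \<eta> p) x
      else 0)"

definition rho3 :: "nat \<Rightarrow> nat \<Rightarrow> param \<Rightarrow> param \<Rightarrow> param \<Rightarrow> real \<Rightarrow> complex" where
  "rho3 m p e \<eta> b x =
     1 / of_real (K3 m p e \<eta> b) * fox_H (beta_upper p e \<eta> b) (pars e \<eta> (p + m)) x"

definition rho4 :: "nat \<Rightarrow> param \<Rightarrow> param \<Rightarrow> param \<Rightarrow> param \<Rightarrow> real \<Rightarrow> complex" where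
  "rho4 l a \<alpha> \<beta> \<gamma> x =
     1 / of_real (K4 l a \<alpha> \<beta>) * fox_H (stable_upper l a \<alpha> \<beta> \<gamma>) (stable_lower l a \<alpha> \<gamma>) x"

definition rho5 :: "nat \<Rightarrow> nat \<Rightarrow> param \<Rightarrow> param \<Rightarrow> param \<Rightarrow> param \<Rightarrow> param \<Rightarrow> param \<Rightarrow> real \<Rightarrow> complex" where
  "rho5 m l e \<eta> a \<alpha> \<beta> \<gamma> x =
     1 / of_real (K5 m l e \<eta> a \<alpha> \<beta>) *
     fox_H (stable_upper l a \<alpha> \<beta> \<gamma>) (pars e \<eta> m @ stable_lower l a \<alpha> \<gamma>) x"

definition rho6 :: "nat \<Rightarrow> nat \<Rightarrow> param \<Rightarrow> param \<Rightarrow> param \<Rightarrow> param \<Rightarrow> param \<Rightarrow> param \<Rightarrow> param \<Rightarrow> real \<Rightarrow> complex" where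
  "rho6 p l e \<eta> b a \<alpha> \<beta> \<gamma> x =
     1 / of_real (K6 p l e \<eta> b a \<alpha> \<beta>) *
     fox_H (beta_upper p e \<eta> b @ stable_upper l a \<alpha> \<beta> \<gamma>) (pars e \<eta> p @ stable_lower l a \<alpha> \<gamma>) x"

definition rho7 :: "nat \<Rightarrow> nat \<Rightarrow> nat \<Rightarrow> param \<Rightarrow> param \<Rightarrow> param \<Rightarrow> param \<Rightarrow> param \<Rightarrow> param \<Rightarrow> param \<Rightarrow> real \<Rightarrow> complex" where
  "rho7 m p l e \<eta> b a \<alpha> \<beta> \<gamma> x =
     1 / of_real (K7 m p l e \<eta> b a \<alpha> \<beta>) *
     fox_H (beta_upper p e \<eta> b @ stable_upper l a \<alpha> \<beta> \<gamma>)
           (pars e \<eta> (p + m) @ stable_lower l a \<alpha> \<gamma>) x"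

definition laplace_converges :: "(real \<Rightarrow> complex) \<Rightarrow> bool" where
  "laplace_converges f \<longleftrightarrow>
     (\<forall>s\<ge>0. set_integrable lborel {0<..} (\<lambda>x. complex_of_real (exp (- s * x)) * f x))"

(* A complex-valued function of s that is real on [0, infinity) and completely monotone there. *)
definition real_completely_monotone :: "(real \<Rightarrow> complex) \<Rightarrow> bool" where
  "real_completely_monotone \<phi> \<longleftrightarrow>
     (\<forall>s\<ge>0. \<phi> s \<in> \<real>) \<and> completely_monotone_nonneg (\<lambda>s. Re (\<phi> s))"

definition entire_extension :: "(complex \<Rightarrow> complex) \<Rightarrow> (real \<Rightarrow> complex) \<Rightarrow> bool" where
  "entire_extension g \<phi> \<longleftrightarrow> g holomorphic_on UNIV \<and> (\<forall>s\<ge>0. g (of_real s) = \<phi> s)"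

end

theory Submission
  imports Defs
begin

text \<open>
  Under the substitution $x = e^y$ a Mellin transform $\int_0^\infty x^{s-1} f(x)\,dx$ becomes the
  two-sided Laplace transform $\int e^{sy} f(e^y)\,dy$. The densities $\varrho_1,\dots,\varrho_7$ are
  inverse Mellin transforms, along a vertical line, of kernels $K$ built from factors
  $\Gamma(B+bs)$ and from ratios $\Gamma(B+bs)/\Gamma(A+as)$ with $0 < a \le b$ and $aB \le bA$; both
  the beta ratios (with $a = b$) and the ratios with parameter $\beta_k$ are of the latter form.

  The reason for positivity is Gauss' limit formula for the Gamma function. It writes each factor as
  a limit of finite products of exponentials, of $1/(s+P)$ and of $(s+Q)/(s+P)$ with $Q \ge P$, and
  each of these is the transform of an explicit positive finite measure: for $(s+Q)/(s+P)$, a multiple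
  of the law of $-\max(0, E-c)$ with $E$ exponentially distributed. Transforms of positive measures are closed
  under products (convolution) and, by Helly's selection theorem, under pointwise limits on a
  strip. So $K$ is the transform of a positive measure on every strip to the right of its poles
  (\<open>strip_transform_fox_kernel\<close>).

  On a vertical line $K(\sigma+it)$ is $O(|t|^{-d})$ for some $d > 1$ (\<open>vertical_decay_fox_kernel\<close>);
  here $\sum b_i > 1$ enters, because each beta ratio contributes exactly the exponent $b_i$. Fourier
  inversion of an integrable characteristic function then shows that the measure has a continuous
  density, which is the Fox function, whatever admissible line is used (\<open>mellin_inversion\<close>). So the
  Fox function is real and nonnegative and its $n$-th moment is $K(n+1)$.

  A nonnegative density with finite moments has a completely monotone Laplace transform, by
  differentiation under the integral sign. Consecutive moments have a quotient of order
  $n^{1-\Delta}$, so that $\Delta > 0$ makes $\sum_n K(n+1)\,(-z)^n/n!$ converge everywhere; integrating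
  the exponential series term by term identifies it with the Laplace transform, and it is the Wright
  series.

  Class 0 is the point mass at 1, with transform $e^{-s}$.
  The classes 1 to 6 are the class 7 with some of $m, p, l$ equal to 0. Only class 2 differs, by the
  cut-off at $x = 1$: as the moments of its Fox function are bounded, that function vanishes almost
  everywhere beyond 1.
\<close>

section \<open>Transforms of positive measures on a strip\<close>

text \<open>
  Two-sided Laplace transforms $\int e^{sy}\,d\nu(y)$ of positive measures $\nu$ for $u \le \Re s \le v$.
  The measure \<open>M\<close> is $e^{uy}\,d\nu(y)$: unlike $\nu$ it is always finite, which convolution needs.
\<close>
definition strip_transform :: "real \<Rightarrow> real \<Rightarrow> (complex \<Rightarrow> complex) \<Rightarrow> bool" where
  "strip_transform u v K \<longleftrightarrow>
     (\<exists>M. finite_measure M \<and> sets M = sets borel \<and>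
        (\<forall>s. u \<le> Re s \<and> Re s \<le> v \<longrightarrow>
          has_bochner_integral M (\<lambda>y. exp ((s - of_real u) * of_real y)) (K s)))"

lemma strip_transformI:
  assumes "finite_measure M" "sets M = sets borel"
    and "\<And>s. u \<le> Re s \<Longrightarrow> Re s \<le> v \<Longrightarrow>
           has_bochner_integral M (\<lambda>y. exp ((s - of_real u) * of_real y)) (K s)"
  shows "strip_transform u v K"
  using assms unfolding strip_transform_def by blast

lemma strip_transformE:
  assumes "strip_transform u v K"
  obtains M where "finite_measure M" "sets M = sets borel"
    "\<And>s. u \<le> Re s \<Longrightarrow> Re s \<le> v \<Longrightarrow>
       has_bochner_integral M (\<lambda>y. exp ((s - of_real u) * of_real y)) (K s)"
  using assms unfolding strip_transform_def by blast

lemma transform_at_real: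
  assumes "has_bochner_integral M (\<lambda>y. exp ((of_real \<tau> - of_real u) * of_real y)) z"
  shows "has_bochner_integral M (\<lambda>y. exp ((\<tau> - u) * y)) (Re z)" and "z = of_real (Re z)"
proof -
  have "exp ((of_real \<tau> - of_real u) * of_real y) = complex_of_real (exp ((\<tau> - u) * y))" for y
    by (simp add: exp_of_real[symmetric])
  with assms have *: "has_bochner_integral M (\<lambda>y. complex_of_real (exp ((\<tau> - u) * y))) z"
    by simp
  from has_bochner_integral_Re[OF *] show 1: "has_bochner_integral M (\<lambda>y. exp ((\<tau> - u) * y)) (Re z)"
    by simp
  from has_bochner_integral_eq[OF * has_bochner_integral_of_real[OF 1]] show "z = of_real (Re z)" .
qed

lemma strip_transform_cong:
  assumes "strip_transform u v K" "\<And>s. u \<le> Re s \<Longrightarrow> Re s \<le> v \<Longrightarrow> K s = L s"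
  shows "strip_transform u v L"
  using assms unfolding strip_transform_def by metis

lemma strip_transform_exp: "strip_transform u v (\<lambda>s. exp (s * of_real d))"
proof (rule strip_transformI)
  let ?M = "density (return borel d) (\<lambda>_. exp (u * d))"
  interpret prob_space "return borel d" by (rule prob_space_return) simp
  show "finite_measure ?M" by (rule finite_measureI) (simp add: emeasure_density)
  show "sets ?M = sets borel" by simp
  fix s :: complex
  have "exp (u * d) *\<^sub>R exp ((s - of_real u) * of_real d) = exp (s * complex_of_real d)"
    unfolding scaleR_conv_of_real exp_of_real[symmetric]
    by (simp add: exp_add[symmetric] algebra_simps)
  moreover have "integrable (return borel d) (\<lambda>y. exp (u * d) *\<^sub>R exp ((s - of_real u) * of_real y))"
    by (subst integrable_iff_bounded) (simp add: nn_integral_return)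
  moreover have "integral\<^sup>L (return borel d) (\<lambda>y. exp (u * d) *\<^sub>R exp ((s - of_real u) * of_real y)) = 
     exp (u * d) *\<^sub>R exp ((s - of_real u) * of_real d)"
    by (rule integral_return) auto
  ultimately show "has_bochner_integral ?M (\<lambda>y. exp ((s - of_real u) * of_real y)) (exp (s * of_real d))"
    by (intro has_bochner_integral_density) 
       (simp_all add: has_bochner_integral_iff)
qed

lemma strip_transform_scale:
  assumes "strip_transform u v K" "c \<ge> 0"
  shows "strip_transform u v (\<lambda>s. of_real c * K s)"
proof -
  from assms(1) obtain M where M: "finite_measure M" "sets M = sets borel"
    "\<And>s. u \<le> Re s \<Longrightarrow> Re s \<le> v \<Longrightarrow>
       has_bochner_integral M (\<lambda>y. exp ((s - of_real u) * of_real y)) (K s)"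
    by (rule strip_transformE) blast
  interpret finite_measure M by fact
  note [measurable_cong] = M(2)
  show ?thesis
  proof (rule strip_transformI)
    show "finite_measure (density M (\<lambda>_. c))"
      by (rule finite_measureI) (simp add: emeasure_density nn_integral_cmult ennreal_mult_eq_top_iff)
    show "sets (density M (\<lambda>_. c)) = sets borel" using M by simp
    fix s assume "u \<le> Re s" "Re s \<le> v"
    from has_bochner_integral_scaleR_right[OF M(3)[OF this], of c]
    show "has_bochner_integral (density M (\<lambda>_. c)) (\<lambda>y. exp ((s - of_real u) * of_real y)) (of_real c * K s)"
      using assms(2) by (intro has_bochner_integral_density) (auto simp: scaleR_conv_of_real)
  qed
qed

lemma strip_transform_mult:
  assumes "strip_transform u v K" "strip_transform u v L"
  shows "strip_transform u v (\<lambda>s. K s * L s)"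
proof -
  from assms(1) obtain M where M: "finite_measure M" "sets M = sets borel"
    "\<And>s. u \<le> Re s \<Longrightarrow> Re s \<le> v \<Longrightarrow>
       has_bochner_integral M (\<lambda>y. exp ((s - of_real u) * of_real y)) (K s)"
    by (rule strip_transformE) blast
  from assms(2) obtain N where N: "finite_measure N" "sets N = sets borel"
    "\<And>s. u \<le> Re s \<Longrightarrow> Re s \<le> v \<Longrightarrow>
       has_bochner_integral N (\<lambda>y. exp ((s - of_real u) * of_real y)) (L s)"
    by (rule strip_transformE) blast
  interpret M: finite_measure M by fact
  interpret N: finite_measure N by fact
  interpret P: pair_sigma_finite M N ..
  note [measurable_cong] = M(2) N(2)
  show ?thesis
  proof (rule strip_transformI)
    show "finite_measure (M \<star> N)" using M N by (intro convolution_finite) auto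
    show "sets (M \<star> N) = sets borel" by simp
    fix s assume s: "u \<le> Re s" "Re s \<le> v"
    let ?e = "\<lambda>y. exp ((s - complex_of_real u) * complex_of_real y)"
    have I: "integrable M ?e" "integrable N ?e"
      and E: "integral\<^sup>L M ?e = K s" "integral\<^sup>L N ?e = L s"
      using M(3)[OF s] N(3)[OF s] by (auto simp: has_bochner_integral_iff)
    have int: "integrable (M \<Otimes>\<^sub>M N) (\<lambda>(x, y). ?e x * ?e y)"
    proof (rule P.Fubini_integrable)
      have "(\<lambda>x. \<integral>y. norm (?e x * ?e y) \<partial>N) = (\<lambda>x. norm (?e x) * (\<integral>y. norm (?e y) \<partial>N))"
        by (simp add: norm_mult)
      with I show "integrable M (\<lambda>x. \<integral>y. norm (case (x, y) of (x, y) \<Rightarrow> ?e x * ?e y) \<partial>N)"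
        by (simp del: norm_exp_eq_Re)
    qed (use I in auto)
    have "(\<integral>z. (case z of (x, y) \<Rightarrow> ?e x * ?e y) \<partial>(M \<Otimes>\<^sub>M N)) = K s * L s"
      using I E by (simp add: P.integral_fst'[OF int, symmetric])
    with int show "has_bochner_integral (M \<star> N) ?e (K s * L s)"
      unfolding convolution_def has_bochner_integral_iff
      by (subst integrable_distr_eq, (measurable)[2], subst integral_distr, (measurable)[2])
         (simp add: case_prod_unfold exp_add[symmetric] algebra_simps)
  qed
qed

lemma strip_transform_prod:
  assumes "finite I" "\<And>i. i \<in> I \<Longrightarrow> strip_transform u v (K i)"
  shows "strip_transform u v (\<lambda>s. \<Prod>i\<in>I. K i s)"
  using assms
proof (induction I rule: finite_induct)
  case empty
  from strip_transform_exp[of u v 0] show ?case by simp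
next
  case (insert i I)
  then show ?case by (simp add: strip_transform_mult)
qed

lemma exponential_density_transform:
  fixes w :: complex
  assumes l: "l > 0" and w: "Re w > - l"
  shows "has_bochner_integral lborel (\<lambda>x. exponential_density l x *\<^sub>R exp (- (w * of_real x)))
           (of_real l / (of_real l + w))"
proof -
  define r where "r = l + Re w"
  have r: "r > 0" using w by (simp add: r_def)
  let ?f = "\<lambda>x. exponential_density l x *\<^sub>R exp (- (w * complex_of_real x))"
  have lw: "of_real l + w \<noteq> 0" using w by (auto simp: complex_eq_iff)
  interpret prob_space "density lborel (exponential_density r)"
    by (rule prob_space_exponential_density[OF r])
  have "integrable (density lborel (exponential_density r)) (\<lambda>x. 1 :: real)" by simp
  then have "integrable lborel (exponential_density r)"
    by (subst (asm) integrable_density) (auto simp: exponential_density_nonneg[OF r])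
  then have "integrable lborel (\<lambda>x. l / r * exponential_density r x)" by simp
  then have int: "integrable lborel ?f"
  proof (rule Bochner_Integration.integrable_bound)
    have "norm (?f x) = l / r * exponential_density r x" for x
      using l r by (simp add: exponential_density_def mult_exp_exp) (simp add: r_def algebra_simps)
    then show "AE x in lborel. norm (?f x) \<le> norm (l / r * exponential_density r x)"
      by (intro AE_I2) (simp only: real_norm_def abs_ge_self)
  qed simp
  have "integral\<^sup>L lborel ?f = of_real l / (of_real l + w)"
  proof (rule LIMSEQ_unique)
    show "(\<lambda>n. LINT x|lborel. indicator {..real n} x *\<^sub>R ?f x) \<longlonglongrightarrow> integral\<^sup>L lborel ?f"
      using tendsto_integral_at_top[OF _ int] filterlim_compose[OF _ filterlim_real_sequentially] by simp
    have eq: "(LINT x|lborel. indicator {..real n} x *\<^sub>R ?f x) = 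
       of_real l / (of_real l + w) * (1 - exp (- ((of_real l + w) * of_real n)))" for n
    proof -
      have "(LINT x|lborel. indicator {..real n} x *\<^sub>R ?f x) =
        (LINT x|lborel. indicator {0..real n} x *\<^sub>R (of_real l * exp (- ((of_real l + w) * of_real x))))"
        by (intro Bochner_Integration.integral_cong)
           (auto simp: indicator_def exponential_density_def scaleR_conv_of_real exp_of_real exp_add[symmetric] algebra_simps
              simp flip: exp_of_real)
      also have "\<dots> = - of_real l / (of_real l + w) * exp (- ((of_real l + w) * of_real (real n)))
                   - (- of_real l / (of_real l + w) * exp (- ((of_real l + w) * of_real 0)))"
      proof (rule integral_FTC_atLeastAtMost)
        show "((\<lambda>x. - of_real l / (of_real l + w) * exp (- ((of_real l + w) * of_real x))) has_vector_derivative
            of_real l * exp (- ((of_real l + w) * of_real x))) (at x within {0..real n})" for x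
        proof -
          have "((\<lambda>x. - of_real l / \<kappa> * exp (- (\<kappa> * x))) has_field_derivative of_real l * exp (- (\<kappa> * z))) (at z)"
            if "\<kappa> \<noteq> 0" for \<kappa> z :: complex
            using that by (auto intro!: derivative_eq_intros)
          from this[OF lw] show ?thesis
            by (rule has_vector_derivative_real_field)
        qed
      qed (auto intro!: continuous_intros)
      finally show ?thesis by (simp add: algebra_simps)
    qed
    have "(\<lambda>n. norm (exp (- ((of_real l + w) * of_real (real n))))) \<longlonglongrightarrow> 0"
      using r unfolding norm_exp_eq_Re r_def by simp real_asymp
    then have "(\<lambda>n. exp (- ((of_real l + w) * of_real (real n)))) \<longlonglongrightarrow> 0"
      by (rule tendsto_norm_zero_cancel)
    then have "(\<lambda>n. of_real l / (of_real l + w) * (1 - exp (- ((of_real l + w) * of_real (real n))))) 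
       \<longlonglongrightarrow> of_real l / (of_real l + w) * (1 - 0)"
      by (intro tendsto_intros)
    then show "(\<lambda>n. LINT x|lborel. indicator {..real n} x *\<^sub>R ?f x) \<longlonglongrightarrow> of_real l / (of_real l + w)"
      unfolding eq by simp
  qed
  with int show ?thesis by (simp add: has_bochner_integral_iff)
qed

text \<open>
  By lack of memory, the excess of an exponential variable over the level \<open>c\<close> is 0 with probability
  $1 - e^{-lc}$ and is otherwise again exponential. The mixture of an atom with an exponential law is thus
  the image of a single exponential law.
\<close>
lemma censored_exponential_transform:
  fixes w :: complex
  assumes l: "l > 0" and w: "Re w > - l" and c: "c \<ge> 0"
  shows "has_bochner_integral lborel (\<lambda>x. exponential_density l x *\<^sub>R exp (- (w * of_real (max 0 (x - c)))))
           (1 - of_real (exp (- l * c)) + of_real (exp (- l * c)) * (of_real l / (of_real l + w)))"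
proof -
  let ?d = "\<lambda>w x. exponential_density l x *\<^sub>R exp (- (w * complex_of_real x))"
  have shift: "has_bochner_integral lborel (\<lambda>x. ?d w (x - c)) (of_real l / (of_real l + w))" 
    if "Re w > - l" for w
    using exponential_density_transform[OF l that]
      lborel_has_bochner_integral_real_affine_iff[of 1 "?d w" "of_real l / (of_real l + w)" "-c"]
    by (simp add: algebra_simps)
  \<comment> \<open>subtract the uncensored tail beyond $c$ and put back the shifted one\<close>
  have "has_bochner_integral lborel
     (\<lambda>x. ?d 0 x - exp (- l * c) *\<^sub>R ?d 0 (x - c) + exp (- l * c) *\<^sub>R ?d w (x - c))
     (of_real l / (of_real l + 0) - exp (- l * c) *\<^sub>R (of_real l / (of_real l + 0)) + exp (- l * c) *\<^sub>R (of_real l / (of_real l + w)))"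
    using l w by (intro has_bochner_integral_add has_bochner_integral_diff 
      has_bochner_integral_scaleR_right shift exponential_density_transform) auto
  also have "(\<lambda>x. ?d 0 x - exp (- l * c) *\<^sub>R ?d 0 (x - c) + exp (- l * c) *\<^sub>R ?d w (x - c)) =
     (\<lambda>x. exponential_density l x *\<^sub>R exp (- (w * of_real (max 0 (x - c)))))"
    using c by (auto simp: fun_eq_iff exponential_density_def max_def scaleR_conv_of_real exp_of_real algebra_simps 
        exp_add[symmetric] simp flip: exp_of_real)
  finally show ?thesis using l by (simp add: scaleR_conv_of_real)
qed

lemma strip_transform_censored:
  assumes "u + p > 0" "c \<ge> 0"
  shows "strip_transform u v (\<lambda>s. 1 - of_real (exp (- (u + p) * c)) +
    of_real (exp (- (u + p) * c)) * (of_real (u + p) / (s + of_real p)))"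
proof (rule strip_transformI)
  let ?D = "density lborel (exponential_density (u + p))"
  let ?M = "distr ?D borel (\<lambda>x. - max 0 (x - c))"
  interpret prob_space ?D
    by (rule prob_space_exponential_density[OF assms(1)])
  show "finite_measure ?M" by (intro finite_measure_distr) simp
  show "sets ?M = sets borel" by simp
  fix s assume s: "u \<le> Re s" "Re s \<le> v"
  have "has_bochner_integral ?D (\<lambda>x. exp (- ((s - u) * of_real (max 0 (x - c)))))
     (1 - of_real (exp (- (u + p) * c)) + of_real (exp (- (u + p) * c)) * (of_real (u + p) / (of_real (u + p) + (s - u))))"
    using s assms by (intro has_bochner_integral_density censored_exponential_transform) (auto simp: exponential_density_nonneg)
  then show "has_bochner_integral ?M (\<lambda>y. exp ((s - of_real u) * of_real y)) 
      (1 - of_real (exp (- (u + p) * c)) + of_real (exp (- (u + p) * c)) * (of_real (u + p) / (s + of_real p)))"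
    by (simp add: has_bochner_integral_iff integrable_distr_eq integral_distr algebra_simps)
qed

lemma strip_transform_pole:
  assumes "u + p > 0"
  shows "strip_transform u v (\<lambda>s. 1 / (s + of_real p))"
proof (rule strip_transform_cong)
  show "strip_transform u v (\<lambda>s. of_real (1 / (u + p)) * (1 - of_real (exp (- (u + p) * 0)) +
    of_real (exp (- (u + p) * 0)) * (of_real (u + p) / (s + of_real p))))"
    using assms by (intro strip_transform_scale strip_transform_censored) auto
qed (use assms in \<open>auto simp: field_simps simp del: of_real_add\<close>)

text \<open>
  Since $(s+q)/(s+p) = 1 + (q-p)/(s+p)$, the measure sought is an atom plus an exponential density with
  nonnegative weight.
\<close>
lemma strip_transform_zero_pole:
  assumes "u + p > 0" "q \<ge> p"
  shows "strip_transform u v (\<lambda>s. (s + of_real q) / (s + of_real p))"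
proof (cases "q = p")
  case True
  have "s + of_real p \<noteq> 0" if "u \<le> Re s" for s
    using that assms by (auto simp: complex_eq_iff)
  then show ?thesis
    using True by (intro strip_transform_cong[OF strip_transform_exp[of u v 0]]) simp
next
  case False
  \<comment> \<open>the censoring level that gives atom and tail their relative weights\<close>
  define c where "c = ln ((u + q) / (q - p)) / (u + p)"
  have c: "c \<ge> 0" "exp (- (u + p) * c) = (q - p) / (u + q)"
  proof -
    have "- (u + p) * c = - ln ((u + q) / (q - p))" using assms
      unfolding c_def by (simp only: minus_mult_left[symmetric]) simp
    then show "exp (- (u + p) * c) = (q - p) / (u + q)" using assms False by (simp only: exp_minus) simp
  qed (use assms False in \<open>simp add: c_def\<close>)
  show ?thesis
  proof (rule strip_transform_cong)
    show "strip_transform u v (\<lambda>s. of_real ((u + q) / (u + p)) * (1 - of_real (exp (- (u + p) * c)) +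
      of_real (exp (- (u + p) * c)) * (of_real (u + p) / (s + of_real p))))"
      using assms c by (intro strip_transform_scale strip_transform_censored) auto
    fix s assume s: "u \<le> Re s" "Re s \<le> v"
    have "s + of_real p \<noteq> 0" "complex_of_real u + of_real p \<noteq> 0" "complex_of_real u + of_real q \<noteq> 0"
      using s assms by (auto simp: complex_eq_iff)
    then show "of_real ((u + q) / (u + p)) * (1 - of_real (exp (- (u + p) * c)) +
      of_real (exp (- (u + p) * c)) * (of_real (u + p) / (s + of_real p))) = (s + of_real q) / (s + of_real p)"
      unfolding c by (simp add: divide_simps) (simp add: algebra_simps)
  qed
qed

text \<open>
  The measures behind \<open>K n\<close> are reweighted by $e^{uy} + e^{vy}$ (relative to $\nu$) and normalised. The
  slightly wider strip controls $e^{-\epsilon y} + e^{\epsilon y}$ under the reweighted measures, so these are tight.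
  The weight also turns $e^{sy}$, for $\Re s$ between $u$ and $v$, into a bounded continuous
  function, so that weak convergence of a subsequence is enough to pass to the limit for all such $s$ at
  once; dividing the weight out again gives the measure for \<open>L\<close>.
\<close>
lemma strip_transform_limit:
  fixes K :: "nat \<Rightarrow> complex \<Rightarrow> complex"
  assumes \<epsilon>: "\<epsilon> > 0" and uv: "u \<le> v"
    and K: "\<And>n. strip_transform (u - \<epsilon>) (v + \<epsilon>) (K n)"
    and lim: "\<And>s. u - \<epsilon> \<le> Re s \<Longrightarrow> Re s \<le> v + \<epsilon> \<Longrightarrow> (\<lambda>n. K n s) \<longlonglongrightarrow> L s"
    and nz: "\<And>n. K n (of_real u) \<noteq> 0" and nzL: "L (of_real u) \<noteq> 0"
  shows "strip_transform u v L"
proof -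
  have "\<exists>M. finite_measure M \<and> sets M = sets borel \<and>
        (\<forall>s. u - \<epsilon> \<le> Re s \<and> Re s \<le> v + \<epsilon> \<longrightarrow>
          has_bochner_integral M (\<lambda>y. exp ((s - of_real (u - \<epsilon>)) * of_real y)) (K n s))" for n
    using K[of n] unfolding strip_transform_def .
  then obtain M where M: "\<And>n. finite_measure (M n)" "\<And>n. sets (M n) = sets borel"
    "\<And>n s. u - \<epsilon> \<le> Re s \<Longrightarrow> Re s \<le> v + \<epsilon> \<Longrightarrow>
       has_bochner_integral (M n) (\<lambda>y. exp ((s - of_real (u - \<epsilon>)) * of_real y)) (K n s)"
    by metis
  interpret M: finite_measure "M n" for n by fact
  note [measurable_cong] = M(2)
  have space_M [simp]: "space (M n) = UNIV" for n
    using sets_eq_imp_space_eq[OF M(2)[of n]] by simp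
  define r where "r n \<sigma> = Re (K n (of_real \<sigma>))" for n \<sigma>
  have R: "has_bochner_integral (M n) (\<lambda>y. exp ((\<sigma> - u + \<epsilon>) * y)) (r n \<sigma>)"
    and KR: "K n (of_real \<sigma>) = of_real (r n \<sigma>)"
    if "u - \<epsilon> \<le> \<sigma>" "\<sigma> \<le> v + \<epsilon>" for n \<sigma>
  proof -
    have \<sigma>: "\<sigma> - u + \<epsilon> = \<sigma> - (u - \<epsilon>)" by simp
    have *: "has_bochner_integral (M n) (\<lambda>y. exp ((of_real \<sigma> - of_real (u - \<epsilon>)) * of_real y)) (K n (of_real \<sigma>))"
      using that by (intro M(3)) auto
    show "has_bochner_integral (M n) (\<lambda>y. exp ((\<sigma> - u + \<epsilon>) * y)) (r n \<sigma>)"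
      unfolding r_def \<sigma> by (rule transform_at_real(1)[OF *])
    show "K n (of_real \<sigma>) = of_real (r n \<sigma>)"
      unfolding r_def by (rule transform_at_real(2)[OF *])
  qed
  have r_nonneg: "r n \<sigma> \<ge> 0" if "u - \<epsilon> \<le> \<sigma>" "\<sigma> \<le> v + \<epsilon>" for n \<sigma>
  proof -
    have "r n \<sigma> = (LINT y|M n. exp ((\<sigma> - u + \<epsilon>) * y))"
      using R[OF that, of n] by (simp add: has_bochner_integral_iff)
    then show ?thesis by simp
  qed
  have r_lim: "(\<lambda>n. r n \<sigma>) \<longlonglongrightarrow> Re (L (of_real \<sigma>))" if "u - \<epsilon> \<le> \<sigma>" "\<sigma> \<le> v + \<epsilon>" for \<sigma>
    unfolding r_def by (intro tendsto_Re lim) (use that in auto)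
  define Z where "Z n = r n u + r n v" for n
  define Z' where "Z' = Re (L (of_real u)) + Re (L (of_real v))"
  have Zpos: "Z n > 0" for n
    using r_nonneg[of u n] r_nonneg[of v n] nz[of n] KR[of u n] uv \<epsilon>
    by (auto simp: Z_def)
  have Z_lim: "Z \<longlonglongrightarrow> Z'"
    unfolding Z_def Z'_def using uv \<epsilon> by (intro tendsto_add r_lim) auto
  have Z'pos: "Z' > 0"
  proof -
    have "Re (L (of_real u)) \<ge> 0" "Re (L (of_real v)) \<ge> 0"
      using uv \<epsilon> by (auto intro!: LIMSEQ_le_const[OF r_lim] r_nonneg)
    moreover have "(\<lambda>n. Im (K n (of_real u))) \<longlonglongrightarrow> Im (L (of_real u))"
      using uv \<epsilon> by (intro tendsto_Im lim) auto
    then have "Im (L (of_real u)) = 0"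
      using uv \<epsilon> by (simp add: KR LIMSEQ_const_iff)
    ultimately show ?thesis using nzL by (auto simp: Z'_def complex_eq_iff)
  qed
  \<comment> \<open>the measures have base point $u - \epsilon$, so this is $e^{uy} + e^{vy}$ relative to $\nu$\<close>
  define W where "W y = exp (\<epsilon> * y) + exp ((v - u + \<epsilon>) * y)" for y
  have Wpos: "W y > 0" for y by (simp add: W_def add_pos_pos)
  have [measurable]: "W \<in> borel_measurable borel" unfolding W_def[abs_def] by measurable
  have W: "has_bochner_integral (M n) (\<lambda>y. W y / Z n) 1" for n
    using has_bochner_integral_divide_zero[OF has_bochner_integral_add[OF R[of u n] R[of v n]], of "Z n"] uv \<epsilon> Zpos[of n]
    by (simp add: W_def Z_def)
  define N where "N n = density (M n) (\<lambda>y. W y / Z n)" for n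
  have N: "has_bochner_integral (N n) f x" 
    if "has_bochner_integral (M n) (\<lambda>y. (W y / Z n) *\<^sub>R f y) x" "f \<in> borel_measurable borel"
    for n and f :: "real \<Rightarrow> 'b :: {banach, second_countable_topology}" and x
    unfolding N_def using that Wpos Zpos[of n] by (intro has_bochner_integral_density) (auto intro!: AE_I2 divide_nonneg_pos less_imp_le)
  have real_dist: "real_distribution (N n)" for n
  proof -
    have "emeasure (N n) UNIV = (\<integral>\<^sup>+y. ennreal (W y / Z n) \<partial>M n)"
      unfolding N_def by (simp add: emeasure_density)
    also have "\<dots> = ennreal 1"
      using W[of n] Wpos Zpos[of n] by (subst nn_integral_eq_integral) (auto simp: has_bochner_integral_iff less_imp_le intro!: AE_I2 divide_nonneg_pos)
    finally have "prob_space (N n)" by (intro prob_spaceI) (simp add: N_def)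
    then show ?thesis
      by (simp add: real_distribution_def real_distribution_axioms_def N_def M(2))
  qed
  interpret N: real_distribution "N n" for n by (rule real_dist)
  define V where "V y = exp (- \<epsilon> * y) + exp (\<epsilon> * y)" for y
  have [measurable]: "V \<in> borel_measurable borel" unfolding V_def[abs_def] by measurable
  define B where "B n = (r n (u - \<epsilon>) + r n (v - \<epsilon>) + r n (u + \<epsilon>) + r n (v + \<epsilon>)) / Z n" for n
  have V: "has_bochner_integral (N n) V (B n)" for n
  proof (rule N)
    have "has_bochner_integral (M n) (\<lambda>y. (exp ((u - \<epsilon> - u + \<epsilon>) * y) + exp ((v - \<epsilon> - u + \<epsilon>) * y) + 
        exp ((u + \<epsilon> - u + \<epsilon>) * y) + exp ((v + \<epsilon> - u + \<epsilon>) * y)) / Z n) (B n)"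
      unfolding B_def using uv \<epsilon>
      by (intro has_bochner_integral_divide_zero has_bochner_integral_add R) auto
    also have "(\<lambda>y. (exp ((u - \<epsilon> - u + \<epsilon>) * y) + exp ((v - \<epsilon> - u + \<epsilon>) * y) + 
        exp ((u + \<epsilon> - u + \<epsilon>) * y) + exp ((v + \<epsilon> - u + \<epsilon>) * y)) / Z n) = (\<lambda>y. (W y / Z n) *\<^sub>R V y)"
      by (simp add: fun_eq_iff W_def V_def distrib_left distrib_right mult_exp_exp) (simp add: algebra_simps add_divide_distrib)
    finally show "has_bochner_integral (M n) (\<lambda>y. (W y / Z n) *\<^sub>R V y) (B n)" .
  qed simp
  have "B \<longlonglongrightarrow> (Re (L (of_real (u - \<epsilon>))) + Re (L (of_real (v - \<epsilon>))) + Re (L (of_real (u + \<epsilon>)))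
     + Re (L (of_real (v + \<epsilon>)))) / Z'"
    unfolding B_def[abs_def] using uv \<epsilon> Z'pos
    by (intro tendsto_divide tendsto_add r_lim Z_lim) auto
  then have "convergent B" by (rule convergentI)
  then obtain C where C: "C > 0" "\<And>n. \<bar>B n\<bar> \<le> C"
    using convergent_imp_Bseq[of B] unfolding Bseq_def by auto
  have "tight N"
    unfolding tight_def
  proof (intro conjI allI impI real_dist)
    fix \<delta> :: real assume \<delta>: "\<delta> > 0"
    \<comment> \<open>chosen so that Markov's inequality for $V \ge e^{\epsilon|y|}$ leaves less than $\delta$ outside $(-A, A]$\<close>
    define A where "A = max 1 ((ln (2 * C / \<delta>)) / \<epsilon>)"
    have A: "A > 0" "C * exp (- \<epsilon> * A) < \<delta>"
    proof -
      have "ln (2 * C / \<delta>) \<le> \<epsilon> * A" using \<epsilon> by (simp add: A_def max_def field_simps)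
      then have "2 * C / \<delta> \<le> exp (\<epsilon> * A)" using C \<delta> by (metis divide_pos_pos exp_le_cancel_iff exp_ln mult_pos_pos zero_less_numeral)
      then have "2 * (C * exp (- \<epsilon> * A)) \<le> \<delta>" using \<delta> by (simp add: exp_minus field_simps)
      moreover have "C * exp (- \<epsilon> * A) > 0" using C by simp
      ultimately show "C * exp (- \<epsilon> * A) < \<delta>" by linarith
    qed (simp add: A_def)
    have "measure (N n) {-A<..A} > 1 - \<delta>" for n
    proof -
      have "measure (N n) (space (N n) - {-A<..A}) = (LINT y|N n. indicator (space (N n) - {-A<..A}) y)"
        by simp
      also have "\<dots> \<le> (LINT y|N n. exp (- \<epsilon> * A) * V y)"
      proof (rule integral_mono)
        show "integrable (N n) (\<lambda>y. exp (- \<epsilon> * A) * V y)" using V[of n] by (auto simp: has_bochner_integral_iff)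
        fix y 
        show "indicator (space (N n) - {-A<..A}) y \<le> exp (- \<epsilon> * A) * V y"
        proof (cases "y \<in> {-A<..A}")
          case False
          then have "A \<le> \<bar>y\<bar>" by auto
          then have "exp (- \<epsilon> * A) * exp (\<epsilon> * \<bar>y\<bar>) \<ge> 1" using \<epsilon> by (simp add: mult_exp_exp)
          moreover have "exp (\<epsilon> * \<bar>y\<bar>) \<le> V y" by (auto simp: V_def abs_if)
          then have "exp (- \<epsilon> * A) * exp (\<epsilon> * \<bar>y\<bar>) \<le> exp (- \<epsilon> * A) * V y" by simp
          ultimately have "1 \<le> exp (- \<epsilon> * A) * V y" by linarith
          with False show ?thesis by (simp add: indicator_def)
        qed (auto simp: V_def)
      qed (simp add: N.emeasure_eq_measure)
      also have "\<dots> = exp (- \<epsilon> * A) * B n" using V[of n] by (auto simp: has_bochner_integral_iff)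
      also have "\<dots> \<le> exp (- \<epsilon> * A) * C" using C(2)[of n] by simp
      also have "\<dots> < \<delta>" using A by (simp add: mult.commute)
      finally show ?thesis by (subst (asm) N.prob_compl) auto
    qed
    with A show "\<exists>a b. a < b \<and> (\<forall>n. measure (N n) {a<..b} > 1 - \<delta>)"
      by (intro exI[of _ "-A"] exI[of _ A]) auto
  qed
  then obtain k M' where k: "strict_mono k" and M': "real_distribution M'" 
    and wc: "weak_conv_m (N \<circ> id \<circ> k) M'"
    using tight_imp_convergent_subsubsequence[of N id] by (auto simp: strict_mono_def)
  interpret M': real_distribution M' by fact
  have norm_pos: "1 + exp ((v - u) * y) > 0" for y by (simp add: add_pos_pos)
  have lim_int: "has_bochner_integral M' (\<lambda>y. exp ((s - of_real u) * of_real y) / of_real (1 + exp ((v - u) * y))) (L s / of_real Z')"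
    (is "has_bochner_integral M' ?h _")
    if s: "u \<le> Re s" "Re s \<le> v" for s
  proof -
    have cont: "isCont ?h y" for y
      using norm_pos[of y] by (intro continuous_intros) (auto simp del: of_real_add)
    have [measurable]: "?h \<in> borel_measurable borel"
      using cont by (intro borel_measurable_continuous_onI continuous_at_imp_continuous_on) auto
    have bound: "norm (?h y) \<le> 1" for y
    proof -
      have "exp ((Re s - u) * y) \<le> 1 + exp ((v - u) * y)"
      proof (cases "y \<ge> 0")
        case True
        then have "exp ((Re s - u) * y) \<le> exp ((v - u) * y)" using s by (simp add: mult_right_mono)
        then show ?thesis by linarith
      next
        case False
        then have "exp ((Re s - u) * y) \<le> 1" using s by (simp add: mult_nonneg_nonpos)
        then show ?thesis using exp_gt_zero[of "(v - u) * y"] by linarith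
      qed
      then show ?thesis using norm_pos[of y] by (simp add: norm_divide del: of_real_add)
    qed
    have "has_bochner_integral (N n) ?h (K n s / of_real (Z n))" for n
    proof (rule N)
      have "(W y / Z n) *\<^sub>R ?h y = exp ((s - of_real (u - \<epsilon>)) * of_real y) / of_real (Z n)" for y
      proof -
        have W': "W y = exp (\<epsilon> * y) * (1 + exp ((v - u) * y))"
          by (simp add: W_def distrib_left mult_exp_exp algebra_simps)
        have "(W y / Z n) *\<^sub>R ?h y = of_real (exp (\<epsilon> * y)) * exp ((s - of_real u) * of_real y) / of_real (Z n)"
          unfolding W' using norm_pos[of y] by (simp add: scaleR_conv_of_real del: of_real_add)
        also have "of_real (exp (\<epsilon> * y)) * exp ((s - of_real u) * of_real y) = exp ((s - of_real (u - \<epsilon>)) * of_real y)"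
          unfolding exp_of_real[symmetric] mult_exp_exp by (simp add: algebra_simps)
        finally show ?thesis .
      qed
      then show "has_bochner_integral (M n) (\<lambda>y. (W y / Z n) *\<^sub>R ?h y) (K n s / of_real (Z n))"
        using s \<epsilon> by (simp only: ) (intro has_bochner_integral_divide_zero M(3); simp)
    qed simp
    then have "(LINT y|(N \<circ> id \<circ> k) n. ?h y) = K (k n) s / of_real (Z (k n))" for n
      by (simp add: has_bochner_integral_iff)
    moreover have "(\<lambda>n. LINT y|(N \<circ> id \<circ> k) n. ?h y) \<longlonglongrightarrow> (LINT y|M'. ?h y)"
      by (rule weak_conv_imp_integral_bdd_continuous_conv[OF _ M' wc cont bound]) (simp add: real_dist)
    moreover have "(\<lambda>n. K n s / of_real (Z n)) \<longlonglongrightarrow> L s / of_real Z'"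
      using s \<epsilon> Z'pos by (intro tendsto_intros lim Z_lim) auto
    from LIMSEQ_subseq_LIMSEQ[OF this k] have "(\<lambda>n. K (k n) s / of_real (Z (k n))) \<longlonglongrightarrow> L s / of_real Z'"
      by (simp add: o_def)
    ultimately have "(LINT y|M'. ?h y) = L s / of_real Z'" by (simp add: LIMSEQ_unique)
    moreover have "integrable M' ?h"
      using bound by (intro M'.integrable_const_bound[of _ 1]) auto
    ultimately show ?thesis by (simp add: has_bochner_integral_iff)
  qed
  show ?thesis
  proof (rule strip_transformI)
    let ?D = "density M' (\<lambda>y. Z' / (1 + exp ((v - u) * y)))"
    have "emeasure ?D UNIV = (\<integral>\<^sup>+y. ennreal (Z' / (1 + exp ((v - u) * y))) \<partial>M')"
      by (simp add: emeasure_density)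
    also have "\<dots> \<le> (\<integral>\<^sup>+y. ennreal Z' \<partial>M')"
      using Z'pos norm_pos by (intro nn_integral_mono ennreal_leI) (auto simp: field_simps)
    also have "\<dots> = ennreal Z'" using M'.emeasure_space_1 by simp
    finally show "finite_measure ?D" by (intro finite_measureI) (auto simp: top_unique)
    show "sets ?D = sets borel" by simp
    fix s assume s: "u \<le> Re s" "Re s \<le> v"
    have "of_real Z' * (exp ((s - of_real u) * of_real y) / of_real (1 + exp ((v - u) * y))) =
       (Z' / (1 + exp ((v - u) * y))) *\<^sub>R exp ((s - of_real u) * of_real y)" for y
      by (simp add: scaleR_conv_of_real)
    with has_bochner_integral_mult_right[OF lim_int[OF s], of "of_real Z'"]
    have "has_bochner_integral M' (\<lambda>y. (Z' / (1 + exp ((v - u) * y))) *\<^sub>R exp ((s - of_real u) * of_real y)) (L s)"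
      using Z'pos by (simp only:) simp
    then show "has_bochner_integral ?D (\<lambda>y. exp ((s - of_real u) * of_real y)) (L s)"
      using Z'pos norm_pos by (intro has_bochner_integral_density) (auto intro!: AE_I2 divide_nonneg_pos less_imp_le)
  qed
qed

section \<open>Gamma functions and their ratios as transforms\<close>

lemma not_nonpos_Ints_if_Re_pos: "Re z > 0 \<Longrightarrow> z \<notin> \<int>\<^sub>\<le>\<^sub>0"
  by (auto elim!: nonpos_Ints_cases')

text \<open>
  Gauss' product has its poles at $-(B+k)/b$, which makes each approximant a positive multiple of an
  exponential times factors $1/(s+P)$.
\<close>
lemma Gamma_series_affine_eq:
  fixes s :: complex
  assumes "b > 0"
  shows "Gamma_series (of_real B + s * of_real b) n =
    of_real (fact n * exp (B * ln n) / b ^ (n + 1)) * (exp (s * of_real (b * ln n)) *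
    (\<Prod>k\<le>n. 1 / (s + of_real ((B + real k) / b))))"
proof -
  have "pochhammer (of_real B + s * of_real b) (n + 1) = (\<Prod>k\<le>n. of_real b * (s + of_real ((B + real k) / b)))"
    unfolding pochhammer_prod using assms
    by (intro prod.cong) (auto simp: field_simps atLeast0LessThan lessThan_Suc_atMost)
  also have "\<dots> = of_real b ^ (n + 1) * (\<Prod>k\<le>n. s + of_real ((B + real k) / b))"
    by (simp add: prod.distrib)
  finally show ?thesis
    unfolding Gamma_series_def
    by (simp add: distrib_right exp_add exp_of_real prod_dividef del: of_real_divide)
       (simp add: exp_of_real[symmetric] mult_ac)
qed

text \<open>
  In the quotient of two Gauss products the pole at $-(B+k)/b$ is paired with the zero at $-(A+k)/a$.
\<close>
lemma Gamma_series_ratio_eq: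
  fixes s :: complex
  assumes "a > 0" "b > 0"
  shows "Gamma_series (of_real B + s * of_real b) n / Gamma_series (of_real A + s * of_real a) n =
    of_real (exp ((B - A) * ln n) * (a / b) ^ (n + 1)) * (exp (s * of_real ((b - a) * ln n)) *
    (\<Prod>k\<le>n. (s + of_real ((A + real k) / a)) / (s + of_real ((B + real k) / b))))"
proof -
  have "exp ((B - A) * ln n) = exp (B * ln n) / exp (A * ln n)"
    by (simp add: exp_diff left_diff_distrib)
  moreover have "exp (s * of_real ((b - a) * ln n)) = exp (s * of_real (b * ln n)) / exp (s * of_real (a * ln n))"
    by (simp add: exp_diff left_diff_distrib right_diff_distrib)
  ultimately show ?thesis
    unfolding Gamma_series_affine_eq[OF assms(1)] Gamma_series_affine_eq[OF assms(2)] prod_dividef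
    using assms by (simp add: power_divide del: of_real_divide) (simp add: field_simps)
qed

lemma Gamma_series_nonzero:
  "Re z > 0 \<Longrightarrow> Gamma_series z n \<noteq> (0 :: complex)"
  using not_nonpos_Ints_if_Re_pos[of z]
  by (auto simp: Gamma_series_def pochhammer_eq_0_iff simp del: pochhammer_Suc)

lemma Gamma_nonzero_if_Re_pos: "Re z > 0 \<Longrightarrow> Gamma z \<noteq> (0 :: complex)"
  using not_nonpos_Ints_if_Re_pos[of z] by (simp add: Gamma_eq_zero_iff)

lemma strip_transform_Gamma:
  assumes b: "b > 0" and u: "B + u * b > 0" and uv: "u \<le> v"
  shows "strip_transform u v (\<lambda>s. Gamma (of_real B + s * of_real b))"
proof -
  define \<epsilon> where "\<epsilon> = (u + B / b) / 2"
  have \<epsilon>: "\<epsilon> > 0" "u - \<epsilon> + B / b > 0"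
    using b u by (auto simp: \<epsilon>_def field_simps)
  have pos: "B + \<sigma> * b > 0" if "u - \<epsilon> \<le> \<sigma>" for \<sigma>
  proof -
    have "\<sigma> + B / b > 0" using that \<epsilon> by linarith
    then show ?thesis using b by (simp add: field_simps)
  qed
  show ?thesis
  proof (rule strip_transform_limit[OF \<epsilon>(1) uv])
    show "strip_transform (u - \<epsilon>) (v + \<epsilon>) (\<lambda>s. Gamma_series (of_real B + s * of_real b) n)" for n
      unfolding Gamma_series_affine_eq[OF b]
    proof (intro strip_transform_scale strip_transform_mult strip_transform_exp strip_transform_prod strip_transform_pole)
      fix k :: nat
      have "B / b \<le> (B + k) / b" using b by (simp add: divide_right_mono)
      with \<epsilon> show "u - \<epsilon> + (B + k) / b > 0" by linarith
    qed (use b in auto)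
    show "Gamma_series (of_real B + complex_of_real u * of_real b) n \<noteq> 0" for n
      using u by (simp add: Gamma_series_nonzero)
    show "Gamma (of_real B + complex_of_real u * of_real b) \<noteq> 0"
      using u by (simp add: Gamma_nonzero_if_Re_pos)
  qed (rule Gamma_series_LIMSEQ)
qed

text \<open>
  The conditions on the parameters say that $(B+k)/b \le (A+k)/a$ for all $k$, so that every paired factor
  is of the form $(s+Q)/(s+P)$ with $Q \ge P$.
\<close>
lemma strip_transform_Gamma_ratio:
  assumes ab: "0 < a" "a \<le> b" and AB: "a * B \<le> b * A" and u: "B + u * b > 0" and uv: "u \<le> v"
  shows "strip_transform u v (\<lambda>s. Gamma (of_real B + s * of_real b) / Gamma (of_real A + s * of_real a))"
proof -
  have b: "b > 0" using ab by simp
  define \<epsilon> where "\<epsilon> = (u + B / b) / 2"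
  have \<epsilon>: "\<epsilon> > 0" "u - \<epsilon> + B / b > 0"
    using b u by (auto simp: \<epsilon>_def field_simps)
  have le: "(B + real k) / b \<le> (A + real k) / a" for k
  proof -
    have "a * (B + real k) \<le> b * (A + real k)"
      using AB ab by (simp add: distrib_left add_mono mult_right_mono)
    then show ?thesis using ab b by (simp add: field_simps)
  qed
  have pos: "B + \<sigma> * b > 0" "A + \<sigma> * a > 0" if "u - \<epsilon> \<le> \<sigma>" for \<sigma>
  proof -
    have *: "\<sigma> + B / b > 0" using that \<epsilon> by linarith
    then show "B + \<sigma> * b > 0" using b by (simp add: field_simps)
    have "\<sigma> + A / a > 0" using * le[of 0] by simp
    then show "A + \<sigma> * a > 0" using ab by (simp add: field_simps)
  qed
  show ?thesis
  proof (rule strip_transform_limit[OF \<epsilon>(1) uv])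
    show "strip_transform (u - \<epsilon>) (v + \<epsilon>)
      (\<lambda>s. Gamma_series (of_real B + s * of_real b) n / Gamma_series (of_real A + s * of_real a) n)" for n
      unfolding Gamma_series_ratio_eq[OF ab(1) b]
    proof (intro strip_transform_scale strip_transform_mult strip_transform_exp strip_transform_prod strip_transform_zero_pole le)
      fix k :: nat
      have "B / b \<le> (B + k) / b" using b by (simp add: divide_right_mono)
      with \<epsilon> show "u - \<epsilon> + (B + k) / b > 0" by linarith
    qed (use b ab in auto)
    show "Gamma_series (of_real B + complex_of_real u * of_real b) n / Gamma_series (of_real A + complex_of_real u * of_real a) n \<noteq> 0" for n
      using pos[of u] \<epsilon> by (simp add: Gamma_series_nonzero)
    show "Gamma (of_real B + complex_of_real u * of_real b) / Gamma (of_real A + complex_of_real u * of_real a) \<noteq> 0"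
      using pos[of u] \<epsilon> by (simp add: Gamma_nonzero_if_Re_pos)
    show "(\<lambda>n. Gamma_series (of_real B + s * of_real b) n / Gamma_series (of_real A + s * of_real a) n) \<longlonglongrightarrow>
      Gamma (of_real B + s * of_real b) / Gamma (of_real A + s * of_real a)"
      if "u - \<epsilon> \<le> Re s" "Re s \<le> v + \<epsilon>" for s
      using pos[OF that(1)] by (intro tendsto_divide Gamma_series_LIMSEQ Gamma_nonzero_if_Re_pos) simp
  qed
qed

section \<open>Distributions with an integrable characteristic function\<close>

context real_distribution
begin

definition char_density :: "real \<Rightarrow> complex" where
  "char_density y = 1 / (2 * of_real pi) * (CLINT t|lborel. iexp (- (t * y)) * char M t)"

context
  assumes int_char: "integrable lborel (char M)"
begin

lemma integrable_iexp_char: "integrable lborel (\<lambda>t. iexp (- (t * y)) * char M t)"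
  by (rule Bochner_Integration.integrable_bound[OF int_char]) (auto simp: norm_mult)

lemma isCont_char_density: "isCont char_density y"
proof -
  have "(\<lambda>n. char_density (x n)) \<longlonglongrightarrow> char_density y" if "x \<longlonglongrightarrow> y" for x
  proof -
    have "(\<lambda>n. CLINT t|lborel. iexp (- (t * x n)) * char M t) \<longlonglongrightarrow> (CLINT t|lborel. iexp (- (t * y)) * char M t)"
    proof (rule integral_dominated_convergence[where w = "\<lambda>t. norm (char M t)"])
      show "AE t in lborel. (\<lambda>n. iexp (- (t * x n)) * char M t) \<longlonglongrightarrow> iexp (- (t * y)) * char M t"
        by (intro AE_I2 tendsto_intros that)
    qed (use int_char in \<open>auto simp: norm_mult\<close>)
    then show ?thesis unfolding char_density_def by (intro tendsto_mult tendsto_const)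
  qed
  then show ?thesis
    by (auto simp: continuous_at_sequentially o_def)
qed

text \<open>
  Levy's inversion formula, in which the principal value is an absolutely convergent integral because the
  characteristic function is integrable; Fubini's theorem turns it into the integral of the candidate
  density.
\<close>
lemma integral_char_density:
  assumes ab: "a < b" and null: "measure M {a} = 0" "measure M {b} = 0"
  shows "(CLBINT y=a..b. char_density y) = of_real (measure M {a<..b})"
proof -
  \<comment> \<open>the integral of $e^{-ity}$ over $[a,b]$, with its limit as value at $t = 0$\<close>
  define F where "F t = (if t = 0 then of_real (b - a) else (iexp (-(t * a)) - iexp (-(t * b))) / (\<i> * of_real t))" for t :: real
  have F: "(CLBINT y:{a..b}. iexp (- (t * y))) = F t" for t
  proof (cases "t = 0")
    case True
    then show ?thesis using ab by (simp add: F_def set_lebesgue_integral_def scaleR_conv_of_real)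
  next
    case False
    have "(CLBINT y:{a..b}. iexp (- (t * y))) = \<i> / of_real t * iexp (- (t * b)) - \<i> / of_real t * iexp (- (t * a))"
      unfolding set_lebesgue_integral_def
    proof (rule integral_FTC_atLeastAtMost)
      show "((\<lambda>y. \<i> / of_real t * iexp (- (t * y))) has_vector_derivative iexp (- (t * y))) (at y within {a..b})" for y
      proof -
        have "((\<lambda>y. \<i> / of_real t * exp (\<i> * - (of_real t * y))) has_field_derivative exp (\<i> * - (of_real t * z))) (at z)" for z
          using False by (auto intro!: derivative_eq_intros)
        from has_vector_derivative_real_field[OF this, of y "{a..b}"] show ?thesis by simp
      qed
    qed (use ab in \<open>auto intro!: continuous_intros\<close>)
    also have "\<dots> = F t" using False by (simp add: F_def field_simps)
    finally show ?thesis .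
  qed
  have F_bound: "norm (F t) \<le> b - a" for t
  proof -
    have "norm (F t) \<le> (LBINT y:{a..b}. norm (iexp (- (t * y))))"
      unfolding F[symmetric] 
      by (rule set_integral_norm_bound) (auto intro!: borel_integrable_atLeastAtMost' continuous_intros)
    also have "\<dots> = b - a" using ab by (simp add: set_lebesgue_integral_def)
    finally show ?thesis .
  qed
  have [measurable]: "F \<in> borel_measurable borel"
    unfolding F_def[abs_def] by measurable
  have intF: "integrable lborel (\<lambda>t. F t * char M t)"
  proof (rule Bochner_Integration.integrable_bound)
    show "integrable lborel (\<lambda>t. (b - a) * norm (char M t))" using int_char by simp
    show "AE t in lborel. norm (F t * char M t) \<le> norm ((b - a) * norm (char M t))"
      using F_bound ab by (auto simp: norm_mult intro!: mult_right_mono)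
  qed simp
  have "(\<lambda>n. CLINT t|lborel. indicator {- real n<..<real n} t *\<^sub>R (F t * char M t)) \<longlonglongrightarrow> (CLINT t|lborel. F t * char M t)"
  proof (rule integral_dominated_convergence[where w = "\<lambda>t. norm (F t * char M t)"])
    show "AE t in lborel. (\<lambda>n. indicator {- real n<..<real n} t *\<^sub>R (F t * char M t)) \<longlonglongrightarrow> F t * char M t"
    proof (intro AE_I2 tendsto_eventually)
      fix t :: real
      obtain N :: nat where N: "\<bar>t\<bar> < real N" using reals_Archimedean2 by blast
      have "indicator {- real n<..<real n} t *\<^sub>R (F t * char M t) = F t * char M t" if "n \<ge> N" for n
      proof -
        have "real N \<le> real n" using that by simp
        with N have "t \<in> {- real n<..<real n}" by (auto simp: abs_less_iff)
        then show ?thesis by simp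
      qed
      then show "eventually (\<lambda>n. indicator {- real n<..<real n} t *\<^sub>R (F t * char M t) = F t * char M t) sequentially"
        by (auto simp: eventually_sequentially)
    qed
    show "AE t in lborel. norm (indicator {- real n<..<real n} t *\<^sub>R (F t * char M t)) \<le> norm (F t * char M t)" for n
      by (intro AE_I2) (simp add: indicator_def)
    show "integrable lborel (\<lambda>t. norm (F t * char M t))"
      using intF by (rule integrable_norm)
  qed simp_all
  then have "(\<lambda>n. 1 / (2 * of_real pi) * (CLINT t|lborel. indicator {- real n<..<real n} t *\<^sub>R (F t * char M t)))
     \<longlonglongrightarrow> 1 / (2 * of_real pi) * (CLINT t|lborel. F t * char M t)"
    by (intro tendsto_intros)
  moreover have "(CLINT t|lborel. indicator {- real n<..<real n} t *\<^sub>R (F t * char M t)) =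
     (CLBINT t=-real n..real n. (iexp (-(t * a)) - iexp (-(t * b))) / (\<i> * t) * char M t)" for n
  proof -
    have "(CLBINT t=-real n..real n. (iexp (-(t * a)) - iexp (-(t * b))) / (\<i> * t) * char M t) =
       (CLINT t|lborel. indicator {- real n<..<real n} t *\<^sub>R ((iexp (-(t * a)) - iexp (-(t * b))) / (\<i> * t) * char M t))"
      by (simp add: interval_lebesgue_integral_def set_lebesgue_integral_def)
    also have "\<dots> = (CLINT t|lborel. indicator {- real n<..<real n} t *\<^sub>R (F t * char M t))"
    proof (rule integral_cong_AE)
      show "AE t in lborel. indicator {- real n<..<real n} t *\<^sub>R ((iexp (-(t * a)) - iexp (-(t * b))) / (\<i> * t) * char M t)
          = indicator {- real n<..<real n} t *\<^sub>R (F t * char M t)"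
        using AE_lborel_singleton[of 0] by eventually_elim (simp add: F_def)
    qed measurable
    finally show ?thesis ..
  qed
  moreover note Levy_Inversion[OF less_imp_le[OF ab] null]
  ultimately have *: "of_real (measure M {a<..b}) = 1 / (2 * of_real pi) * (CLINT t|lborel. F t * char M t)"
    by (intro LIMSEQ_unique) auto
  have int2: "integrable (lborel \<Otimes>\<^sub>M lborel) (\<lambda>(y, t). indicator {a..b} y *\<^sub>R (iexp (- (t * y)) * char M t))"
  proof (rule lborel_pair.Fubini_integrable)
    have "integrable lborel (\<lambda>y. indicator {a..b} y *\<^sub>R (LBINT t. norm (char M t)))"
      using ab by (intro integrable_scaleR_left integrable_real_indicator) auto
    then show "integrable lborel (\<lambda>y. LBINT t. norm (case (y, t) of (y, t) \<Rightarrow> indicator {a..b} y *\<^sub>R (iexp (- (t * y)) * char M t)))"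
      by (simp add: norm_mult)
    show "AE y in lborel. integrable lborel (\<lambda>t. case (y, t) of (y, t) \<Rightarrow> indicator {a..b} y *\<^sub>R (iexp (- (t * y)) * char M t))"
      unfolding prod.case by (intro AE_I2 integrable_scaleR_right integrable_iexp_char)
  qed simp
  have "(CLBINT y=a..b. char_density y) = 1 / (2 * of_real pi) * (CLBINT y. CLBINT t. indicator {a..b} y *\<^sub>R (iexp (- (t * y)) * char M t))"
    using ab by (simp add: interval_integral_Icc set_lebesgue_integral_def char_density_def)
  also have "(CLBINT y. CLBINT t. indicator {a..b} y *\<^sub>R (iexp (- (t * y)) * char M t)) =
     (CLBINT t. CLBINT y. indicator {a..b} y *\<^sub>R (iexp (- (t * y)) * char M t))"
    using lborel_pair.Fubini_integral[OF int2] by simp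
  also have "\<dots> = (CLBINT t. F t * char M t)"
    unfolding F[symmetric] set_lebesgue_integral_def integral_mult_left_zero[symmetric]
    by (simp only: mult_scaleR_left)
  finally show ?thesis using * by simp
qed

text \<open>
  The inversion formula gives the increments of the distribution function only between continuity points.
  These are dense, and the distribution function is right continuous, so it differs from a primitive of the
  candidate density by a constant.
\<close>
lemma cdf_has_derivative_char_density:
  "((\<lambda>x. complex_of_real (cdf M x)) has_vector_derivative char_density x) (at x)"
proof -
  have cont_on: "continuous_on A char_density" for A
    by (intro continuous_at_imp_continuous_on ballI isCont_char_density)
  obtain P where P: "\<And>x. (P has_vector_derivative char_density x) (at x)"
    using einterval_antiderivative[of "-\<infinity>" "\<infinity>" char_density] isCont_char_density by auto
  define H where "H x = complex_of_real (cdf M x) - P x" for x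
  have sub: "P b - P a = (CLBINT y=a..b. char_density y)" for a b
    by (rule interval_integral_FTC_finite[symmetric])
       (auto intro: cont_on has_vector_derivative_at_within P)
  have count: "countable {x. measure M {x} \<noteq> 0}" by (rule countable_support)
  have "H a = H b" if "a < b" "measure M {a} = 0" "measure M {b} = 0" for a b
    using integral_char_density[OF that] cdf_diff_eq[OF that(1)] sub[of b a]
    by (simp add: H_def algebra_simps flip: of_real_diff)
  then have Hc: "H a = H b" if "measure M {a} = 0" "measure M {b} = 0" for a b
    using that by (metis linorder_neqE_linordered_idom)
  obtain z where z: "measure M {z} = 0"
    using open_minus_countable[OF count, of UNIV] by auto
  have "H x = H z" for x
  proof (rule ccontr)
    assume ne: "H x \<noteq> H z"
    have "isCont P x" using P by (rule has_vector_derivative_continuous)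
    then have "(P \<longlongrightarrow> P x) (at_right x)"
      unfolding isCont_def by (rule tendsto_within_subset) simp
    then have "(H \<longlongrightarrow> H x) (at_right x)"
      unfolding H_def using cdf_is_right_cont[of x]
      by (intro tendsto_intros) (auto simp: continuous_within)
    from tendstoD[OF this, of "dist (H x) (H z)"] ne
    have "eventually (\<lambda>y. dist (H y) (H x) < dist (H x) (H z)) (at_right x)" by simp
    then obtain d where d: "d > x" "\<And>y. x < y \<Longrightarrow> y < d \<Longrightarrow> dist (H y) (H x) < dist (H x) (H z)"
      by (auto simp: eventually_at_right[OF less_add_one])
    obtain y where "x < y" "y < d" "measure M {y} = 0"
      using open_minus_countable[OF count, of "{x<..<d}"] d(1) by auto
    with d(2)[of y] Hc[of y z] z show False by (simp add: dist_commute)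
  qed
  then have "(\<lambda>x. complex_of_real (cdf M x)) = (\<lambda>x. H z + P x)"
    by (auto simp: H_def fun_eq_iff algebra_simps)
  moreover have "((\<lambda>x. H z + P x) has_vector_derivative 0 + char_density x) (at x)"
    by (intro has_vector_derivative_add has_vector_derivative_const P)
  ultimately show ?thesis by simp
qed

text \<open>
  Realness and nonnegativity of the inversion integral come for free: it is the derivative of a real
  nondecreasing function.
\<close>
lemma cdf_has_real_derivative_char_density: "(cdf M has_real_derivative Re (char_density x)) (at x)"
  and char_density_real: "Im (char_density x) = 0"
proof -
  have *: "(cdf M has_real_derivative Re (char_density x)) (at x)" 
    "((\<lambda>x. 0 :: real) has_real_derivative Im (char_density x)) (at x)"
    using cdf_has_derivative_char_density[of x] unfolding has_vector_derivative_complex_iff by simp_all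
  from *(1) show "(cdf M has_real_derivative Re (char_density x)) (at x)" .
  from DERIV_unique[OF *(2) DERIV_const] show "Im (char_density x) = 0" .
qed

lemma char_density_nonneg: "Re (char_density x) \<ge> 0"
  by (rule mono_on_imp_deriv_nonneg[OF _ cdf_has_real_derivative_char_density, where A = UNIV])
     (auto intro: mono_onI cdf_nondecreasing)

lemma char_density_measurable [measurable]: "char_density \<in> borel_measurable borel"
  by (intro borel_measurable_continuous_onI continuous_at_imp_continuous_on ballI isCont_char_density)

lemma distribution_eq_char_density: "M = density lborel (\<lambda>y. Re (char_density y))"
proof (rule measure_eqI_lessThan)
  show "sets M = sets borel" by simp
  show "sets (density lborel (\<lambda>y. Re (char_density y))) = sets borel" by simp
  fix x :: real
  show "emeasure M {x<..} < \<infinity>" by (simp add: emeasure_eq_measure)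
  have "emeasure (density lborel (\<lambda>y. Re (char_density y))) {x<..} =
    (\<integral>\<^sup>+y. ennreal (Re (char_density y)) * indicator {x..} y \<partial>lborel)"
  proof (subst emeasure_density)
    have "AE y in lborel. ennreal (Re (char_density y)) * indicator {x<..} y = ennreal (Re (char_density y)) * indicator {x..} y"
      using AE_lborel_singleton[of x] by eventually_elim (auto simp: indicator_def)
    then show "(\<integral>\<^sup>+y. ennreal (Re (char_density y)) * indicator {x<..} y \<partial>lborel) =
      (\<integral>\<^sup>+y. ennreal (Re (char_density y)) * indicator {x..} y \<partial>lborel)"
      by (rule nn_integral_cong_AE)
  qed simp_all
  also have "\<dots> = ennreal (1 - cdf M x)"
    by (rule nn_integral_FTC_atLeast)
       (auto intro: cdf_has_real_derivative_char_density char_density_nonneg cdf_lim_at_top_prob)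
  also have "1 - cdf M x = measure M (space M - {..x})"
    by (subst prob_compl) (auto simp: cdf_def)
  also have "space M - {..x} = {x<..}" by auto
  finally show "emeasure M {x<..} = emeasure (density lborel (\<lambda>y. Re (char_density y))) {x<..}"
    by (simp add: emeasure_eq_measure)
qed

end
end

section \<open>Decay on vertical lines\<close>

lemma strip_transform_norm_le:
  assumes "strip_transform u v K" "u \<le> Re s" "Re s \<le> v"
  shows "norm (K s) \<le> Re (K (of_real (Re s)))"
proof -
  from assms(1) obtain M where M: "\<And>s. u \<le> Re s \<Longrightarrow> Re s \<le> v \<Longrightarrow>
       has_bochner_integral M (\<lambda>y. exp ((s - of_real u) * of_real y)) (K s)"
    by (rule strip_transformE) blast
  have *: "has_bochner_integral M (\<lambda>y. exp ((Re s - u) * y)) (Re (K (of_real (Re s))))"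
    using assms by (intro transform_at_real M) auto
  have "norm (K s) = norm (LINT y|M. exp ((s - of_real u) * of_real y))"
    using M[of s] assms by (simp add: has_bochner_integral_iff)
  also have "\<dots> \<le> (LINT y|M. norm (exp ((s - of_real u) * of_real y)))"
    by (rule integral_norm_bound)
  also have "\<dots> = (LINT y|M. exp ((Re s - u) * y))"
    by simp
  also have "\<dots> = Re (K (of_real (Re s)))"
    using * by (simp add: has_bochner_integral_iff)
  finally show ?thesis .
qed

lemma one_plus_sq_pos: "0 < 1 + t\<^sup>2" for t :: real
  by (simp add: add_pos_nonneg)

definition vertical_decay :: "real \<Rightarrow> real \<Rightarrow> (complex \<Rightarrow> complex) \<Rightarrow> bool" where
  "vertical_decay \<sigma> d K \<longleftrightarrow> (\<exists>C\<ge>0. \<forall>t. norm (K (Complex \<sigma> t)) \<le> C * (1 + t\<^sup>2) powr (- d / 2))"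

lemma vertical_decayI:
  assumes "C \<ge> 0" "\<And>t. norm (K (Complex \<sigma> t)) \<le> C * (1 + t\<^sup>2) powr (- d / 2)"
  shows "vertical_decay \<sigma> d K"
  using assms unfolding vertical_decay_def by blast

lemma vertical_decay_mult:
  assumes "vertical_decay \<sigma> d K" "vertical_decay \<sigma> d' L"
  shows "vertical_decay \<sigma> (d + d') (\<lambda>s. K s * L s)"
proof -
  obtain C C' where C: "C \<ge> 0" "C' \<ge> 0" "\<And>t. norm (K (Complex \<sigma> t)) \<le> C * (1 + t\<^sup>2) powr (- d / 2)"
    "\<And>t. norm (L (Complex \<sigma> t)) \<le> C' * (1 + t\<^sup>2) powr (- d' / 2)"
    using assms unfolding vertical_decay_def by blast
  show ?thesis
  proof (rule vertical_decayI)
    show "0 \<le> C * C'" using C by simp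
    fix t :: real
    have "norm (K (Complex \<sigma> t) * L (Complex \<sigma> t)) \<le> (C * (1 + t\<^sup>2) powr (- d / 2)) * (C' * (1 + t\<^sup>2) powr (- d' / 2))"
      unfolding norm_mult using C by (intro mult_mono) auto
    also have "\<dots> = C * C' * (1 + t\<^sup>2) powr (- (d + d') / 2)"
    proof -
      have "- (d + d') / 2 = - d / 2 + - d' / 2" by (simp add: field_simps)
      then show ?thesis by (simp only: powr_add mult_ac)
    qed
    finally show "norm (K (Complex \<sigma> t) * L (Complex \<sigma> t)) \<le> C * C' * (1 + t\<^sup>2) powr (- (d + d') / 2)" .
  qed
qed

lemma vertical_decay_prod:
  assumes "finite I" "\<And>i. i \<in> I \<Longrightarrow> vertical_decay \<sigma> (d i) (K i)"
  shows "vertical_decay \<sigma> (\<Sum>i\<in>I. d i) (\<lambda>s. \<Prod>i\<in>I. K i s)"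
  using assms
proof (induction I rule: finite_induct)
  case empty
  show ?case by (rule vertical_decayI[of 1]) (simp_all add: one_plus_sq_pos[THEN less_imp_neq, symmetric])
next
  case (insert i I)
  then show ?case by (simp add: vertical_decay_mult)
qed

lemma one_plus_sq_powr_le:
  fixes t :: real
  assumes "c > 0" "w \<ge> c * (1 + t\<^sup>2)" "d \<ge> 0"
  shows "w powr (- d / 2) \<le> c powr (- d / 2) * (1 + t\<^sup>2) powr (- d / 2)"
proof -
  have "1 + t\<^sup>2 > 0" by (simp add: add_pos_nonneg)
  with assms have "w powr (- d / 2) \<le> (c * (1 + t\<^sup>2)) powr (- d / 2)"
    by (intro powr_mono2') auto
  then show ?thesis using assms by (simp add: powr_mult)
qed

text \<open>
  Two steps of the functional equation express $\Gamma(z)$ as $\Gamma(z+2)/(z(z+1))$, and $\Gamma(z+2)$ is bounded on the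
  line.
\<close>
lemma vertical_decay_Gamma:
  assumes b: "b > 0" and X: "B + \<sigma> * b > 0"
  shows "vertical_decay \<sigma> 2 (\<lambda>s. Gamma (of_real B + s * of_real b))"
proof -
  define X where "X = B + \<sigma> * b"
  define c where "c = min (X\<^sup>2) (b\<^sup>2)"
  have X0: "X > 0" and c: "c > 0" using X b by (auto simp: X_def c_def)
  show ?thesis
  proof (rule vertical_decayI)
    show "Gamma (X + 2) / c \<ge> 0" using X0 c by (auto intro!: divide_nonneg_pos)
    fix t :: real
    define z where "z = of_real B + Complex \<sigma> t * of_real b"
    have z: "Re z = X" "Im z = t * b" by (auto simp: z_def X_def)
    have nz: "z \<notin> \<int>\<^sub>\<le>\<^sub>0" "z + 1 \<notin> \<int>\<^sub>\<le>\<^sub>0" using X0 z by (auto intro!: not_nonpos_Ints_if_Re_pos)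
    have "Gamma (z + 2) = (z + 1) * (z * Gamma z)"
    proof -
      have "Gamma (z + 2) = Gamma (z + 1 + 1)" by (simp add: add.assoc)
      then show ?thesis using nz by (simp only: Gamma_plus1 not_False_eq_True)
    qed
    then have "norm (Gamma (z + 2)) = norm (z + 1) * norm z * norm (Gamma z)"
      by (simp add: norm_mult)
    moreover have "norm (Gamma (z + 2)) \<le> Gamma (X + 2)"
    proof -
      have "strip_transform (X + 2) (X + 2) (\<lambda>s. Gamma (of_real 0 + s * of_real 1))"
        using X0 by (intro strip_transform_Gamma) auto
      from strip_transform_norm_le[OF this, of "z + 2"] z have "norm (Gamma (z + 2)) \<le> Re (Gamma (complex_of_real (X + 2)))"
        by simp
      then show ?thesis unfolding Gamma_complex_of_real by simp
    qed
    moreover have "c * (1 + t\<^sup>2) * norm (Gamma z) \<le> norm (z + 1) * norm z * norm (Gamma z)"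
    proof (intro mult_right_mono)
      have "c * (1 + t\<^sup>2) \<le> X\<^sup>2 + b\<^sup>2 * t\<^sup>2"
        unfolding c_def distrib_left by (intro add_mono mult_right_mono) auto
      also have "\<dots> = norm z * norm z"
        by (simp add: z cmod_def power_mult_distrib mult_ac)
      also have "\<dots> \<le> norm (z + 1) * norm z"
        using X0 by (intro mult_right_mono) (auto simp: z cmod_def)
      finally show "c * (1 + t\<^sup>2) \<le> norm (z + 1) * norm z" .
    qed simp
    ultimately have "c * (1 + t\<^sup>2) * norm (Gamma z) \<le> Gamma (X + 2)" by linarith
    moreover have "1 + t\<^sup>2 > 0" by (simp add: add_pos_nonneg)
    ultimately show "norm (Gamma (of_real B + Complex \<sigma> t * of_real b)) \<le> Gamma (X + 2) / c * (1 + t\<^sup>2) powr (- 2 / 2)"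
      using c unfolding z_def[symmetric]
      by (simp add: powr_minus divide_inverse[symmetric] pos_le_divide_eq mult_ac)
  qed
qed

text \<open>
  The function $x \mapsto \ln(1+T^2/x^2)$ is convex on $x > 0$, so its slope over $[x, x+d]$ is at most its slope over
  $[x+d, x+d+1]$. The right-hand side telescopes when $x$ runs through steps of length 1.
\<close>
lemma ratio_one_plus_sq_le:
  fixes x d T :: real
  defines "h \<equiv> \<lambda>x. 1 + T\<^sup>2 / x\<^sup>2"
  assumes x: "x > 0" and d: "d \<ge> 0"
  shows "h (x + d) / h x \<le> (h (x + d + 1) / h (x + d)) powr d"
proof (cases "d = 0")
  case True
  have "h x > 0" for x by (simp add: h_def add_pos_nonneg)
  from this[of x] this[of "x + 1"] show ?thesis using True by simp
next
  case False
  with d have d: "d > 0" by simp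
  have h: "h x > 0" for x by (simp add: h_def add_pos_nonneg)
  define g' where "g' x = - (2 * T\<^sup>2) / (x * (x\<^sup>2 + T\<^sup>2))" for x
  have deriv: "((\<lambda>x. ln (h x)) has_real_derivative g' x) (at x)" if "x > 0" for x
  proof -
    have "((\<lambda>x. ln (h x)) has_real_derivative (1 / h x) * (- (2 * T\<^sup>2) / x ^ 3)) (at x)"
      unfolding h_def using that h[of x]
      by (auto intro!: derivative_eq_intros simp: h_def power2_eq_square power3_eq_cube mult_ac)
    also have "(1 / h x) * (- (2 * T\<^sup>2) / x ^ 3) = g' x"
      using that h[of x] unfolding h_def g'_def by (simp add: divide_simps power2_eq_square power3_eq_cube)
    finally show ?thesis .
  qed
  obtain z1 where z1: "x < z1" "z1 < x + d" "ln (h (x + d)) - ln (h x) = (x + d - x) * g' z1"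
    using MVT2[of x "x + d" "\<lambda>x. ln (h x)" g'] d x deriv by force
  obtain z2 where z2: "x + d < z2" "z2 < x + d + 1" "ln (h (x + d + 1)) - ln (h (x + d)) = (x + d + 1 - (x + d)) * g' z2"
    using MVT2[of "x + d" "x + d + 1" "\<lambda>x. ln (h x)" g'] d x deriv by force
  have "g' z1 \<le> g' z2"
    unfolding g'_def using z1 z2 x
    by (intro divide_left_mono_neg mult_mono add_right_mono power_mono mult_pos_pos add_pos_nonneg) auto
  then have "d * g' z1 \<le> d * g' z2" using d by simp
  then have "ln (h (x + d)) - ln (h x) \<le> d * (ln (h (x + d + 1)) - ln (h (x + d)))"
    using z1 z2 by simp
  then have "ln (h (x + d) / h x) \<le> d * ln (h (x + d + 1) / h (x + d))"
    using h[THEN less_imp_neq, symmetric] by (simp add: ln_div)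
  also have "\<dots> = ln ((h (x + d + 1) / h (x + d)) powr d)"
    using h[THEN less_imp_neq, symmetric] by (simp add: ln_powr)
  finally show ?thesis using h
    by (subst (asm) ln_le_cancel_iff) (auto simp: h[THEN less_imp_neq, symmetric])
qed

lemma sqrt_prod: "sqrt (\<Prod>i\<in>I. f i) = (\<Prod>i\<in>I. sqrt (f i))"
  by (induction I rule: infinite_finite_induct) (auto simp: real_sqrt_mult)

text \<open>
  Relative to its value at $t = 0$, the $k$-th paired factor has modulus $\sqrt{h(y_k)/h(x_k)}$ with
  $h(x) = 1 + (bt)^2/x^2$, $x_k = B + \sigma b + k$ and $y_k = \frac ba (A+\sigma a+k)$. All these are at most 1. For $k \ge k_0$ the
  gap $y_k - x_k$ is at least its value $d$ at $k_0$, so the product telescopes by the convexity estimate to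
  the power $h^{-d/2}$ at a fixed point.
  For $a = b$ the exponent $d = A - B$ is the true one; for $a < b$ it can be made as large as desired by
  the choice of $k_0$.
\<close>
lemma vertical_decay_Gamma_ratio:
  fixes k0 :: nat
  assumes ab: "0 < a" "a \<le> b" and AB: "a * B \<le> b * A" and \<sigma>: "B + \<sigma> * b > 0"
  shows "vertical_decay \<sigma> (b * A / a - B + (b / a - 1) * k0)
     (\<lambda>s. Gamma (of_real B + s * of_real b) / Gamma (of_real A + s * of_real a))"
proof -
  define x where "x k = B + \<sigma> * b + real k" for k
  define y where "y k = (b / a) * (A + \<sigma> * a + real k)" for k
  define d where "d = b * A / a - B + (b / a - 1) * k0"
  have b: "b > 0" and ba: "b / a \<ge> 1" using ab by auto
  have yx: "y k - x k = b * A / a - B + (b / a - 1) * k" for k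
    using ab by (simp add: x_def y_def field_simps)
  have AB': "b * A / a - B \<ge> 0" using AB ab by (simp add: field_simps)
  have d: "d \<ge> 0" unfolding d_def using AB' ba by simp
  have x: "x k > 0" for k using \<sigma> by (simp add: x_def)
  have yx_ge: "y k \<ge> x k" for k
  proof -
    have "y k - x k \<ge> 0" unfolding yx using AB' ba by simp
    then show ?thesis by simp
  qed
  have yx_d: "y k \<ge> x k + d" if "k \<ge> k0" for k
  proof -
    have "(b / a - 1) * k \<ge> (b / a - 1) * k0" using that ba by (intro mult_left_mono) auto
    then show ?thesis using yx[of k] by (simp add: d_def)
  qed
  have y: "y k > 0" for k using x[of k] yx_ge[of k] by simp
  define z0 where "z0 = x k0 + d"
  have z0: "z0 > 0" unfolding z0_def using x[of k0] d by simp
  have A: "A + \<sigma> * a > 0" using y[of 0] ab b by (simp add: y_def zero_less_mult_iff zero_less_divide_iff)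
  define R where "R s = Gamma (of_real B + s * of_real b) / Gamma (of_real A + s * of_real a)" for s :: complex
  define Rn where "Rn n s = Gamma_series (of_real B + s * of_real b) n / Gamma_series (of_real A + s * of_real a) n" for n and s :: complex
  have lim: "(\<lambda>n. Rn n s) \<longlonglongrightarrow> R s" if "Re s = \<sigma>" for s
    unfolding R_def Rn_def using A that
    by (intro tendsto_divide Gamma_series_LIMSEQ Gamma_nonzero_if_Re_pos) simp
  have bound: "norm (R (Complex \<sigma> t)) \<le> norm (R (of_real \<sigma>)) * (1 + (b * t)\<^sup>2 / z0\<^sup>2) powr (- d / 2)" for t
  proof -
    define h where "h x = 1 + (b * t)\<^sup>2 / x\<^sup>2" for x
    have h: "h x > 0" for x by (simp add: h_def add_pos_nonneg)
    have h_mono: "h w \<le> h w'" if "w' > 0" "w' \<le> w" for w w'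
      unfolding h_def using that by (intro add_mono divide_left_mono power_mono) auto
    have factor: "norm ((Complex \<sigma> t + of_real ((A + real k) / a)) / (Complex \<sigma> t + of_real ((B + real k) / b))) =
       norm ((of_real \<sigma> + complex_of_real ((A + real k) / a)) / (of_real \<sigma> + of_real ((B + real k) / b))) * sqrt (h (y k) / h (x k))" for k
    proof -
      have yk: "\<sigma> + (A + real k) / a = y k / b" and xk: "\<sigma> + (B + real k) / b = x k / b"
        using ab b by (auto simp: x_def y_def field_simps)
      have *: "norm (Complex \<sigma> t + of_real q) = (w / b) * sqrt (h w)"
        "norm (of_real \<sigma> + complex_of_real q) = w / b" if "\<sigma> + q = w / b" "w > 0" for q w
      proof -
        have "(norm (Complex \<sigma> t + of_real q))\<^sup>2 = (w / b)\<^sup>2 + t\<^sup>2"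
          by (simp add: cmod_def that)
        also have "\<dots> = ((w / b) * sqrt (h w))\<^sup>2"
          using h[of w] that b by (simp add: power_mult_distrib h_def field_simps)
        finally show "norm (Complex \<sigma> t + of_real q) = (w / b) * sqrt (h w)"
          by (rule power2_eq_imp_eq) (use that b h[of w] in auto)
        show "norm (of_real \<sigma> + complex_of_real q) = w / b"
          unfolding of_real_add[symmetric] norm_of_real that(1) using that b by simp
      qed
      show ?thesis
        unfolding norm_divide *[OF yk y] *[OF xk x] using b x[of k] y[of k] h
        by (simp add: real_sqrt_divide)
    qed
    have norm_Rn: "norm (Rn n (Complex \<sigma> t)) = norm (Rn n (of_real \<sigma>)) * sqrt (\<Prod>k<Suc n. h (y k) / h (x k))" for n
      unfolding Rn_def Gamma_series_ratio_eq[OF ab(1) b] norm_mult prod_norm[symmetric] factor prod.distrib sqrt_prod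
      by (simp add: lessThan_Suc_atMost)
    have prod_le: "(\<Prod>k<n. h (y k) / h (x k)) \<le> (h (x n + d) / h z0) powr d" if "n \<ge> k0" for n
      using that
    proof (induction n rule: nat_induct_at_least)
      case base
      have "(\<Prod>k<k0. h (y k) / h (x k)) \<le> 1"
        using h h_mono[OF x yx_ge] by (intro prod_le_1) (auto intro: less_imp_le)
      then show ?case using h[of z0] by (simp add: z0_def)
    next
      case (Suc n)
      have "h (y n) / h (x n) \<le> h (x n + d) / h (x n)"
        using x[of n] d Suc.hyps h[of "x n"] by (intro divide_right_mono h_mono yx_d) auto
      also have "\<dots> \<le> (h (x n + d + 1) / h (x n + d)) powr d"
        unfolding h_def by (rule ratio_one_plus_sq_le[OF x d])
      finally have "(\<Prod>k<Suc n. h (y k) / h (x k)) \<le> (h (x n + d) / h z0) powr d * (h (x n + d + 1) / h (x n + d)) powr d"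
        using Suc.IH h[of "y n"] h[of "x n"] unfolding prod.lessThan_Suc
        by (intro mult_mono) (auto intro: less_imp_le)
      also have "\<dots> = (h (x (Suc n) + d) / h z0) powr d"
        using h[of "x n + d"] h[of z0] h[of "x n + d + 1"] by (simp add: powr_mult[symmetric] less_imp_le x_def add_ac)
      finally show ?case .
    qed
    have "norm (R (Complex \<sigma> t)) \<le> norm (R (of_real \<sigma>)) * sqrt ((1 / h z0) powr d)"
    proof (rule LIMSEQ_le)
      show "(\<lambda>n. norm (Rn n (Complex \<sigma> t))) \<longlonglongrightarrow> norm (R (Complex \<sigma> t))"
        by (intro tendsto_norm lim) simp
      have "(\<lambda>n. h (x (Suc n) + d)) \<longlonglongrightarrow> 1"
        unfolding h_def x_def by real_asymp
      then show "(\<lambda>n. norm (Rn n (of_real \<sigma>)) * sqrt ((h (x (Suc n) + d) / h z0) powr d)) \<longlonglongrightarrow>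
        norm (R (of_real \<sigma>)) * sqrt ((1 / h z0) powr d)"
        using h[of z0] by (intro tendsto_intros lim) auto
      have "norm (Rn n (Complex \<sigma> t)) \<le> norm (Rn n (of_real \<sigma>)) * sqrt ((h (x (Suc n) + d) / h z0) powr d)" if "n \<ge> k0" for n
        unfolding norm_Rn using prod_le[of "Suc n"] that by (intro mult_left_mono) auto
      then show "\<exists>N. \<forall>n\<ge>N. norm (Rn n (Complex \<sigma> t)) \<le> norm (Rn n (of_real \<sigma>)) * sqrt ((h (x (Suc n) + d) / h z0) powr d)"
        by blast
    qed
    also have "sqrt ((1 / h z0) powr d) = h z0 powr (- d / 2)"
      using h[of z0] by (simp add: powr_half_sqrt[symmetric] powr_powr powr_divide powr_minus_divide)
    finally show ?thesis by (simp add: h_def)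
  qed
  define c where "c = min 1 (b\<^sup>2 / z0\<^sup>2)"
  have c: "c > 0" using b z0 by (simp add: c_def)
  have "vertical_decay \<sigma> d R"
  proof (rule vertical_decayI)
    show "norm (R (of_real \<sigma>)) * c powr (- d / 2) \<ge> 0" by simp
    fix t :: real
    have "c * (1 + t\<^sup>2) \<le> 1 + (b\<^sup>2 / z0\<^sup>2) * t\<^sup>2"
      unfolding c_def distrib_left by (intro add_mono mult_right_mono) auto
    then have "(1 + (b * t)\<^sup>2 / z0\<^sup>2) powr (- d / 2) \<le> c powr (- d / 2) * (1 + t\<^sup>2) powr (- d / 2)"
      by (intro one_plus_sq_powr_le c d) (simp add: power_mult_distrib)
    then have "norm (R (of_real \<sigma>)) * (1 + (b * t)\<^sup>2 / z0\<^sup>2) powr (- d / 2) \<le>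
      norm (R (of_real \<sigma>)) * (c powr (- d / 2) * (1 + t\<^sup>2) powr (- d / 2))" by (intro mult_left_mono) auto
    with bound[of t] show "norm (R (Complex \<sigma> t)) \<le> norm (R (of_real \<sigma>)) * c powr (- d / 2) * (1 + t\<^sup>2) powr (- d / 2)"
      by (simp add: mult.assoc)
  qed
  then show ?thesis unfolding R_def[abs_def] d_def .
qed

text \<open>
  Comparison with $(1+|t|)^{-d}$, by $(1+|t|)^2 \le 2(1+t^2)$.
\<close>
lemma integrable_one_plus_sq_powr:
  assumes d: "d > 1"
  shows "integrable lborel (\<lambda>t::real. (1 + t\<^sup>2) powr (- d / 2))"
proof -
  define g where "g t = indicator {0..} t * (1 + t) powr (- d)" for t :: real
  have [measurable]: "g \<in> borel_measurable borel" unfolding g_def[abs_def] by measurable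
  have "integrable lborel g"
  proof (rule integrableI_nonneg)
    have "(\<integral>\<^sup>+t. ennreal ((1 + t) powr (- d)) * indicator {0..} t \<partial>lborel) = 0 - (- 1 / (d - 1) * (1 + 0) powr (1 - d))"
    proof (rule nn_integral_FTC_atLeast)
      show "((\<lambda>t. - 1 / (d - 1) * (1 + t) powr (1 - d)) \<longlongrightarrow> 0) at_top"
        using d by real_asymp
      show "((\<lambda>t. - 1 / (d - 1) * (1 + t) powr (1 - d)) has_real_derivative (1 + t) powr - d) (at t)" if "0 \<le> t" for t
      proof -
        have "((\<lambda>t. (1 + t) powr (1 - d)) has_real_derivative (1 - d) * (1 + t) powr - d) (at t)"
          using that by (auto intro!: derivative_eq_intros)
        moreover have "- 1 / (d - 1) * ((1 - d) * w) = w" for w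
          using d by (simp add: field_simps)
        ultimately show ?thesis using DERIV_cmult[of _ _ t UNIV "- 1 / (d - 1)"] by metis
      qed
    qed auto
    then show "(\<integral>\<^sup>+t. ennreal (g t) \<partial>lborel) < \<infinity>"
      by (simp add: g_def ennreal_mult'' ennreal_indicator mult.commute)
  qed (auto simp: g_def)
  then have "integrable lborel (\<lambda>t. 2 powr (d / 2) * (g t + g (0 + (-1) * t)))"
    by (intro integrable_mult_right Bochner_Integration.integrable_add lborel_integrable_real_affine) auto
  then show ?thesis
  proof (rule Bochner_Integration.integrable_bound)
    show "AE t in lborel. norm ((1 + t\<^sup>2) powr (- d / 2)) \<le> norm (2 powr (d / 2) * (g t + g (0 + (-1) * t)))"
    proof (rule AE_I2)
      fix t :: real
      have "(1 + \<bar>t\<bar>)\<^sup>2 / 2 \<le> 1 + t\<^sup>2"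
      proof -
        have "(1 - \<bar>t\<bar>)\<^sup>2 \<ge> 0" by simp
        then show ?thesis by (simp add: power2_eq_square algebra_simps)
      qed
      then have "(1 + t\<^sup>2) powr (- d / 2) \<le> ((1 + \<bar>t\<bar>)\<^sup>2 / 2) powr (- d / 2)"
        using d by (intro powr_mono2') auto
      also have "\<dots> = 2 powr (d / 2) * (1 + \<bar>t\<bar>) powr (- d)"
        by (simp add: powr_divide powr_powr powr_minus_divide flip: powr_numeral)
      also have "(1 + \<bar>t\<bar>) powr (- d) \<le> g t + g (0 + (-1) * t)"
        by (auto simp: g_def indicator_def abs_if)
      finally show "norm ((1 + t\<^sup>2) powr (- d / 2)) \<le> norm (2 powr (d / 2) * (g t + g (0 + (-1) * t)))"
        by (simp add: mult_left_mono)
    qed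
  qed simp
qed

lemma vertical_decay_integrable:
  assumes "vertical_decay \<sigma> d K" "d > 1" "(\<lambda>t. K (Complex \<sigma> t)) \<in> borel_measurable borel"
  shows "integrable lborel (\<lambda>t. K (Complex \<sigma> t))"
proof -
  obtain C where C: "\<And>t. norm (K (Complex \<sigma> t)) \<le> C * (1 + t\<^sup>2) powr (- d / 2)"
    using assms(1) unfolding vertical_decay_def by blast
  show ?thesis
  proof (rule Bochner_Integration.integrable_bound)
    show "integrable lborel (\<lambda>t::real. C * (1 + t\<^sup>2) powr (- d / 2))"
      by (intro integrable_mult_right integrable_one_plus_sq_powr assms)
    show "AE t in lborel. norm (K (Complex \<sigma> t)) \<le> norm (C * (1 + t\<^sup>2) powr (- d / 2))"
      using C by (intro AE_I2) (metis abs_ge_self order_trans real_norm_def)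
  qed (use assms in auto)
qed

section \<open>Mellin inversion along a vertical line\<close>

definition vertical_inverse_mellin :: "real \<Rightarrow> (complex \<Rightarrow> complex) \<Rightarrow> real \<Rightarrow> complex" where
  "vertical_inverse_mellin \<sigma> K x = 1 / (2 * of_real pi * \<i>) *
      (LINT t|lborel. K (Complex \<sigma> t) * of_real x powr (- Complex \<sigma> t) * \<i>)"

lemma has_bochner_integral_density_iff:
  fixes f :: "'a \<Rightarrow> 'b :: {banach, second_countable_topology}" and g :: "'a \<Rightarrow> real"
  assumes "f \<in> borel_measurable M" "g \<in> borel_measurable M" "AE x in M. 0 \<le> g x"
  shows "has_bochner_integral (density M g) f x \<longleftrightarrow> has_bochner_integral M (\<lambda>x. g x *\<^sub>R f x) x"
  using assms by (simp add: has_bochner_integral_iff integrable_density integral_density)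

text \<open>
  Tilting the measure behind \<open>K\<close> to the line $\Re s = \sigma$ gives a probability measure with characteristic
  function $t \mapsto K(\sigma+it)/K(\sigma)$, which is integrable by assumption. Its density at $\ln x$ is the line integral up to the factor
  $x^{\sigma}/K(\sigma)$. As the untilted measure serves all lines of the strip, the moments of the line integral over
  $\Re s = \sigma$ are values of \<open>K\<close> at other points $\tau$ as well; no contour is moved.
\<close>
lemma mellin_inversion:
  fixes K :: "complex \<Rightarrow> complex"
  assumes K: "strip_transform u v K" and \<sigma>: "u \<le> \<sigma>" "\<sigma> \<le> v"
    and int: "integrable lborel (\<lambda>t. K (Complex \<sigma> t))" and nz: "K (of_real \<sigma>) \<noteq> 0"
  shows "\<And>x. x > 0 \<Longrightarrow> Im (vertical_inverse_mellin \<sigma> K x) = 0"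
    and "\<And>x. x > 0 \<Longrightarrow> Re (vertical_inverse_mellin \<sigma> K x) \<ge> 0"
    and "\<And>x. x > 0 \<Longrightarrow> isCont (vertical_inverse_mellin \<sigma> K) x"
    and "\<And>\<tau>. u \<le> \<tau> \<Longrightarrow> \<tau> \<le> v \<Longrightarrow> has_bochner_integral lborel
           (\<lambda>x. indicator {0<..} x * (x powr (\<tau> - 1) * Re (vertical_inverse_mellin \<sigma> K x))) (Re (K (of_real \<tau>)))"
proof -
  from K obtain M where M: "finite_measure M" "sets M = sets borel"
    "\<And>s. u \<le> Re s \<Longrightarrow> Re s \<le> v \<Longrightarrow>
       has_bochner_integral M (\<lambda>y. exp ((s - of_real u) * of_real y)) (K s)"
    by (rule strip_transformE) blast
  interpret M: finite_measure M by fact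
  note [measurable_cong] = M(2)
  have space_M [simp]: "space M = UNIV"
    using sets_eq_imp_space_eq[OF M(2)] by simp
  have R: "has_bochner_integral M (\<lambda>y. exp ((\<tau> - u) * y)) (Re (K (of_real \<tau>)))"
    and KR: "K (of_real \<tau>) = of_real (Re (K (of_real \<tau>)))"
    if "u \<le> \<tau>" "\<tau> \<le> v" for \<tau>
    by (rule transform_at_real[OF M(3)]; use that in simp)+
  define \<kappa> where "\<kappa> = Re (K (of_real \<sigma>))"
  have \<kappa>: "\<kappa> > 0"
  proof -
    have "\<kappa> = (LINT y|M. exp ((\<sigma> - u) * y))"
      using R[OF \<sigma>] by (simp add: has_bochner_integral_iff \<kappa>_def)
    then have "\<kappa> \<ge> 0" by simp
    moreover have "\<kappa> \<noteq> 0" using nz KR[OF \<sigma>] by (auto simp: \<kappa>_def)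
    ultimately show ?thesis by simp
  qed
  \<comment> \<open>the tilt from the base point $u$ to $\sigma$, normalised to total mass 1\<close>
  define w where "w y = exp ((\<sigma> - u) * y) / \<kappa>" for y
  have w: "w y \<ge> 0" for y using \<kappa> by (simp add: w_def)
  have [measurable]: "w \<in> borel_measurable borel" unfolding w_def[abs_def] by measurable
  define N where "N = density M w"
  have N_iff: "has_bochner_integral N f x \<longleftrightarrow> has_bochner_integral M (\<lambda>y. w y *\<^sub>R f y) x"
    if [measurable]: "f \<in> borel_measurable borel"
    for f :: "real \<Rightarrow> 'b :: {banach, second_countable_topology}" and x
    unfolding N_def using w by (intro has_bochner_integral_density_iff) auto
  have "real_distribution N"
  proof -
    have "emeasure N UNIV = (\<integral>\<^sup>+y. ennreal (w y) \<partial>M)"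
      unfolding N_def by (simp add: emeasure_density)
    also have "\<dots> = ennreal 1"
    proof (subst nn_integral_eq_integral)
      have "has_bochner_integral M w 1"
        using has_bochner_integral_divide_zero[OF R[OF \<sigma>], of \<kappa>] \<kappa> by (simp add: w_def[abs_def] flip: \<kappa>_def)
      then show "integrable M w" "ennreal (integral\<^sup>L M w) = ennreal 1"
        by (auto simp: has_bochner_integral_iff)
    qed (use w in auto)
    finally have "prob_space N" by (intro prob_spaceI) (simp add: N_def)
    then show ?thesis
      by (simp add: real_distribution_def real_distribution_axioms_def N_def M(2))
  qed
  interpret N: real_distribution N by fact
  have char: "char N t = K (Complex \<sigma> t) / of_real \<kappa>" for t
  proof -
    have "has_bochner_integral M (\<lambda>y. w y *\<^sub>R iexp (t * y)) (K (Complex \<sigma> t) / of_real \<kappa>)"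
    proof -
      have "w y *\<^sub>R iexp (t * y) = exp ((Complex \<sigma> t - of_real u) * of_real y) / of_real \<kappa>" for y
      proof -
        have "(Complex \<sigma> t - of_real u) * of_real y = of_real ((\<sigma> - u) * y) + \<i> * of_real (t * y)"
          by (simp add: complex_eq_iff)
        then show ?thesis
          by (simp add: w_def scaleR_conv_of_real exp_add exp_of_real flip: of_real_mult of_real_diff)
      qed
      then show ?thesis using \<sigma> by (simp only:) (intro has_bochner_integral_divide_zero M(3); simp)
    qed
    then show ?thesis
      unfolding char_def by (subst (asm) N_iff[symmetric]) (auto simp: has_bochner_integral_iff)
  qed
  have int_char: "integrable lborel (char N)"
    unfolding char[abs_def] using int by simp
  define f where "f y = Re (N.char_density y)" for y
  have f: "N.char_density y = of_real (f y)" "f y \<ge> 0" for y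
    using N.char_density_real[OF int_char] N.char_density_nonneg[OF int_char]
    by (auto simp: complex_eq_iff f_def)
  have f_cont: "isCont f y" for y
    unfolding f_def by (rule isCont_Re) (rule N.isCont_char_density[OF int_char])
  have [measurable]: "f \<in> borel_measurable borel"
    by (intro borel_measurable_continuous_onI continuous_at_imp_continuous_on ballI f_cont)
  have N_eq: "N = density lborel f"
    using N.distribution_eq_char_density[OF int_char] by (simp add: f_def)
  have H: "vertical_inverse_mellin \<sigma> K x = of_real (\<kappa> * x powr (- \<sigma>) * f (ln x))" if "x > 0" for x
  proof -
    have *: "of_real x powr (- Complex \<sigma> t) = of_real (x powr (- \<sigma>)) * iexp (- (t * ln x))" for t
    proof -
      have "- Complex \<sigma> t * of_real (ln x) = of_real (- \<sigma> * ln x) + \<i> * of_real (- (t * ln x))"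
        by (simp add: complex_eq_iff)
      then show ?thesis using that
        by (simp add: powr_def exp_add exp_of_real Ln_of_real flip: of_real_mult of_real_minus)
    qed
    have "K (Complex \<sigma> t) * (of_real (x powr (- \<sigma>)) * iexp (- (t * ln x))) * \<i> =
        (\<i> * of_real \<kappa> * of_real (x powr (- \<sigma>))) * (iexp (- (t * ln x)) * char N t)" for t
      unfolding char using \<kappa> by simp
    then have "vertical_inverse_mellin \<sigma> K x = 1 / (2 * of_real pi * \<i>) *
      (LINT t|lborel. (\<i> * of_real \<kappa> * of_real (x powr (- \<sigma>))) * (iexp (- (t * ln x)) * char N t))"
      unfolding vertical_inverse_mellin_def * by (simp only:)
    also have "\<dots> = of_real \<kappa> * of_real (x powr (- \<sigma>)) * N.char_density (ln x)"
      unfolding N.char_density_def by simp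
    finally show ?thesis by (simp add: f)
  qed
  show "Im (vertical_inverse_mellin \<sigma> K x) = 0" "Re (vertical_inverse_mellin \<sigma> K x) \<ge> 0" if "x > 0" for x
    using \<kappa> f unfolding H[OF that] Re_complex_of_real Im_complex_of_real by simp_all
  show cont: "isCont (vertical_inverse_mellin \<sigma> K) x" if "x > 0" for x
  proof -
    have "isCont (\<lambda>x. complex_of_real (\<kappa> * x powr (- \<sigma>) * f (ln x))) x"
      using that by (intro continuous_intros isCont_o2[OF _ f_cont]) auto
    moreover have "eventually (\<lambda>x. complex_of_real (\<kappa> * x powr (- \<sigma>) * f (ln x)) = vertical_inverse_mellin \<sigma> K x) (nhds x)"
      using eventually_nhds_in_open[of "{0<..}" x] that by (auto elim!: eventually_mono simp: H)
    ultimately show ?thesis by (simp add: isCont_cong)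
  qed
  show "has_bochner_integral lborel
           (\<lambda>x. indicator {0<..} x * (x powr (\<tau> - 1) * Re (vertical_inverse_mellin \<sigma> K x))) (Re (K (of_real \<tau>)))"
    if \<tau>: "u \<le> \<tau>" "\<tau> \<le> v" for \<tau>
  proof -
    let ?h = "\<lambda>x. x powr (\<tau> - 1) * Re (vertical_inverse_mellin \<sigma> K x)"
    have h_exp: "?h (exp y) * exp y = \<kappa> * (f y * exp ((\<tau> - \<sigma>) * y))" for y
      unfolding H[OF exp_gt_zero] by (simp add: powr_def mult_exp_exp algebra_simps)
    have "has_bochner_integral M (\<lambda>y. w y *\<^sub>R exp ((\<tau> - \<sigma>) * y)) (Re (K (of_real \<tau>)) / \<kappa>)"
      using has_bochner_integral_divide_zero[OF R[OF \<tau>], of \<kappa>] by (simp add: w_def mult_exp_exp algebra_simps)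
    then have "has_bochner_integral N (\<lambda>y. exp ((\<tau> - \<sigma>) * y)) (Re (K (of_real \<tau>)) / \<kappa>)"
      by (subst N_iff) auto
    then have "has_bochner_integral lborel (\<lambda>y. f y *\<^sub>R exp ((\<tau> - \<sigma>) * y)) (Re (K (of_real \<tau>)) / \<kappa>)"
      unfolding N_eq using f by (subst (asm) has_bochner_integral_density_iff) auto
    from has_bochner_integral_mult_right[OF this, of \<kappa>]
    have *: "has_bochner_integral lborel (\<lambda>y. ?h (exp y) * exp y) (Re (K (of_real \<tau>)))"
      unfolding h_exp using \<kappa> by simp
    have int_h: "set_integrable lborel (einterval (-\<infinity>) \<infinity>) (\<lambda>y. ?h (exp y) * exp y)"
      using * by (simp add: set_integrable_def has_bochner_integral_iff)
    have nonneg: "0 \<le> ?h (exp y)" for y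
      using f \<kappa> unfolding H[OF exp_gt_zero] by simp
    have cont_h: "isCont ?h (exp y)" for y
      by (intro isCont_mult isCont_Re cont) (auto intro!: continuous_intros)
    note sub = interval_integral_substitution_nonneg[of "-\<infinity>" "\<infinity>" exp exp ?h 0 \<infinity>,
        OF _ DERIV_exp cont_h _ nonneg _ _ _ int_h]
    have tends: "((ereal \<circ> exp \<circ> real_of_ereal) \<longlongrightarrow> 0) (at_right (-\<infinity>))"
       "((ereal \<circ> exp \<circ> real_of_ereal) \<longlongrightarrow> \<infinity>) (at_left \<infinity>)"
      using exp_at_bot exp_at_top
      by (simp_all add: ereal_tendsto_simps zero_ereal_def)
    have "set_integrable lborel (einterval 0 \<infinity>) ?h"
      "(LBINT x=0..\<infinity>. ?h x) = (LBINT y=-\<infinity>..\<infinity>. ?h (exp y) * exp y)"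
      by (rule sub; use tends in simp)+
    moreover have "einterval 0 \<infinity> = {0<..}" by (auto simp: einterval_def)
    ultimately show ?thesis
      using * by (simp add: set_integrable_def has_bochner_integral_iff interval_lebesgue_integral_def set_lebesgue_integral_def)
  qed
qed

section \<open>Laplace transforms of nonnegative densities with finite moments\<close>

text \<open>
  All derivatives may be taken under the integral sign: for $s, s' \ge 0$ the difference quotients of $e^{-sx}$ are
  bounded by $x$, and the next moment is finite.
\<close>
lemma completely_monotone_nonneg_laplace:
  fixes r :: "real \<Rightarrow> real" and \<phi> :: "real \<Rightarrow> real"
  assumes r: "\<And>x. r x \<ge> 0" "\<And>x. x \<le> 0 \<Longrightarrow> r x = 0"
    and int: "\<And>n. integrable lborel (\<lambda>x. x ^ n * r x)"
    and \<phi>: "\<And>s. s \<ge> 0 \<Longrightarrow> \<phi> s = (LINT x|lborel. exp (- s * x) * r x)"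
  shows "completely_monotone_nonneg \<phi>"
proof -
  define L where "L n s = (LINT x|lborel. x ^ n * (exp (- s * x) * r x))" for n :: nat and s :: real
  have [measurable]: "r \<in> borel_measurable borel"
    using borel_measurable_integrable[OF int[of 0]] by simp
  have xr: "x ^ n * r x \<ge> 0" for x n
    using r[of x] by (cases "x \<le> 0") auto
  have bound: "\<bar>x ^ n * (exp (- s * x) * r x)\<bar> \<le> x ^ n * r x" if "s \<ge> 0" for x n s
  proof (cases "x \<le> 0")
    case False
    with that have "exp (- s * x) \<le> 1" by simp
    then have "exp (- s * x) * (x ^ n * r x) \<le> 1 * (x ^ n * r x)" by (intro mult_right_mono xr)
    moreover have "x ^ n * (exp (- s * x) * r x) \<ge> 0" using False r[of x] by simp
    ultimately show ?thesis by (simp add: mult_ac)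
  qed (use r in simp)
  have intL: "integrable lborel (\<lambda>x. x ^ n * (exp (- s * x) * r x))" if "s \<ge> 0" for n s
    by (rule Bochner_Integration.integrable_bound[OF int[of n]]) (use bound[OF that] in \<open>auto intro: order_trans[OF _ abs_ge_self]\<close>)
  have L_nonneg: "L n s \<ge> 0" if "s \<ge> 0" for n s
    unfolding L_def
  proof (rule Bochner_Integration.integral_nonneg)
    show "x ^ n * (exp (- s * x) * r x) \<ge> 0" for x
    proof -
      have "0 \<le> exp (- s * x) * (x ^ n * r x)" by (intro mult_nonneg_nonneg xr) simp
      then show ?thesis by (simp only: mult.left_commute)
    qed
  qed
  have cont: "continuous_on {0..} (L 0)"
    unfolding continuous_on_sequentially
  proof (intro allI ballI impI, elim conjE)
    fix \<sigma> :: "nat \<Rightarrow> real" and s :: real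
    assume \<sigma>: "\<forall>n. \<sigma> n \<in> {0..}" "\<sigma> \<longlonglongrightarrow> s"
    have "(\<lambda>i. LINT x|lborel. x ^ 0 * (exp (- \<sigma> i * x) * r x)) \<longlonglongrightarrow> (LINT x|lborel. x ^ 0 * (exp (- s * x) * r x))"
    proof (rule integral_dominated_convergence[OF _ _ int[of 0]])
      show "AE x in lborel. (\<lambda>i. x ^ 0 * (exp (- \<sigma> i * x) * r x)) \<longlonglongrightarrow> x ^ 0 * (exp (- s * x) * r x)"
        by (intro AE_I2 tendsto_intros \<sigma>)
      show "AE x in lborel. norm (x ^ 0 * (exp (- \<sigma> i * x) * r x)) \<le> x ^ 0 * r x" for i
        using bound[of "\<sigma> i" _ 0] \<sigma>(1) by simp
    qed measurable
    then show "(L 0 \<circ> \<sigma>) \<longlonglongrightarrow> L 0 s" by (simp add: o_def L_def)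
  qed
  have deriv: "(L n has_real_derivative - L (Suc n) s) (at s)" if s: "s > 0" for n s
    unfolding DERIV_def tendsto_at_iff_sequentially
  proof (intro allI impI)
    fix h :: "nat \<Rightarrow> real"
    assume h: "\<forall>i. h i \<in> UNIV - {0}" "h \<longlonglongrightarrow> 0"
    have ev: "eventually (\<lambda>i. h i > - s) sequentially"
      using h(2) s by (intro order_tendstoD) auto
    then obtain N where N: "\<And>i. i \<ge> N \<Longrightarrow> h i > - s" by (auto simp: eventually_sequentially)
    \<comment> \<open>the shift by $N$ keeps all evaluation points nonnegative\<close>
    define q where "q i x = x ^ n * ((exp (- (s + h (i + N)) * x) - exp (- s * x)) / h (i + N) * r x)" for i x
    have "(\<lambda>i. LINT x|lborel. q i x) \<longlonglongrightarrow> (LINT x|lborel. x ^ n * (- x * exp (- s * x) * r x))"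
    proof (rule integral_dominated_convergence[OF _ _ int[of "Suc n"]])
      show "AE x in lborel. (\<lambda>i. q i x) \<longlonglongrightarrow> x ^ n * (- x * exp (- s * x) * r x)"
      proof (rule AE_I2)
        fix x :: real
        have "((\<lambda>s. exp (- s * x)) has_real_derivative - x * exp (- s * x)) (at s)"
          by (auto intro!: derivative_eq_intros)
        then have "((\<lambda>i. (exp (- (s + h i) * x) - exp (- s * x)) / h i) \<longlongrightarrow> - x * exp (- s * x)) sequentially"
          unfolding DERIV_def tendsto_at_iff_sequentially using h by (simp add: o_def)
        then have "((\<lambda>i. (exp (- (s + h (i + N)) * x) - exp (- s * x)) / h (i + N)) \<longlongrightarrow> - x * exp (- s * x)) sequentially"
          by (rule LIMSEQ_ignore_initial_segment)
        then show "(\<lambda>i. q i x) \<longlonglongrightarrow> x ^ n * (- x * exp (- s * x) * r x)"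
          unfolding q_def by (intro tendsto_intros)
      qed
      show "AE x in lborel. norm (q i x) \<le> x ^ Suc n * r x" for i
      proof (rule AE_I2)
        fix x :: real
        show "norm (q i x) \<le> x ^ Suc n * r x"
        proof (cases "x \<le> 0")
          case False
          have lip: "\<bar>exp (- a) - exp (- b)\<bar> \<le> \<bar>a - b\<bar>" if "a \<ge> 0" "b \<ge> 0" for a b :: real
          proof -
            have *: "\<bar>exp (- a) - exp (- b)\<bar> \<le> b - a" if "0 \<le> a" "a \<le> b" for a b :: real
            proof -
              have "exp (- a) - exp (- b) = exp (- a) * (1 - exp (a - b))"
                by (simp add: algebra_simps mult_exp_exp)
              also have "1 - exp (a - b) \<le> b - a"
                using exp_ge_add_one_self[of "a - b"] by linarith
              then have "exp (- a) * (1 - exp (a - b)) \<le> 1 * (b - a)"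
                using that by (intro mult_mono) auto
              finally show ?thesis using that by simp
            qed
            show ?thesis
              using *[of a b] *[of b a] that by (cases "a \<le> b") (auto simp: abs_minus_commute)
          qed
          have "s + h (i + N) > 0" using N[of "i + N"] by simp
          with lip[of "(s + h (i + N)) * x" "s * x"] False s
          have "\<bar>exp (- (s + h (i + N)) * x) - exp (- s * x)\<bar> \<le> \<bar>(s + h (i + N)) * x - s * x\<bar>"
            unfolding mult_minus_left by simp
          also have "\<dots> = \<bar>h (i + N)\<bar> * x" using False by (simp add: algebra_simps abs_mult)
          finally have "\<bar>(exp (- (s + h (i + N)) * x) - exp (- s * x)) / h (i + N)\<bar> \<le> x"
            using h(1) by (simp add: abs_divide divide_le_eq mult.commute)
          then have "x ^ n * (\<bar>(exp (- (s + h (i + N)) * x) - exp (- s * x)) / h (i + N)\<bar> * r x) \<le> x ^ n * (x * r x)"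
            using False r(1)[of x] by (intro mult_left_mono mult_right_mono) auto
          then show ?thesis using False r(1)[of x] by (simp add: q_def abs_mult mult_ac)
        qed (use r in \<open>simp add: q_def\<close>)
      qed
    qed (unfold q_def[abs_def], measurable)
    also have "(LINT x|lborel. x ^ n * (- x * exp (- s * x) * r x)) = - L (Suc n) s"
      unfolding L_def by (subst Bochner_Integration.integral_minus[symmetric]) (simp add: mult_ac)
    also have "(\<lambda>i. LINT x|lborel. q i x) = (\<lambda>i. (L n (s + h (i + N)) - L n s) / h (i + N))"
    proof
      fix i
      have "s + h (i + N) \<ge> 0" using N[of "i + N"] by simp
      then have "(L n (s + h (i + N)) - L n s) / h (i + N) =
        (LINT x|lborel. (x ^ n * (exp (- (s + h (i + N)) * x) * r x) - x ^ n * (exp (- s * x) * r x)) / h (i + N))"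
        unfolding L_def using s intL by (simp del: minus_add_distrib)
      then show "(LINT x|lborel. q i x) = (L n (s + h (i + N)) - L n s) / h (i + N)"
        by (simp add: q_def[abs_def] algebra_simps diff_divide_distrib)
    qed
    finally have "(\<lambda>i. (L n (s + h (i + N)) - L n s) / h (i + N)) \<longlonglongrightarrow> - L (Suc n) s" .
    from LIMSEQ_offset[OF this] show "((\<lambda>h. (L n (s + h) - L n s) / h) \<circ> h) \<longlonglongrightarrow> - L (Suc n) s"
      by (simp add: o_def)
  qed
  have iter: "(deriv ^^ k) \<phi> s = (- 1) ^ k * L k s" if "s > 0" for k s
    using that
  proof (induction k arbitrary: s)
    case 0
    then show ?case by (simp add: \<phi> L_def)
  next
    case (Suc k)
    have "((\<lambda>s. (- 1) ^ k * L k s) has_real_derivative (- 1) ^ k * - L (Suc k) s) (at s)"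
      by (intro DERIV_cmult deriv Suc.prems)
    then have "((deriv ^^ k) \<phi> has_real_derivative (- 1) ^ k * - L (Suc k) s) (at s)"
      by (rule has_field_derivative_transform_within_open[where S = "{0<..}"]) (use Suc in auto)
    then show ?case by (simp add: DERIV_imp_deriv)
  qed
  have diff: "(deriv ^^ k) \<phi> differentiable (at s)" if "s > 0" for k s
  proof -
    have "((\<lambda>s. (- 1) ^ k * L k s) has_real_derivative (- 1) ^ k * - L (Suc k) s) (at s)"
      by (intro DERIV_cmult deriv that)
    then have "((deriv ^^ k) \<phi> has_real_derivative (- 1) ^ k * - L (Suc k) s) (at s)"
      by (rule has_field_derivative_transform_within_open[where S = "{0<..}"]) (use that in \<open>auto simp: iter\<close>)
    then show ?thesis by (auto simp: real_differentiable_def)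
  qed
  have "continuous_on {0..} \<phi>"
    using cont by (rule continuous_on_eq) (simp add: \<phi> L_def)
  moreover have "(- 1) ^ k * (deriv ^^ k) \<phi> s \<ge> 0" if "s > 0" for k s
    using L_nonneg[of s k] that by (simp add: iter mult.assoc[symmetric] power_mult_distrib[symmetric])
  ultimately show ?thesis
    using diff by (auto simp: completely_monotone_nonneg_def completely_monotone_def)
qed

lemma laplace_power_series:
  fixes r :: "real \<Rightarrow> real"
  assumes r: "\<And>x. r x \<ge> 0" "\<And>x. x \<le> 0 \<Longrightarrow> r x = 0"
    and mom: "\<And>n. has_bochner_integral lborel (\<lambda>x. x ^ n * r x) (\<mu> n)"
    and sm: "\<And>R. summable (\<lambda>n. \<mu> n * (R ^ n / fact n))"
  shows "summable (\<lambda>n. of_real (\<mu> n) * ((- z) ^ n / fact n) :: complex)"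
    and "(\<lambda>z::complex. \<Sum>n. of_real (\<mu> n) * ((- z) ^ n / fact n)) holomorphic_on UNIV"
    and "(\<Sum>n. of_real (\<mu> n) * ((- of_real s) ^ n / fact n)) = complex_of_real (LINT x|lborel. exp (- s * x) * r x)"
proof -
  have int: "integrable lborel (\<lambda>x. x ^ n * r x)" and \<mu>: "\<mu> n = (LINT x|lborel. x ^ n * r x)" for n
    using mom[of n] by (auto simp: has_bochner_integral_iff)
  have xr: "x ^ n * r x \<ge> 0" for x n
    using r[of x] by (cases "x \<le> 0") auto
  have \<mu>_nonneg: "\<mu> n \<ge> 0" for n
    unfolding \<mu> by (rule Bochner_Integration.integral_nonneg) (rule xr)
  show sm': "summable (\<lambda>n. of_real (\<mu> n) * ((- z) ^ n / fact n) :: complex)" for z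
  proof (rule summable_norm_cancel)
    show "summable (\<lambda>n. norm (of_real (\<mu> n) * ((- z) ^ n / fact n)))"
      using sm[of "norm z"] \<mu>_nonneg by (simp add: norm_mult norm_divide norm_power)
  qed
  have eq: "of_real (\<mu> n) * ((- z) ^ n / fact n) = of_real (\<mu> n) * (- 1) ^ n / fact n * z ^ n" for n and z :: complex
    by (simp add: power_minus[of z])
  have sm'': "summable (\<lambda>n. of_real (\<mu> n) * (- 1) ^ n / fact n * z ^ n :: complex)" for z
    using sm'[of z] unfolding eq .
  show "(\<lambda>z::complex. \<Sum>n. of_real (\<mu> n) * ((- z) ^ n / fact n)) holomorphic_on UNIV"
  proof (subst holomorphic_on_open[OF open_UNIV], intro ballI)
    fix z :: complex
    from termdiffs_strong_converges_everywhere[OF sm'', of z]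
    show "\<exists>f'. ((\<lambda>z. \<Sum>n. of_real (\<mu> n) * ((- z) ^ n / fact n)) has_field_derivative f') (at z)"
      unfolding eq by blast
  qed
  have "(\<lambda>n. LINT x|lborel. (- s) ^ n / fact n * (x ^ n * r x)) sums
      (LINT x|lborel. (\<Sum>n. (- s) ^ n / fact n * (x ^ n * r x)))"
  proof (rule sums_integral)
    show "integrable lborel (\<lambda>x. (- s) ^ n / fact n * (x ^ n * r x))" for n
      using int by simp
    show "AE x in lborel. summable (\<lambda>n. norm ((- s) ^ n / fact n * (x ^ n * r x)))"
    proof (rule AE_I2)
      fix x :: real
      have "summable (\<lambda>n. inverse (fact n) * (\<bar>s * x\<bar>) ^ n * \<bar>r x\<bar>)"
        by (intro summable_mult2 summable_exp)
      then show "summable (\<lambda>n. norm ((- s) ^ n / fact n * (x ^ n * r x)))"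
        by (simp add: abs_mult power_abs power_mult_distrib divide_inverse mult_ac)
    qed
    have "(LINT x|lborel. norm ((- s) ^ n / fact n * (x ^ n * r x))) = \<mu> n * (\<bar>s\<bar> ^ n / fact n)" for n
    proof -
      have "norm ((- s) ^ n / fact n * (x ^ n * r x)) = \<bar>s\<bar> ^ n / fact n * (x ^ n * r x)" for x
        unfolding norm_mult[of _ "x ^ n * r x"] using xr[of x n] by (simp only: real_norm_def abs_of_nonneg) (simp add: power_abs)
      then show ?thesis by (simp add: \<mu>)
    qed
    with sm[of "\<bar>s\<bar>"] show "summable (\<lambda>n. LINT x|lborel. norm ((- s) ^ n / fact n * (x ^ n * r x)))"
      by simp
  qed
  moreover have "(\<Sum>n. (- s) ^ n / fact n * (x ^ n * r x)) = exp (- s * x) * r x" for x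
  proof -
    have "(\<lambda>n. (- s * x) ^ n /\<^sub>R fact n * r x) sums (exp (- s * x) * r x)"
      by (intro sums_mult2 exp_converges)
    moreover have "(- s * x) ^ n /\<^sub>R fact n * r x = (- s) ^ n / fact n * (x ^ n * r x)" for n
      unfolding power_mult_distrib by (simp add: divide_inverse)
    ultimately show ?thesis by (simp add: sums_iff)
  qed
  moreover have "(LINT x|lborel. (- s) ^ n / fact n * (x ^ n * r x)) = \<mu> n * ((- s) ^ n / fact n)" for n
    by (simp add: \<mu>)
  ultimately have "(\<lambda>n. \<mu> n * ((- s) ^ n / fact n)) sums (LINT x|lborel. exp (- s * x) * r x)"
    by (simp only:)
  from sums_of_real[OF this, where 'a = complex]
  show "(\<Sum>n. of_real (\<mu> n) * ((- of_real s) ^ n / fact n)) = complex_of_real (LINT x|lborel. exp (- s * x) * r x)"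
    by (simp add: sums_iff)
qed

text \<open>
  By Bernoulli's inequality $x^n \ge n(x-1)$, so that $n\int_1^\infty (x-1)\,r(x)\,dx$ is bounded in $n$.
\<close>
lemma AE_eq_0_if_moments_bounded:
  fixes r :: "real \<Rightarrow> real"
  assumes r: "\<And>x. r x \<ge> 0" "\<And>x. x \<le> 0 \<Longrightarrow> r x = 0"
    and mom: "\<And>n. has_bochner_integral lborel (\<lambda>x. x ^ n * r x) (\<mu> n)"
    and bdd: "\<And>n. \<mu> n \<le> C"
  shows "AE x in lborel. x \<ge> 1 \<longrightarrow> r x = 0"
proof -
  have int: "integrable lborel (\<lambda>x. x ^ n * r x)" for n
    using mom[of n] by (auto simp: has_bochner_integral_iff)
  have [measurable]: "r \<in> borel_measurable borel"
    using borel_measurable_integrable[OF int[of 0]] by simp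
  define f where "f x = indicator {1<..} x * ((x - 1) * r x)" for x
  have f0: "f x \<ge> 0" for x using r by (auto simp: f_def indicator_def)
  have [measurable]: "f \<in> borel_measurable borel" unfolding f_def[abs_def] by measurable
  have bern: "real n * f x \<le> x ^ n * r x" for n x
  proof (cases "x > 1")
    case True
    have "1 + real n * (x - 1) \<le> (1 + (x - 1)) ^ n" using True by (intro Bernoulli_inequality) auto
    then have "real n * (x - 1) \<le> x ^ n" by simp
    from mult_right_mono[OF this r(1)[of x]] True show ?thesis by (simp add: f_def mult.assoc)
  next
    case False
    then show ?thesis using r[of x] by (cases "x \<le> 0") (auto simp: f_def)
  qed
  have intf: "integrable lborel f"
    by (rule Bochner_Integration.integrable_bound[OF int[of 1]])
       (use bern[of 1] f0 in \<open>auto simp: abs_of_nonneg intro: order_trans[OF _ abs_ge_self]\<close>)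
  have "real n * integral\<^sup>L lborel f \<le> C" for n
  proof -
    have "real n * integral\<^sup>L lborel f = (LINT x|lborel. real n * f x)" by simp
    also have "\<dots> \<le> (LINT x|lborel. x ^ n * r x)"
      using intf int bern by (intro integral_mono) auto
    also have "\<dots> \<le> C" using mom[of n] bdd[of n] by (simp add: has_bochner_integral_iff)
    finally show ?thesis .
  qed
  then have "integral\<^sup>L lborel f \<le> 0"
    by (meson not_le reals_Archimedean3)
  with f0 have "integral\<^sup>L lborel f = 0"
    by (intro antisym Bochner_Integration.integral_nonneg)
  then have "AE x in lborel. f x = 0"
    using integral_nonneg_eq_0_iff_AE[OF intf] f0 by simp
  then show ?thesis
    using AE_lborel_singleton[of 1] by eventually_elim (auto simp: f_def)
qed

section \<open>Growth of Gamma quotients\<close>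

text \<open>
  Compare the mean slope of the convex function $\ln\Gamma$ over $[x, x+b]$ with its increments $\ln(x-1)$ and
  $\ln(x+b)$ over the adjacent unit intervals.
\<close>
lemma Gamma_quotient_bounds:
  fixes x b :: real
  assumes x: "x > 1" and b: "b > 0"
  shows "(x - 1) powr b \<le> Gamma (x + b) / Gamma x" "Gamma (x + b) / Gamma x \<le> (x + b) powr b"
proof -
  have mvt: "\<exists>z. u < z \<and> z < v \<and> ln_Gamma v - ln_Gamma u = (v - u) * Digamma z" if "0 < u" "u < v" for u v :: real
    using that by (intro MVT2) (auto intro!: has_field_derivative_ln_Gamma_real)
  have step: "ln_Gamma (u + 1) - ln_Gamma u = ln u" if "u > 0" for u :: real
  proof -
    have "u \<notin> \<int>\<^sub>\<le>\<^sub>0" using that by (auto elim!: nonpos_Ints_cases)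
    then show ?thesis
      using that Gamma_plus1[of u] Gamma_real_pos[OF that, THEN less_imp_neq] by (simp add: ln_Gamma_real_pos ln_mult)
  qed
  obtain z where z: "x < z" "z < x + b" "ln_Gamma (x + b) - ln_Gamma x = b * Digamma z"
    using mvt[of x "x + b"] x b by auto
  obtain z1 where z1: "x - 1 < z1" "z1 < x" "ln (x - 1) = Digamma z1"
    using mvt[of "x - 1" x] step[of "x - 1"] x by auto
  obtain z2 where z2: "x + b < z2" "z2 < x + b + 1" "ln (x + b) = Digamma z2"
    using mvt[of "x + b" "x + b + 1"] step[of "x + b"] x b by auto
  have "Digamma z1 \<le> Digamma z" "Digamma z \<le> Digamma z2"
    using z z1 z2 x b by (auto intro!: Polygamma_real_mono)
  then have *: "b * ln (x - 1) \<le> ln_Gamma (x + b) - ln_Gamma x" "ln_Gamma (x + b) - ln_Gamma x \<le> b * ln (x + b)"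
    using z z1 z2 b by auto
  have **: "exp (ln_Gamma (x + b) - ln_Gamma x) = Gamma (x + b) / Gamma x"
    using x b by (simp add: exp_diff Gamma_real_pos_exp)
  show "(x - 1) powr b \<le> Gamma (x + b) / Gamma x" "Gamma (x + b) / Gamma x \<le> (x + b) powr b"
    using * x b unfolding **[symmetric] by (simp_all add: powr_def)
qed

lemma Gamma_quotient_mono:
  fixes x y b :: real
  assumes "0 < x" "x \<le> y" "b \<ge> 0"
  shows "Gamma y / Gamma (y + b) \<le> Gamma x / Gamma (x + b)"
proof -
  have "ln_Gamma (x + b) - ln_Gamma x \<le> ln_Gamma (y + b) - ln_Gamma y"
  proof (rule DERIV_nonneg_imp_nondecreasing[OF assms(2)])
    fix t assume t: "x \<le> t" "t \<le> y"
    then have "((\<lambda>t. ln_Gamma (t + b) - ln_Gamma t) has_real_derivative Digamma (t + b) - Digamma t) (at t)"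
      using assms by (auto intro!: derivative_eq_intros)
    moreover have "Digamma t \<le> Digamma (t + b)"
      using t assms by (intro Polygamma_real_mono) auto
    ultimately show "\<exists>D. ((\<lambda>t. ln_Gamma (t + b) - ln_Gamma t) has_real_derivative D) (at t) \<and> 0 \<le> D"
      by force
  qed
  then have "exp (ln_Gamma y - ln_Gamma (y + b)) \<le> exp (ln_Gamma x - ln_Gamma (x + b))" by simp
  then show ?thesis using assms by (simp add: exp_diff Gamma_real_pos_exp)
qed

text \<open>
  The limit is required to be nonzero so that the notion is stable under quotients.
\<close>
definition ratio_growth :: "(nat \<Rightarrow> real) \<Rightarrow> real \<Rightarrow> bool" where
  "ratio_growth f c \<longleftrightarrow> (\<exists>C. C \<noteq> 0 \<and> (\<lambda>n. f (Suc n) / f n / real (Suc n) powr c) \<longlonglongrightarrow> C)"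

lemma ratio_growth_mult:
  assumes "ratio_growth f c" "ratio_growth g d"
  shows "ratio_growth (\<lambda>n. f n * g n) (c + d)"
proof -
  obtain C D where C: "C \<noteq> 0" "(\<lambda>n. f (Suc n) / f n / real (Suc n) powr c) \<longlonglongrightarrow> C"
    and D: "D \<noteq> 0" "(\<lambda>n. g (Suc n) / g n / real (Suc n) powr d) \<longlonglongrightarrow> D"
    using assms unfolding ratio_growth_def by blast
  have "(\<lambda>n. (f (Suc n) / f n / real (Suc n) powr c) * (g (Suc n) / g n / real (Suc n) powr d)) \<longlonglongrightarrow> C * D"
    by (intro tendsto_mult C D)
  then have "(\<lambda>n. (f (Suc n) * g (Suc n)) / (f n * g n) / real (Suc n) powr (c + d)) \<longlonglongrightarrow> C * D"
    by (simp add: powr_add mult_ac)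
  with C D show ?thesis unfolding ratio_growth_def by (intro exI[of _ "C * D"]) auto
qed

lemma ratio_growth_inverse:
  assumes "ratio_growth f c"
  shows "ratio_growth (\<lambda>n. 1 / f n) (- c)"
proof -
  obtain C where C: "C \<noteq> 0" "(\<lambda>n. f (Suc n) / f n / real (Suc n) powr c) \<longlonglongrightarrow> C"
    using assms unfolding ratio_growth_def by blast
  have "(\<lambda>n. inverse (f (Suc n) / f n / real (Suc n) powr c)) \<longlonglongrightarrow> inverse C"
    by (intro tendsto_inverse C)
  then have "(\<lambda>n. (1 / f (Suc n)) / (1 / f n) / real (Suc n) powr (- c)) \<longlonglongrightarrow> inverse C"
    by (simp add: powr_minus divide_inverse mult_ac)
  with C show ?thesis unfolding ratio_growth_def by (intro exI[of _ "inverse C"]) auto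
qed

lemma ratio_growth_prod:
  assumes "finite I" "\<And>i. i \<in> I \<Longrightarrow> ratio_growth (f i) (c i)"
  shows "ratio_growth (\<lambda>n. \<Prod>i\<in>I. f i n) (\<Sum>i\<in>I. c i)"
  using assms
proof (induction I rule: finite_induct)
  case empty
  show ?case unfolding ratio_growth_def by (intro exI[of _ 1]) simp
next
  case (insert i I)
  then show ?case by (simp add: ratio_growth_mult)
qed

lemma ratio_growth_Gamma:
  assumes b: "b > 0"
  shows "ratio_growth (\<lambda>n. Gamma (B + b * real n)) b"
proof -
  have "(\<lambda>n. Gamma (B + b * real (Suc n)) / Gamma (B + b * real n) / real (Suc n) powr b) \<longlonglongrightarrow> b powr b"
  proof (rule tendsto_sandwich)
    have "(\<lambda>n. (B + b * real n - 1) / real (Suc n)) \<longlonglongrightarrow> b" "(\<lambda>n. (B + b * real n + b) / real (Suc n)) \<longlonglongrightarrow> b"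
      by real_asymp+
    then show "(\<lambda>n. ((B + b * real n - 1) / real (Suc n)) powr b) \<longlonglongrightarrow> b powr b"
      "(\<lambda>n. ((B + b * real n + b) / real (Suc n)) powr b) \<longlonglongrightarrow> b powr b"
      using b by (auto intro!: tendsto_powr tendsto_const)
    have "filterlim (\<lambda>n. B + b * real n) at_top sequentially"
      using b by (intro filterlim_tendsto_add_at_top[OF tendsto_const] filterlim_tendsto_pos_mult_at_top[OF tendsto_const]
        filterlim_real_sequentially)
    then have ev: "eventually (\<lambda>n. B + b * real n > 1) sequentially"
      by (auto simp: filterlim_at_top_dense)
    have eq: "Gamma (B + b * real (Suc n)) = Gamma (B + b * real n + b)" for n
      by (simp add: algebra_simps)
    show "eventually (\<lambda>n. ((B + b * real n - 1) / real (Suc n)) powr b \<le> Gamma (B + b * real (Suc n)) / Gamma (B + b * real n) / real (Suc n) powr b) sequentially"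
      using ev
    proof eventually_elim
      case (elim n)
      from divide_right_mono[OF Gamma_quotient_bounds(1)[OF elim b], of "real (Suc n) powr b"] elim b show ?case
        by (simp add: powr_divide eq del: of_nat_Suc)
    qed
    show "eventually (\<lambda>n. Gamma (B + b * real (Suc n)) / Gamma (B + b * real n) / real (Suc n) powr b \<le> ((B + b * real n + b) / real (Suc n)) powr b) sequentially"
      using ev
    proof eventually_elim
      case (elim n)
      from divide_right_mono[OF Gamma_quotient_bounds(2)[OF elim b], of "real (Suc n) powr b"] elim b show ?case
        by (simp add: powr_divide eq del: of_nat_Suc)
    qed
  qed
  then show ?thesis using b unfolding ratio_growth_def by (intro exI[of _ "b powr b"]) auto
qed

lemma ratio_growth_summable:
  assumes f: "ratio_growth f c" and c: "c < 1" and nz: "\<And>n. f n \<noteq> 0"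
  shows "summable (\<lambda>n. f n * (R ^ n / fact n))"
proof -
  obtain C where C: "(\<lambda>n. f (Suc n) / f n / real (Suc n) powr c) \<longlonglongrightarrow> C"
    using f unfolding ratio_growth_def by blast
  have "(\<lambda>n. real (Suc n) powr (c - 1)) \<longlonglongrightarrow> 0" using c by real_asymp
  then have "(\<lambda>n. f (Suc n) / f n / real (Suc n) powr c * R * real (Suc n) powr (c - 1)) \<longlonglongrightarrow> C * R * 0"
    by (intro tendsto_mult C tendsto_const)
  moreover have "f (Suc n) / f n / real (Suc n) powr c * R * real (Suc n) powr (c - 1) = f (Suc n) / f n * R / real (Suc n)" for n
    by (simp add: powr_diff del: of_nat_Suc)
  ultimately have "(\<lambda>n. f (Suc n) / f n * R / real (Suc n)) \<longlonglongrightarrow> 0" by simp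
  from tendstoD[OF this, of "1/2"] obtain N where N: "\<And>n. n \<ge> N \<Longrightarrow> \<bar>f (Suc n) / f n * R / real (Suc n)\<bar> < 1/2"
    by (auto simp: eventually_sequentially)
  show ?thesis
  proof (rule summable_ratio_test[of "1/2" N])
    fix n assume n: "N \<le> n"
    have "f (Suc n) * (R ^ Suc n / fact (Suc n)) = (f (Suc n) / f n * R / real (Suc n)) * (f n * (R ^ n / fact n))"
      using nz[of n] by (simp add: fact_Suc divide_simps del: of_nat_Suc)
    then have "norm (f (Suc n) * (R ^ Suc n / fact (Suc n))) = \<bar>f (Suc n) / f n * R / real (Suc n)\<bar> * norm (f n * (R ^ n / fact n))"
      by (simp only: norm_mult real_norm_def abs_mult)
    also have "\<dots> \<le> 1/2 * norm (f n * (R ^ n / fact n))"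
      using N[OF n] by (intro mult_right_mono) auto
    finally show "norm (f (Suc n) * (R ^ Suc n / fact (Suc n))) \<le> 1/2 * norm (f n * (R ^ n / fact n))" .
  qed simp
qed

section \<open>The Fox kernels of the corollary\<close>

lemma strip_transform_measurable:
  assumes "strip_transform u v K" "u \<le> \<sigma>" "\<sigma> \<le> v"
  shows "(\<lambda>t. K (Complex \<sigma> t)) \<in> borel_measurable borel"
proof -
  from assms(1) obtain M where M: "finite_measure M" "sets M = sets borel"
    "\<And>s. u \<le> Re s \<Longrightarrow> Re s \<le> v \<Longrightarrow>
       has_bochner_integral M (\<lambda>y. exp ((s - of_real u) * of_real y)) (K s)"
    by (rule strip_transformE) blast
  interpret finite_measure M by fact
  note [measurable_cong] = M(2)
  have "K (Complex \<sigma> t) = (LINT y|M. exp ((of_real (\<sigma> - u) + \<i> * of_real t) * of_real y))" for t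
  proof -
    have "Complex \<sigma> t - of_real u = of_real (\<sigma> - u) + \<i> * of_real t" by (simp add: complex_eq_iff)
    with M(3)[of "Complex \<sigma> t"] assms show ?thesis by (simp add: has_bochner_integral_iff)
  qed
  moreover have "(\<lambda>t. LINT y|M. exp ((of_real (\<sigma> - u) + \<i> * complex_of_real t) * of_real y)) \<in> borel_measurable borel"
    by (rule borel_measurable_lebesgue_integral) measurable
  ultimately show ?thesis by simp
qed

lemma laplace_of_moments:
  fixes \<rho> :: "real \<Rightarrow> complex"
  assumes real: "\<And>x. x > 0 \<Longrightarrow> Im (\<rho> x) = 0" and nonneg: "\<And>x. x > 0 \<Longrightarrow> Re (\<rho> x) \<ge> 0"
    and mom: "\<And>n. has_bochner_integral lborel (\<lambda>x. x ^ n * (indicator {0<..} x * Re (\<rho> x))) (\<mu> n)"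
  shows "laplace_converges \<rho>"
    and "real_completely_monotone (laplace \<rho>)"
    and "\<lbrakk>\<And>R. summable (\<lambda>n. \<mu> n * (R ^ n / fact n))\<rbrakk> \<Longrightarrow>
      (\<forall>z. summable (\<lambda>n. of_real (\<mu> n) * ((- z) ^ n / fact n) :: complex)) \<and>
      entire_extension (\<lambda>z. \<Sum>n. of_real (\<mu> n) * ((- z) ^ n / fact n)) (laplace \<rho>)"
proof -
  define r where "r x = indicator {0<..} x * Re (\<rho> x)" for x
  have r: "r x \<ge> 0" "x \<le> 0 \<Longrightarrow> r x = 0" for x
    using nonneg[of x] by (auto simp: r_def indicator_def)
  have mom: "has_bochner_integral lborel (\<lambda>x. x ^ n * r x) (\<mu> n)" for n
    using mom[of n] by (simp add: r_def)
  then have int: "integrable lborel (\<lambda>x. x ^ n * r x)" for n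
    by (auto simp: has_bochner_integral_iff)
  have [measurable]: "r \<in> borel_measurable borel"
    using borel_measurable_integrable[OF int[of 0]] by simp
  have eq: "indicator {0<..} x *\<^sub>R (complex_of_real (exp (- s * x)) * \<rho> x) = of_real (exp (- s * x) * r x)" for s x
    using real[of x] by (auto simp: r_def indicator_def complex_eq_iff)
  have "integrable lborel (\<lambda>x. exp (- s * x) * r x)" if "s \<ge> 0" for s
  proof (rule Bochner_Integration.integrable_bound[OF int[of 0]])
    show "AE x in lborel. norm (exp (- s * x) * r x) \<le> norm (x ^ 0 * r x)"
    proof (rule AE_I2)
      fix x show "norm (exp (- s * x) * r x) \<le> norm (x ^ 0 * r x)"
      proof (cases "x \<le> 0")
        case False
        with that have "exp (- s * x) \<le> 1" by simp
        then show ?thesis using r(1)[of x] by (simp add: abs_mult mult_left_le_one_le)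
      qed (use r in simp)
    qed
  qed simp
  then show "laplace_converges \<rho>"
    unfolding laplace_converges_def set_integrable_def eq by (intro allI impI integrable_of_real)
  have lap: "laplace \<rho> s = of_real (LINT x|lborel. exp (- s * x) * r x)" for s
    unfolding laplace_def set_lebesgue_integral_def eq integral_complex_of_real ..
  have "completely_monotone_nonneg (\<lambda>s. Re (laplace \<rho> s))"
    by (rule completely_monotone_nonneg_laplace[OF r int]) (simp_all only: lap Re_complex_of_real)
  then show "real_completely_monotone (laplace \<rho>)"
    by (simp add: real_completely_monotone_def lap)
  show "(\<forall>z. summable (\<lambda>n. of_real (\<mu> n) * ((- z) ^ n / fact n) :: complex)) \<and>
      entire_extension (\<lambda>z. \<Sum>n. of_real (\<mu> n) * ((- z) ^ n / fact n)) (laplace \<rho>)"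
    if "\<And>R. summable (\<lambda>n. \<mu> n * (R ^ n / fact n))"
    using laplace_power_series[OF r mom that] by (auto simp: entire_extension_def lap)
qed

lemma pars_0 [simp]: "pars A a 0 = []"
  by (simp add: pars_def)

lemma prod_list_pars: "(\<Prod>(A, a)\<leftarrow>pars A a M. f A a) = (\<Prod>i=1..M. f (A i) (a i))"
  by (induction M) (auto simp: pars_def)

lemma set_pars: "set (pars A a M) = (\<lambda>i. (A i, a i)) ` {1..M}"
  by (auto simp: pars_def)

text \<open>
  The parameters of class 7, with $m$, $p$ and $l$ allowed to be 0. If all three vanish, the kernel is constant
  and has no inverse Mellin integral; its measure is the Dirac distribution of class 0.
\<close>
locale fox_parameters =
  fixes m p l :: nat and e \<eta> b a \<alpha> \<beta> \<gamma> :: "nat \<Rightarrow> real"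
  assumes eta: "\<And>j. j \<in> {1..p + m} \<Longrightarrow> \<eta> j > 0 \<and> e j + \<eta> j > 0"
    and b: "\<And>i. i \<in> {1..p} \<Longrightarrow> b i > 0"
    and stable: "\<And>k. k \<in> {1..l} \<Longrightarrow> \<gamma> k > 0 \<and> \<alpha> k > 0 \<and> 0 < \<beta> k \<and> \<beta> k < 1 \<and> a k + \<alpha> k > 0"
    and b_sum: "p > 0 \<Longrightarrow> (\<Sum>i=1..p. b i) > 1"
    and nonempty: "m > 0 \<or> p > 0 \<or> l > 0"
begin

abbreviation "c \<equiv> c_par a \<alpha> \<gamma>"
abbreviation "upper \<equiv> beta_upper p e \<eta> b @ stable_upper l a \<alpha> \<beta> \<gamma>"
abbreviation "lower \<equiv> pars e \<eta> (p + m) @ stable_lower l a \<alpha> \<gamma>"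

definition admissible :: "real \<Rightarrow> bool" where
  "admissible \<sigma> \<longleftrightarrow> (\<forall>i\<in>{1..p + m}. e i + \<sigma> * \<eta> i > 0) \<and> (\<forall>k\<in>{1..l}. c k + \<sigma> * (\<alpha> k * \<gamma> k) > 0)"

text \<open>
  The kernel at $s = n+1$, that is, the coefficient of the Wright series.
\<close>
definition moment :: "nat \<Rightarrow> real" where
  "moment n = (\<Prod>i=1..m + p. Gamma (e i + \<eta> i * (1 + real n))) * (\<Prod>k=1..l. Gamma (a k + \<alpha> k + \<alpha> k * \<gamma> k * real n)) /
     ((\<Prod>i=1..p. Gamma (e i + b i + \<eta> i * (1 + real n))) *
      (\<Prod>k=1..l. Gamma (1 + \<beta> k * (a k + \<alpha> k - 1) + \<alpha> k * \<beta> k * \<gamma> k * real n)))"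

lemma lower_pos: "\<forall>(B, b)\<in>set lower. b > 0"
  using eta stable by (auto simp: stable_lower_def set_pars)

lemma admissible_iff: "poles_left_of lower \<sigma> \<longleftrightarrow> admissible \<sigma>"
  unfolding poles_left_of_iff[OF lower_pos] admissible_def
  by (auto simp: stable_lower_def set_pars)

lemma admissible_1: "admissible 1"
  using eta stable by (auto simp: admissible_def c_par_def)

lemma prod_split: "(\<Prod>i=1..p + m. f i) = (\<Prod>i=1..p. f i) * (\<Prod>i=p+1..p+m. f i :: 'a :: comm_monoid_mult)"
  using prod.ub_add_nat[of 1 p f m] by simp

lemma sum_split: "(\<Sum>i=1..p + m. f i) = (\<Sum>i=1..p. f i) + (\<Sum>i=p+1..p+m. f i :: 'a :: comm_monoid_add)"
  using sum.ub_add_nat[of 1 p f m] by simp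

lemma fox_kernel_eq: "fox_kernel upper lower s =
   (\<Prod>i=1..p. Gamma (of_real (e i) + s * of_real (\<eta> i)) / Gamma (of_real (e i + b i) + s * of_real (\<eta> i))) *
   (\<Prod>i=p+1..p+m. Gamma (of_real (e i) + s * of_real (\<eta> i))) *
   (\<Prod>k=1..l. Gamma (of_real (c k) + s * of_real (\<alpha> k * \<gamma> k)) /
      Gamma (of_real (1 - \<beta> k + \<beta> k * c k) + s * of_real (\<alpha> k * \<beta> k * \<gamma> k)))"
  unfolding fox_kernel_def beta_upper_def stable_upper_def stable_lower_def map_append prod_list.append
    prod_list_pars prod_split prod_dividef by simp

text \<open>
  The ratios with parameter $\beta_k$ satisfy the hypotheses on Gamma ratios. The last equation evaluates the
  decay exponent, which is unbounded in $n$ since $\beta_k < 1$.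
\<close>
lemma stable_ratio:
  assumes k: "k \<in> {1..l}"
  shows "0 < \<alpha> k * \<beta> k * \<gamma> k" "\<alpha> k * \<beta> k * \<gamma> k \<le> \<alpha> k * \<gamma> k"
    "\<alpha> k * \<beta> k * \<gamma> k * c k \<le> \<alpha> k * \<gamma> k * (1 - \<beta> k + \<beta> k * c k)"
    "\<alpha> k * \<gamma> k * (1 - \<beta> k + \<beta> k * c k) / (\<alpha> k * \<beta> k * \<gamma> k) - c k + (\<alpha> k * \<gamma> k / (\<alpha> k * \<beta> k * \<gamma> k) - 1) * n
      = (1 / \<beta> k - 1) * (1 + n)"
proof -
  have pos: "\<gamma> k > 0" "\<alpha> k > 0" "0 < \<beta> k" "\<beta> k < 1" using stable[OF k] by auto
  show "0 < \<alpha> k * \<beta> k * \<gamma> k" using pos by simp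
  have "\<alpha> k * \<gamma> k * \<beta> k \<le> \<alpha> k * \<gamma> k * 1" using pos by (intro mult_left_mono) auto
  then show "\<alpha> k * \<beta> k * \<gamma> k \<le> \<alpha> k * \<gamma> k" by (simp add: mult_ac)
  have "\<alpha> k * \<gamma> k * (\<beta> k * c k) \<le> \<alpha> k * \<gamma> k * (1 - \<beta> k + \<beta> k * c k)" using pos by (intro mult_left_mono) auto
  then show "\<alpha> k * \<beta> k * \<gamma> k * c k \<le> \<alpha> k * \<gamma> k * (1 - \<beta> k + \<beta> k * c k)" by (simp add: mult_ac)
  show "\<alpha> k * \<gamma> k * (1 - \<beta> k + \<beta> k * c k) / (\<alpha> k * \<beta> k * \<gamma> k) - c k + (\<alpha> k * \<gamma> k / (\<alpha> k * \<beta> k * \<gamma> k) - 1) * n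
      = (1 / \<beta> k - 1) * (1 + n)"
    using pos by (simp add: divide_simps) (simp add: algebra_simps)
qed

lemma strip_transform_fox_kernel:
  assumes "admissible u" "u \<le> v"
  shows "strip_transform u v (fox_kernel upper lower)"
  unfolding fox_kernel_eq[abs_def]
proof (intro strip_transform_mult strip_transform_prod)
  show "strip_transform u v (\<lambda>s. Gamma (of_real (e i) + s * of_real (\<eta> i)) / Gamma (of_real (e i + b i) + s * of_real (\<eta> i)))"
    if i: "i \<in> {1..p}" for i
    using i assms eta[of i] b[OF i] by (intro strip_transform_Gamma_ratio) (auto simp: admissible_def)
  show "strip_transform u v (\<lambda>s. Gamma (of_real (e i) + s * of_real (\<eta> i)))"
    if i: "i \<in> {p+1..p+m}" for i
    using i assms eta[of i] by (intro strip_transform_Gamma) (auto simp: admissible_def)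
  show "strip_transform u v (\<lambda>s. Gamma (of_real (c k) + s * of_real (\<alpha> k * \<gamma> k)) /
      Gamma (of_real (1 - \<beta> k + \<beta> k * c k) + s * of_real (\<alpha> k * \<beta> k * \<gamma> k)))" if k: "k \<in> {1..l}" for k
    using k assms by (intro strip_transform_Gamma_ratio stable_ratio) (auto simp: admissible_def)
qed auto

lemma vertical_decay_fox_kernel:
  assumes "admissible \<sigma>"
  obtains d where "d > 1" "vertical_decay \<sigma> d (fox_kernel upper lower)"
proof -
  \<comment> \<open>makes the exponent of the $k$-th ratio with parameter $\beta_k$ at least 2\<close>
  define k0 where "k0 k = nat \<lceil>2 / (1 / \<beta> k - 1)\<rceil>" for k
  define d where "d = (\<Sum>i=1..p. b i) + (\<Sum>i=p+1..p+m. 2) + (\<Sum>k=1..l. (1 / \<beta> k - 1) * (1 + real (k0 k)))"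
  have "vertical_decay \<sigma> d (fox_kernel upper lower)"
    unfolding fox_kernel_eq[abs_def] d_def
  proof (intro vertical_decay_mult vertical_decay_prod)
    show "vertical_decay \<sigma> (b i) (\<lambda>s. Gamma (of_real (e i) + s * of_real (\<eta> i)) / Gamma (of_real (e i + b i) + s * of_real (\<eta> i)))"
      if i: "i \<in> {1..p}" for i
      using vertical_decay_Gamma_ratio[of "\<eta> i" "\<eta> i" "e i" "e i + b i" \<sigma> 0] i assms eta[of i] b[OF i]
      by (auto simp: admissible_def)
    show "vertical_decay \<sigma> 2 (\<lambda>s. Gamma (of_real (e i) + s * of_real (\<eta> i)))"
      if i: "i \<in> {p+1..p+m}" for i
      using i assms eta[of i] by (intro vertical_decay_Gamma) (auto simp: admissible_def)
    show "vertical_decay \<sigma> ((1 / \<beta> k - 1) * (1 + real (k0 k))) (\<lambda>s. Gamma (of_real (c k) + s * of_real (\<alpha> k * \<gamma> k)) /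
      Gamma (of_real (1 - \<beta> k + \<beta> k * c k) + s * of_real (\<alpha> k * \<beta> k * \<gamma> k)))" if k: "k \<in> {1..l}" for k
      unfolding stable_ratio(4)[OF k, symmetric]
      using k assms by (intro vertical_decay_Gamma_ratio stable_ratio) (auto simp: admissible_def)
  qed auto
  moreover have "d > 1"
  proof -
    have k0: "(1 / \<beta> k - 1) * (1 + real (k0 k)) \<ge> 2" if "k \<in> {1..l}" for k
    proof -
      have pos: "1 / \<beta> k - 1 > 0" using stable[OF that] by simp
      have "real (k0 k) \<ge> 2 / (1 / \<beta> k - 1)" unfolding k0_def by linarith
      then have "(1 / \<beta> k - 1) * (1 + real (k0 k)) \<ge> (1 / \<beta> k - 1) * (2 / (1 / \<beta> k - 1))"
        using pos by (intro mult_left_mono) auto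
      also have "(1 / \<beta> k - 1) * (2 / (1 / \<beta> k - 1)) = 2"
      proof -
        have "x * (2 / x) = 2" if "x > 0" for x :: real using that by simp
        from this[OF pos] show ?thesis .
      qed
      finally show ?thesis .
    qed
    have "(\<Sum>k=1..l. (1 / \<beta> k - 1) * (1 + real (k0 k))) \<ge> (\<Sum>k=1..l. 2)"
      by (intro sum_mono k0) auto
    then have "(\<Sum>k=1..l. (1 / \<beta> k - 1) * (1 + real (k0 k))) \<ge> 2 * real l" by simp
    moreover have "(\<Sum>i=p+1..p+m. 2 :: real) = 2 * real m" by simp
    moreover have "(\<Sum>i=1..p. b i) \<ge> 0" using b by (intro sum_nonneg) (auto intro: less_imp_le)
    moreover have "real m \<ge> 1 \<or> p > 0 \<or> real l \<ge> 1" using nonempty by auto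
    ultimately show ?thesis unfolding d_def using b_sum by (cases "p > 0") auto
  qed
  ultimately show ?thesis using that by blast
qed

lemma moment_pos: "moment n > 0"
proof -
  have eta': "e i + \<eta> i * (1 + real n) > 0" if "i \<in> {1..p + m}" for i
  proof -
    have "\<eta> i * real n \<ge> 0" "e i + \<eta> i > 0" using eta[OF that] by auto
    then show ?thesis by (simp add: distrib_left)
  qed
  show ?thesis
    unfolding moment_def
  proof (intro divide_pos_pos mult_pos_pos prod_pos ballI Gamma_real_pos)
    show "e i + \<eta> i * (1 + real n) > 0" if "i \<in> {1..m + p}" for i
      using that by (intro eta') auto
    show "e i + b i + \<eta> i * (1 + real n) > 0" if "i \<in> {1..p}" for i
      using eta'[of i] b[OF that] that by auto
    show "a k + \<alpha> k + \<alpha> k * \<gamma> k * real n > 0" if "k \<in> {1..l}" for k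
      using stable[OF that] by (intro add_pos_nonneg[of "a k + \<alpha> k"]) auto
    show "1 + \<beta> k * (a k + \<alpha> k - 1) + \<alpha> k * \<beta> k * \<gamma> k * real n > 0" if "k \<in> {1..l}" for k
    proof (rule add_pos_nonneg)
      have "1 + \<beta> k * (a k + \<alpha> k - 1) = (1 - \<beta> k) + \<beta> k * (a k + \<alpha> k)" by (simp add: algebra_simps)
      also have "\<dots> > 0"
        using stable[OF that] mult_pos_pos[of "\<beta> k" "a k + \<alpha> k"] by linarith
      finally show "1 + \<beta> k * (a k + \<alpha> k - 1) > 0" .
    qed (use stable[OF that] in auto)
  qed
qed

lemma moment_eq_ratios: "moment n =
   (\<Prod>i=1..p. Gamma (e i + \<eta> i * (1 + real n)) / Gamma (e i + b i + \<eta> i * (1 + real n))) *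
   (\<Prod>i=p+1..p+m. Gamma (e i + \<eta> i * (1 + real n))) *
   (\<Prod>k=1..l. Gamma (a k + \<alpha> k + \<alpha> k * \<gamma> k * real n) / Gamma (1 + \<beta> k * (a k + \<alpha> k - 1) + \<alpha> k * \<beta> k * \<gamma> k * real n))"
  unfolding moment_def add.commute[of m p] prod_split prod_dividef by simp

lemma fox_kernel_moment: "fox_kernel upper lower (of_real (real n + 1)) = of_real (moment n)"
proof -
  have "of_real (e i) + of_real (real n + 1) * of_real (\<eta> i) = complex_of_real (e i + \<eta> i * (1 + real n))"
    "of_real (e i + b i) + of_real (real n + 1) * of_real (\<eta> i) = complex_of_real (e i + b i + \<eta> i * (1 + real n))"
    "of_real (c k) + of_real (real n + 1) * of_real (\<alpha> k * \<gamma> k) = complex_of_real (a k + \<alpha> k + \<alpha> k * \<gamma> k * real n)"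
    "of_real (1 - \<beta> k + \<beta> k * c k) + of_real (real n + 1) * of_real (\<alpha> k * \<beta> k * \<gamma> k) =
      complex_of_real (1 + \<beta> k * (a k + \<alpha> k - 1) + \<alpha> k * \<beta> k * \<gamma> k * real n)" for i k
    unfolding of_real_add[symmetric] of_real_mult[symmetric] of_real_eq_iff by (simp_all add: c_par_def algebra_simps)
  then show ?thesis
    unfolding fox_kernel_eq moment_eq_ratios by (simp only: Gamma_complex_of_real of_real_mult of_real_prod of_real_divide)
qed

lemma K7_eq_moment: "K7 m p l e \<eta> b a \<alpha> \<beta> = moment 0"
  unfolding moment_eq_ratios K7_def K3_def K4_def by (simp add: algebra_simps)

text \<open>
  The line $\sigma$ is the one that the definition of the Fox function picks; the strip is taken wide enough to
  contain it together with 1 and $n+1$.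
\<close>
lemma fox_H_density:
  shows "\<And>x. x > 0 \<Longrightarrow> Im (fox_H upper lower x) = 0"
    and "\<And>x. x > 0 \<Longrightarrow> Re (fox_H upper lower x) \<ge> 0"
    and "has_bochner_integral lborel (\<lambda>x. x ^ n * (indicator {0<..} x * Re (fox_H upper lower x))) (moment n)"
proof -
  define \<sigma> where "\<sigma> = (SOME \<sigma>. poles_left_of lower \<sigma>)"
  have \<sigma>: "admissible \<sigma>"
    unfolding \<sigma>_def admissible_iff[symmetric] by (rule someI_ex[OF ex_poles_left_of[OF lower_pos]])
  define u where "u = min \<sigma> 1"
  define v where "v = max \<sigma> (real n + 1)"
  have u: "admissible u" using \<sigma> admissible_1 by (simp add: u_def min_def)
  have uv: "u \<le> \<sigma>" "\<sigma> \<le> v" "u \<le> real n + 1" "real n + 1 \<le> v" by (auto simp: u_def v_def)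
  have strip: "strip_transform u v (fox_kernel upper lower)"
    using u uv by (intro strip_transform_fox_kernel) auto
  obtain d where d: "d > 1" "vertical_decay \<sigma> d (fox_kernel upper lower)"
    using vertical_decay_fox_kernel[OF \<sigma>] .
  have int: "integrable lborel (\<lambda>t. fox_kernel upper lower (Complex \<sigma> t))"
    by (rule vertical_decay_integrable[OF d(2,1) strip_transform_measurable[OF strip uv(1,2)]])
  have nz: "fox_kernel upper lower (of_real \<sigma>) \<noteq> 0"
  proof -
    have "Re (of_real (1 - \<beta> k + \<beta> k * c k) + of_real \<sigma> * complex_of_real (\<alpha> k * \<beta> k * \<gamma> k)) > 0" if k: "k \<in> {1..l}" for k
    proof -
      have "(1 - \<beta> k) + \<beta> k * (c k + \<sigma> * (\<alpha> k * \<gamma> k)) > 0"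
        using \<sigma> stable[OF k] k mult_pos_pos[of "\<beta> k" "c k + \<sigma> * (\<alpha> k * \<gamma> k)"]
        unfolding admissible_def by fastforce
      then show ?thesis by (simp add: algebra_simps)
    qed
    moreover have "Re (of_real (e i + b i) + of_real \<sigma> * complex_of_real (\<eta> i)) > 0" if i: "i \<in> {1..p}" for i
    proof -
      have "e i + \<sigma> * \<eta> i > 0" using \<sigma> i by (simp add: admissible_def)
      with b[OF i] show ?thesis by simp
    qed
    ultimately show ?thesis
      unfolding fox_kernel_eq using \<sigma>
      by (auto simp: admissible_def intro!: Gamma_nonzero_if_Re_pos simp del: of_real_add of_real_mult of_real_diff)
  qed
  have H: "fox_H upper lower = vertical_inverse_mellin \<sigma> (fox_kernel upper lower)"
    unfolding fox_H_def vertical_inverse_mellin_def \<sigma>_def Let_def ..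
  note inv = mellin_inversion[OF strip uv(1,2) int nz]
  show "Im (fox_H upper lower x) = 0" "Re (fox_H upper lower x) \<ge> 0" if "x > 0" for x
    unfolding H using inv(1,2)[OF that] by auto
  have eq: "indicator {0<..} x * (x powr (real n + 1 - 1) * y) = x ^ n * (indicator {0<..} x * y)" for x y :: real
    by (cases "x > 0") (auto simp: powr_realpow)
  from inv(4)[OF uv(3,4)] show "has_bochner_integral lborel (\<lambda>x. x ^ n * (indicator {0<..} x * Re (fox_H upper lower x))) (moment n)"
    unfolding H fox_kernel_moment eq Re_complex_of_real .
qed

lemma moment_growth: "ratio_growth moment (1 - Delta7 m p l \<eta> \<alpha> \<beta> \<gamma>)"
proof -
  have 1: "ratio_growth (\<lambda>n. Gamma (e i + \<eta> i * (1 + real n))) (\<eta> i)" if "i \<in> {1..p + m}" for i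
    using ratio_growth_Gamma[of "\<eta> i" "e i + \<eta> i"] eta[OF that] by (simp add: algebra_simps)
  have 2: "ratio_growth (\<lambda>n. Gamma (e i + b i + \<eta> i * (1 + real n))) (\<eta> i)" if "i \<in> {1..p}" for i
    using ratio_growth_Gamma[of "\<eta> i" "e i + b i + \<eta> i"] eta[of i] that by (simp add: algebra_simps)
  have "ratio_growth (\<lambda>n. (\<Prod>i=1..p + m. Gamma (e i + \<eta> i * (1 + real n))) * (\<Prod>k=1..l. Gamma (a k + \<alpha> k + \<alpha> k * \<gamma> k * real n)) *
     (1 / ((\<Prod>i=1..p. Gamma (e i + b i + \<eta> i * (1 + real n))) *
      (\<Prod>k=1..l. Gamma (1 + \<beta> k * (a k + \<alpha> k - 1) + \<alpha> k * \<beta> k * \<gamma> k * real n)))))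
     ((\<Sum>i=1..p + m. \<eta> i) + (\<Sum>k=1..l. \<alpha> k * \<gamma> k) + - ((\<Sum>i=1..p. \<eta> i) + (\<Sum>k=1..l. \<alpha> k * \<beta> k * \<gamma> k)))"
    using stable by (intro ratio_growth_mult ratio_growth_inverse ratio_growth_prod 1 2 ratio_growth_Gamma) auto
  also have "(\<Sum>i=1..p + m. \<eta> i) + (\<Sum>k=1..l. \<alpha> k * \<gamma> k) + - ((\<Sum>i=1..p. \<eta> i) + (\<Sum>k=1..l. \<alpha> k * \<beta> k * \<gamma> k))
     = 1 - Delta7 m p l \<eta> \<alpha> \<beta> \<gamma>"
    unfolding sum_split Delta7_def S_sum_def by (simp add: algebra_simps sum_subtractf)
  also have "(\<lambda>n. (\<Prod>i=1..p + m. Gamma (e i + \<eta> i * (1 + real n))) * (\<Prod>k=1..l. Gamma (a k + \<alpha> k + \<alpha> k * \<gamma> k * real n)) *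
     (1 / ((\<Prod>i=1..p. Gamma (e i + b i + \<eta> i * (1 + real n))) *
      (\<Prod>k=1..l. Gamma (1 + \<beta> k * (a k + \<alpha> k - 1) + \<alpha> k * \<beta> k * \<gamma> k * real n))))) = moment"
    by (simp add: fun_eq_iff moment_def add.commute[of m p])
  finally show ?thesis .
qed

lemma wright_term_eq: "wright_term (pars (\<lambda>i. e i + \<eta> i) \<eta> (m + p) @ pars (\<lambda>k. a k + \<alpha> k) (\<lambda>k. \<alpha> k * \<gamma> k) l)
    (pars (\<lambda>i. e i + b i + \<eta> i) \<eta> p @ pars (\<lambda>k. 1 + \<beta> k * (a k + \<alpha> k - 1)) (\<lambda>k. \<alpha> k * \<beta> k * \<gamma> k) l) z n
  = of_real (moment n) * (z ^ n / fact n)"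
  unfolding wright_term_def moment_def map_append prod_list.append prod_list_pars by (simp add: algebra_simps)

text \<open>
  The assertion on each of the classes 1 to 7, once the absent parameter lists are written as empty ones.
\<close>
definition laplace_is_wright :: "(real \<Rightarrow> complex) \<Rightarrow> bool" where
  "laplace_is_wright \<rho> \<longleftrightarrow>
    laplace_converges \<rho> \<and> real_completely_monotone (laplace \<rho>) \<and>
    (0 < Delta7 m p l \<eta> \<alpha> \<beta> \<gamma> \<longrightarrow>
      (\<exists>g. entire_extension g (laplace \<rho>) \<and>
        (\<forall>z. g z = 1 / of_real (K7 m p l e \<eta> b a \<alpha> \<beta>) *
               wright (pars (\<lambda>i. e i + \<eta> i) \<eta> (m + p) @ pars (\<lambda>k. a k + \<alpha> k) (\<lambda>k. \<alpha> k * \<gamma> k) l)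
                 (pars (\<lambda>i. e i + b i + \<eta> i) \<eta> p @ pars (\<lambda>k. 1 + \<beta> k * (a k + \<alpha> k - 1)) (\<lambda>k. \<alpha> k * \<beta> k * \<gamma> k) l) (- z) \<and>
             summable (\<lambda>n. of_real (moment n) * ((- z) ^ n / fact n)) \<and>
             g z = 1 / of_real (K7 m p l e \<eta> b a \<alpha> \<beta>) * (\<Sum>n. of_real (moment n) * ((- z) ^ n / fact n)))))"

lemma laplace_conclusion:
  assumes real: "\<And>x. x > 0 \<Longrightarrow> Im (\<rho> x) = 0" and nonneg: "\<And>x. x > 0 \<Longrightarrow> Re (\<rho> x) \<ge> 0"
    and mom: "\<And>n. has_bochner_integral lborel (\<lambda>x. x ^ n * (indicator {0<..} x * Re (\<rho> x))) (moment n / moment 0)"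
  shows "laplace_is_wright \<rho>"
  unfolding laplace_is_wright_def
proof (intro conjI impI)
  note lap = laplace_of_moments[of \<rho>, OF real nonneg mom]
  show "laplace_converges \<rho>" "real_completely_monotone (laplace \<rho>)"
    by (rule lap(1,2); assumption)+
  assume "0 < Delta7 m p l \<eta> \<alpha> \<beta> \<gamma>"
  then have sm: "summable (\<lambda>n. moment n * (R ^ n / fact n))" for R
    using moment_pos by (intro ratio_growth_summable[OF moment_growth]) (auto simp: less_imp_neq[symmetric])
  have "summable (\<lambda>n. moment n / moment 0 * (R ^ n / fact n))" for R
    using summable_divide[OF sm[of R], of "moment 0"] by (simp add: mult.commute)
  then have lap3: "\<And>z. summable (\<lambda>n. of_real (moment n / moment 0) * ((- z) ^ n / fact n) :: complex)"
      "entire_extension (\<lambda>z. \<Sum>n. of_real (moment n / moment 0) * ((- z) ^ n / fact n)) (laplace \<rho>)"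
    using lap(3) by blast+
  have m0: "moment 0 \<noteq> 0" using moment_pos[of 0] by simp
  have smz: "summable (\<lambda>n. of_real (moment n) * ((- z) ^ n / fact n) :: complex)" for z
    using summable_mult[OF lap3(1)[of z], of "of_real (moment 0)"] m0 by simp
  have sum_eq: "(\<Sum>n. of_real (moment n / moment 0) * ((- z) ^ n / fact n)) =
     1 / of_real (moment 0) * (\<Sum>n. of_real (moment n) * ((- z) ^ n / fact n))" for z :: complex
    using suminf_mult[OF smz[of z], of "1 / of_real (moment 0)"] by simp
  show "\<exists>g. entire_extension g (laplace \<rho>) \<and>
        (\<forall>z. g z = 1 / of_real (K7 m p l e \<eta> b a \<alpha> \<beta>) *
               wright (pars (\<lambda>i. e i + \<eta> i) \<eta> (m + p) @ pars (\<lambda>k. a k + \<alpha> k) (\<lambda>k. \<alpha> k * \<gamma> k) l)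
                 (pars (\<lambda>i. e i + b i + \<eta> i) \<eta> p @ pars (\<lambda>k. 1 + \<beta> k * (a k + \<alpha> k - 1)) (\<lambda>k. \<alpha> k * \<beta> k * \<gamma> k) l) (- z) \<and>
             summable (\<lambda>n. of_real (moment n) * ((- z) ^ n / fact n)) \<and>
             g z = 1 / of_real (K7 m p l e \<eta> b a \<alpha> \<beta>) * (\<Sum>n. of_real (moment n) * ((- z) ^ n / fact n)))"
    by (rule exI[of _ "\<lambda>z. \<Sum>n. of_real (moment n / moment 0) * ((- z) ^ n / fact n)"], rule conjI, rule lap3(2))
       (simp only: sum_eq wright_def wright_term_eq K7_eq_moment smz simp_thms)
qed

lemma rho7_density:
  defines "\<rho> \<equiv> rho7 m p l e \<eta> b a \<alpha> \<beta> \<gamma>"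
  shows "\<And>x. x > 0 \<Longrightarrow> Im (\<rho> x) = 0" "\<And>x. x > 0 \<Longrightarrow> Re (\<rho> x) \<ge> 0"
    and "has_bochner_integral lborel (\<lambda>x. x ^ n * (indicator {0<..} x * Re (\<rho> x))) (moment n / moment 0)"
proof -
  have \<rho>: "\<rho> x = of_real (1 / moment 0) * fox_H upper lower x" for x
    by (simp add: \<rho>_def rho7_def K7_eq_moment)
  show "Im (\<rho> x) = 0" "Re (\<rho> x) \<ge> 0" if "x > 0" for x
    using fox_H_density(1,2)[OF that] moment_pos[of 0] unfolding \<rho> by simp_all
  have "x ^ n * (indicator {0<..} x * Re (\<rho> x)) = x ^ n * (indicator {0<..} x * Re (fox_H upper lower x)) / moment 0" for x
    unfolding \<rho> by simp
  then show "has_bochner_integral lborel (\<lambda>x. x ^ n * (indicator {0<..} x * Re (\<rho> x))) (moment n / moment 0)"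
    using has_bochner_integral_divide_zero[OF fox_H_density(3)[of n], of "moment 0"] by simp
qed

lemma laplace_rho7: "laplace_is_wright (rho7 m p l e \<eta> b a \<alpha> \<beta> \<gamma>)"
  by (rule laplace_conclusion) (rule rho7_density; assumption)+

text \<open>
  The density of class 2 is the Fox function cut off at $x = 1$. Its moments agree with those of the whole Fox
  function, because the latter has decreasing moments and so vanishes almost everywhere on $[1,\infty)$.
\<close>
lemma laplace_rho2:
  assumes "m = 0" "l = 0"
  shows "laplace_is_wright (rho2 p e \<eta> b)"
proof (rule laplace_conclusion)
  have rho: "rho2 p e \<eta> b x = (if x < 1 then rho7 m p l e \<eta> b a \<alpha> \<beta> \<gamma> x else 0)" if "x > 0" for x
    using that assms
    by (simp add: rho2_def rho7_def K7_def K3_def K2_def K4_def stable_upper_def stable_lower_def)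
  show "Im (rho2 p e \<eta> b x) = 0" "Re (rho2 p e \<eta> b x) \<ge> 0" if "x > 0" for x
    using rho7_density(1,2)[OF that] by (auto simp: rho[OF that])
  fix n
  define r where "r x = indicator {0<..} x * Re (rho7 m p l e \<eta> b a \<alpha> \<beta> \<gamma> x)" for x
  have r: "r x \<ge> 0" "x \<le> 0 \<Longrightarrow> r x = 0" for x
    using rho7_density(2)[of x] by (auto simp: r_def indicator_def)
  have mom: "has_bochner_integral lborel (\<lambda>x. x ^ n * r x) (moment n / moment 0)" for n
    unfolding r_def by (rule rho7_density)
  have "AE x in lborel. x \<ge> 1 \<longrightarrow> r x = 0"
  proof (rule AE_eq_0_if_moments_bounded[OF r mom])
    fix n
    have "moment n \<le> moment 0"
      unfolding moment_eq_ratios using assms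
    proof (simp, intro prod_mono conjI)
      fix i assume i: "i \<in> {Suc 0..p}"
      then have i': "i \<in> {1..p}" "i \<in> {1..p + m}" by auto
      have le: "e i + \<eta> i \<le> e i + \<eta> i * (1 + real n)" using eta[OF i'(2)] by (simp add: distrib_left)
      show "Gamma (e i + \<eta> i * (1 + real n)) / Gamma (e i + b i + \<eta> i * (1 + real n)) \<le> Gamma (e i + \<eta> i) / Gamma (e i + b i + \<eta> i)"
        using Gamma_quotient_mono[OF _ le, of "b i"] eta[OF i'(2)] b[OF i'(1)] by (simp add: add_ac)
      show "0 \<le> Gamma (e i + \<eta> i * (1 + real n)) / Gamma (e i + b i + \<eta> i * (1 + real n))"
      proof (intro divide_nonneg_nonneg Gamma_real_nonneg)
        show "e i + \<eta> i * (1 + real n) > 0" using le eta[OF i'(2)] by linarith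
        then show "e i + b i + \<eta> i * (1 + real n) > 0" using b[OF i'(1)] by linarith
      qed
    qed
    then show "moment n / moment 0 \<le> 1" using moment_pos[of 0] by simp
  qed
  then have ae: "AE x in lborel. x ^ n * r x = x ^ n * (indicator {0<..} x * Re (rho2 p e \<eta> b x))"
    by eventually_elim (auto simp: r_def rho indicator_def)
  have meas': "(\<lambda>x. x ^ n * r x) \<in> borel_measurable lborel"
    using mom[of n] by (intro borel_measurable_integrable) (auto simp: has_bochner_integral_iff)
  have meas: "(\<lambda>x. x ^ n * (indicator {0<..} x * Re (rho2 p e \<eta> b x))) \<in> borel_measurable lborel"
  proof -
    have "(\<lambda>x. x ^ 0 * r x) \<in> borel_measurable lborel"
      using mom[of 0] by (intro borel_measurable_integrable) (auto simp: has_bochner_integral_iff)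
    then have [measurable]: "r \<in> borel_measurable lborel" by simp
    have "(\<lambda>x. x ^ n * (indicator {..<1} x * r x)) \<in> borel_measurable lborel" by measurable
    also have "(\<lambda>x. x ^ n * (indicator {..<1} x * r x)) = (\<lambda>x. x ^ n * (indicator {0<..} x * Re (rho2 p e \<eta> b x)))"
      by (auto simp: fun_eq_iff r_def rho indicator_def)
    finally show ?thesis .
  qed
  show "has_bochner_integral lborel (\<lambda>x. x ^ n * (indicator {0<..} x * Re (rho2 p e \<eta> b x))) (moment n / moment 0)"
    using mom[of n] has_bochner_integral_cong_AE[OF meas' meas ae] by simp
qed

end

section \<open>The corollary\<close>

lemma completely_monotone_exp_minus: "completely_monotone_nonneg (\<lambda>s. exp (- s))"
proof -
  have iter: "(deriv ^^ k) (\<lambda>s. exp (- s)) = (\<lambda>s. (- 1) ^ k * exp (- s :: real))" for k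
  proof (induction k)
    case (Suc k)
    have "((\<lambda>s. (- 1) ^ k * exp (- s)) has_real_derivative (- 1) ^ Suc k * exp (- s)) (at s)" for s :: real
      by (auto intro!: derivative_eq_intros)
    then show ?case by (simp add: Suc.IH fun_eq_iff DERIV_imp_deriv)
  qed simp
  have "(\<lambda>s. (- 1) ^ k * exp (- s :: real)) differentiable (at y)" for k y
  proof -
    have "((\<lambda>s. (- 1) ^ k * exp (- s)) has_real_derivative (- 1) ^ Suc k * exp (- y)) (at y)"
      by (auto intro!: derivative_eq_intros)
    then show ?thesis by (auto simp: real_differentiable_def)
  qed
  moreover have "(- 1) ^ k * ((- 1) ^ k * exp (- y :: real)) \<ge> 0" for k y
    by (simp add: mult.assoc[symmetric] power_mult_distrib[symmetric])
  ultimately show ?thesis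
    unfolding completely_monotone_nonneg_def completely_monotone_def iter
    by (auto intro!: continuous_intros)
qed

lemma laplace_rho0:
  shows "integrable rho0 (\<lambda>x. complex_of_real (exp (- s * x)))"
    and "laplace_measure rho0 s = of_real (exp (- s))"
    and "real_completely_monotone (laplace_measure rho0)"
proof -
  show "integrable rho0 (\<lambda>x. complex_of_real (exp (- s * x)))" for s
    unfolding rho0_def by (subst integrable_iff_bounded) (simp add: nn_integral_return)
  have eq: "laplace_measure rho0 s = of_real (exp (- s))" for s
    unfolding laplace_measure_def rho0_def by (subst integral_return) auto
  show "laplace_measure rho0 s = of_real (exp (- s))" by (rule eq)
  show "real_completely_monotone (laplace_measure rho0)"
    unfolding real_completely_monotone_def eq by (simp add: completely_monotone_exp_minus)
qed

theorem corollary9: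
  fixes m p l :: nat
    and e \<eta> b a \<alpha> \<beta> \<gamma> :: "nat \<Rightarrow> real"
  assumes "\<forall>j\<in>{1..p + m}. \<eta> j > 0 \<and> e j + \<eta> j > 0"
    and "\<forall>i\<in>{1..p}. b i > 0"
    and "\<forall>k\<in>{1..l}. \<gamma> k > 0 \<and> \<alpha> k > 0 \<and> 0 < \<beta> k \<and> \<beta> k < 1 \<and> a k + \<alpha> k > 0"
    and "p > 0 \<longrightarrow> (\<Sum>i=1..p. b i) > 1"
  shows "(m = 0 \<and> p = 0 \<longrightarrow>
           (\<forall>s\<ge>0. integrable rho0 (\<lambda>x. complex_of_real (exp (- s * x)))) \<and>
           real_completely_monotone (laplace_measure rho0) \<and>
           (0 < Delta0 \<longrightarrow>
             (\<exists>g. entire_extension g (laplace_measure rho0) \<and>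
               (\<forall>z. g z = wright [] [] (- z) \<and>
                 summable (\<lambda>n. (- z) ^ n / fact n) \<and> g z = (\<Sum>n. (- z) ^ n / fact n) \<and>
                 g z = exp (- z))))) \<and>
         (m > 0 \<longrightarrow>
           laplace_converges (rho1 m e \<eta>) \<and>
           real_completely_monotone (laplace (rho1 m e \<eta>)) \<and>
           (0 < Delta1 m \<eta> \<longrightarrow>
             (\<exists>g. entire_extension g (laplace (rho1 m e \<eta>)) \<and>
               (\<forall>z. g z = 1 / of_real (K1 m e \<eta>) * wright (pars (\<lambda>i. e i + \<eta> i) \<eta> m) ([]) (- z) \<and>
                 (let t = (\<lambda>n. of_real ((\<Prod>i=1..m. Gamma (e i + \<eta> i * (1 + real n)))) * ((- z) ^ n / fact n)) in
                    summable t \<and> g z = 1 / of_real (K1 m e \<eta>) * (\<Sum>n. t n)))))) \<and>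
         (p > 0 \<longrightarrow>
           laplace_converges (rho2 p e \<eta> b) \<and>
           real_completely_monotone (laplace (rho2 p e \<eta> b)) \<and>
           (0 < Delta2 \<longrightarrow>
             (\<exists>g. entire_extension g (laplace (rho2 p e \<eta> b)) \<and>
               (\<forall>z. g z = 1 / of_real (K2 p e \<eta> b) * wright (pars (\<lambda>i. e i + \<eta> i) \<eta> p) (pars (\<lambda>i. e i + b i + \<eta> i) \<eta> p) (- z) \<and>
                 (let t = (\<lambda>n. of_real ((\<Prod>i=1..p. Gamma (e i + \<eta> i * (1 + real n))) / (\<Prod>i=1..p. Gamma (e i + b i + \<eta> i * (1 + real n)))) * ((- z) ^ n / fact n)) in
                    summable t \<and> g z = 1 / of_real (K2 p e \<eta> b) * (\<Sum>n. t n)))))) \<and>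
         (p > 0 \<and> m > 0 \<longrightarrow>
           laplace_converges (rho3 m p e \<eta> b) \<and>
           real_completely_monotone (laplace (rho3 m p e \<eta> b)) \<and>
           (0 < Delta3 m p \<eta> \<longrightarrow>
             (\<exists>g. entire_extension g (laplace (rho3 m p e \<eta> b)) \<and>
               (\<forall>z. g z = 1 / of_real (K3 m p e \<eta> b) * wright (pars (\<lambda>i. e i + \<eta> i) \<eta> (m + p)) (pars (\<lambda>i. e i + b i + \<eta> i) \<eta> p) (- z) \<and>
                 (let t = (\<lambda>n. of_real ((\<Prod>i=1..m + p. Gamma (e i + \<eta> i * (1 + real n))) / (\<Prod>i=1..p. Gamma (e i + b i + \<eta> i * (1 + real n)))) * ((- z) ^ n / fact n)) in
                    summable t \<and> g z = 1 / of_real (K3 m p e \<eta> b) * (\<Sum>n. t n)))))) \<and>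
         (l > 0 \<longrightarrow>
           laplace_converges (rho4 l a \<alpha> \<beta> \<gamma>) \<and>
           real_completely_monotone (laplace (rho4 l a \<alpha> \<beta> \<gamma>)) \<and>
           (0 < Delta4 l \<alpha> \<beta> \<gamma> \<longrightarrow>
             (\<exists>g. entire_extension g (laplace (rho4 l a \<alpha> \<beta> \<gamma>)) \<and>
               (\<forall>z. g z = 1 / of_real (K4 l a \<alpha> \<beta>) * wright (pars (\<lambda>k. a k + \<alpha> k) (\<lambda>k. \<alpha> k * \<gamma> k) l) (pars (\<lambda>k. 1 + \<beta> k * (a k + \<alpha> k - 1)) (\<lambda>k. \<alpha> k * \<beta> k * \<gamma> k) l) (- z) \<and>
                 (let t = (\<lambda>n. of_real ((\<Prod>k=1..l. Gamma (a k + \<alpha> k + \<alpha> k * \<gamma> k * real n)) / (\<Prod>k=1..l. Gamma (1 + \<beta> k * (a k + \<alpha> k - 1) + \<alpha> k * \<beta> k * \<gamma> k * real n))) * ((- z) ^ n / fact n)) in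
                    summable t \<and> g z = 1 / of_real (K4 l a \<alpha> \<beta>) * (\<Sum>n. t n)))))) \<and>
         (m > 0 \<and> l > 0 \<longrightarrow>
           laplace_converges (rho5 m l e \<eta> a \<alpha> \<beta> \<gamma>) \<and>
           real_completely_monotone (laplace (rho5 m l e \<eta> a \<alpha> \<beta> \<gamma>)) \<and>
           (0 < Delta5 m l \<eta> \<alpha> \<beta> \<gamma> \<longrightarrow>
             (\<exists>g. entire_extension g (laplace (rho5 m l e \<eta> a \<alpha> \<beta> \<gamma>)) \<and>
               (\<forall>z. g z = 1 / of_real (K5 m l e \<eta> a \<alpha> \<beta>) * wright (pars (\<lambda>i. e i + \<eta> i) \<eta> m @ pars (\<lambda>k. a k + \<alpha> k) (\<lambda>k. \<alpha> k * \<gamma> k) l) (pars (\<lambda>k. 1 + \<beta> k * (a k + \<alpha> k - 1)) (\<lambda>k. \<alpha> k * \<beta> k * \<gamma> k) l) (- z) \<and>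
                 (let t = (\<lambda>n. of_real ((\<Prod>i=1..m. Gamma (e i + \<eta> i * (1 + real n))) * (\<Prod>k=1..l. Gamma (a k + \<alpha> k + \<alpha> k * \<gamma> k * real n)) / (\<Prod>k=1..l. Gamma (1 + \<beta> k * (a k + \<alpha> k - 1) + \<alpha> k * \<beta> k * \<gamma> k * real n))) * ((- z) ^ n / fact n)) in
                    summable t \<and> g z = 1 / of_real (K5 m l e \<eta> a \<alpha> \<beta>) * (\<Sum>n. t n)))))) \<and>
         (p > 0 \<and> l > 0 \<longrightarrow>
           laplace_converges (rho6 p l e \<eta> b a \<alpha> \<beta> \<gamma>) \<and>
           real_completely_monotone (laplace (rho6 p l e \<eta> b a \<alpha> \<beta> \<gamma>)) \<and>
           (0 < Delta6 l \<alpha> \<beta> \<gamma> \<longrightarrow>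
             (\<exists>g. entire_extension g (laplace (rho6 p l e \<eta> b a \<alpha> \<beta> \<gamma>)) \<and>
               (\<forall>z. g z = 1 / of_real (K6 p l e \<eta> b a \<alpha> \<beta>) * wright (pars (\<lambda>i. e i + \<eta> i) \<eta> p @ pars (\<lambda>k. a k + \<alpha> k) (\<lambda>k. \<alpha> k * \<gamma> k) l) (pars (\<lambda>i. e i + b i + \<eta> i) \<eta> p @ pars (\<lambda>k. 1 + \<beta> k * (a k + \<alpha> k - 1)) (\<lambda>k. \<alpha> k * \<beta> k * \<gamma> k) l) (- z) \<and>
                 (let t = (\<lambda>n. of_real ((\<Prod>i=1..p. Gamma (e i + \<eta> i * (1 + real n))) * (\<Prod>k=1..l. Gamma (a k + \<alpha> k + \<alpha> k * \<gamma> k * real n)) / ((\<Prod>i=1..p. Gamma (e i + b i + \<eta> i * (1 + real n))) * (\<Prod>k=1..l. Gamma (1 + \<beta> k * (a k + \<alpha> k - 1) + \<alpha> k * \<beta> k * \<gamma> k * real n)))) * ((- z) ^ n / fact n)) in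
                    summable t \<and> g z = 1 / of_real (K6 p l e \<eta> b a \<alpha> \<beta>) * (\<Sum>n. t n)))))) \<and>
         (p > 0 \<and> m > 0 \<and> l > 0 \<longrightarrow>
           laplace_converges (rho7 m p l e \<eta> b a \<alpha> \<beta> \<gamma>) \<and>
           real_completely_monotone (laplace (rho7 m p l e \<eta> b a \<alpha> \<beta> \<gamma>)) \<and>
           (0 < Delta7 m p l \<eta> \<alpha> \<beta> \<gamma> \<longrightarrow>
             (\<exists>g. entire_extension g (laplace (rho7 m p l e \<eta> b a \<alpha> \<beta> \<gamma>)) \<and>
               (\<forall>z. g z = 1 / of_real (K7 m p l e \<eta> b a \<alpha> \<beta>) * wright (pars (\<lambda>i. e i + \<eta> i) \<eta> (m + p) @ pars (\<lambda>k. a k + \<alpha> k) (\<lambda>k. \<alpha> k * \<gamma> k) l) (pars (\<lambda>i. e i + b i + \<eta> i) \<eta> p @ pars (\<lambda>k. 1 + \<beta> k * (a k + \<alpha> k - 1)) (\<lambda>k. \<alpha> k * \<beta> k * \<gamma> k) l) (- z) \<and>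
                 (let t = (\<lambda>n. of_real ((\<Prod>i=1..m + p. Gamma (e i + \<eta> i * (1 + real n))) * (\<Prod>k=1..l. Gamma (a k + \<alpha> k + \<alpha> k * \<gamma> k * real n)) / ((\<Prod>i=1..p. Gamma (e i + b i + \<eta> i * (1 + real n))) * (\<Prod>k=1..l. Gamma (1 + \<beta> k * (a k + \<alpha> k - 1) + \<alpha> k * \<beta> k * \<gamma> k * real n)))) * ((- z) ^ n / fact n)) in
                    summable t \<and> g z = 1 / of_real (K7 m p l e \<eta> b a \<alpha> \<beta>) * (\<Sum>n. t n))))))"
proof (intro conjI, goal_cases)
  case 1
  have "(\<lambda>n. (- z) ^ n / fact n) sums exp (- z)" for z :: complex
    using exp_converges[of "- z"] by (simp add: scaleR_conv_of_real divide_inverse mult.commute)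
  then have exp: "summable (\<lambda>n. (- z) ^ n / fact n)" "(\<Sum>n. (- z) ^ n / fact n) = exp (- z)" for z :: complex
    by (simp_all add: sums_iff)
  have wright: "wright [] [] (- z) = exp (- z)" for z
    by (simp add: wright_def wright_term_def exp)
  have "entire_extension (\<lambda>z. exp (- z)) (laplace_measure rho0)"
    by (auto simp: entire_extension_def laplace_rho0(2) exp_of_real[symmetric] intro!: holomorphic_intros)
  then show ?case
    using laplace_rho0 by (auto simp: wright exp intro!: exI[of _ "\<lambda>z. exp (- z)"])
next
  case 2
  show ?case (is "_ \<longrightarrow> ?C")
  proof
    assume "m > 0"
    with assms interpret fox_parameters m 0 0 e \<eta> b a \<alpha> \<beta> \<gamma>
      by unfold_locales auto
    have eqs: "rho7 m 0 0 e \<eta> b a \<alpha> \<beta> \<gamma> = rho1 m e \<eta>"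
      "K7 m 0 0 e \<eta> b a \<alpha> \<beta> = K1 m e \<eta>"
      "Delta7 m 0 0 \<eta> \<alpha> \<beta> \<gamma> = Delta1 m \<eta>"
      by (simp_all add: fun_eq_iff rho7_def K7_def K3_def K4_def Delta7_def rho1_def K1_def Delta1_def S_sum_def
          beta_upper_def stable_upper_def stable_lower_def)
    from laplace_rho7 show ?C
      by (simp add: laplace_is_wright_def moment_def Let_def eqs)
  qed
next
  case 3
  show ?case (is "_ \<longrightarrow> ?C")
  proof
    assume "p > 0"
    with assms interpret fox_parameters 0 p 0 e \<eta> b a \<alpha> \<beta> \<gamma>
      by unfold_locales auto
    have eqs: "K7 0 p 0 e \<eta> b a \<alpha> \<beta> = K2 p e \<eta> b"
      "Delta7 0 p 0 \<eta> \<alpha> \<beta> \<gamma> = Delta2"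
      by (simp_all add: K7_def K3_def K4_def Delta7_def K2_def Delta2_def S_sum_def)
    from laplace_rho2[OF refl refl] show ?C
      by (simp add: laplace_is_wright_def moment_def Let_def eqs)
  qed
next
  case 4
  show ?case (is "_ \<longrightarrow> ?C")
  proof
    assume "p > 0 \<and> m > 0"
    with assms interpret fox_parameters m p 0 e \<eta> b a \<alpha> \<beta> \<gamma>
      by unfold_locales auto
    have eqs: "rho7 m p 0 e \<eta> b a \<alpha> \<beta> \<gamma> = rho3 m p e \<eta> b"
      "K7 m p 0 e \<eta> b a \<alpha> \<beta> = K3 m p e \<eta> b"
      "Delta7 m p 0 \<eta> \<alpha> \<beta> \<gamma> = Delta3 m p \<eta>"
      by (simp_all add: fun_eq_iff rho7_def K7_def K4_def Delta7_def rho3_def Delta3_def S_sum_def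
          beta_upper_def stable_upper_def stable_lower_def)
    from laplace_rho7 show ?C
      by (simp add: laplace_is_wright_def moment_def Let_def eqs)
  qed
next
  case 5
  show ?case (is "_ \<longrightarrow> ?C")
  proof
    assume "l > 0"
    with assms interpret fox_parameters 0 0 l e \<eta> b a \<alpha> \<beta> \<gamma>
      by unfold_locales auto
    have eqs: "rho7 0 0 l e \<eta> b a \<alpha> \<beta> \<gamma> = rho4 l a \<alpha> \<beta> \<gamma>"
      "K7 0 0 l e \<eta> b a \<alpha> \<beta> = K4 l a \<alpha> \<beta>"
      "Delta7 0 0 l \<eta> \<alpha> \<beta> \<gamma> = Delta4 l \<alpha> \<beta> \<gamma>"
      by (simp_all add: fun_eq_iff rho7_def K7_def K3_def Delta7_def rho4_def Delta4_def S_sum_def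
          beta_upper_def stable_upper_def stable_lower_def)
    from laplace_rho7 show ?C
      by (simp add: laplace_is_wright_def moment_def Let_def eqs)
  qed
next
  case 6
  show ?case (is "_ \<longrightarrow> ?C")
  proof
    assume "m > 0 \<and> l > 0"
    with assms interpret fox_parameters m 0 l e \<eta> b a \<alpha> \<beta> \<gamma>
      by unfold_locales auto
    have eqs: "rho7 m 0 l e \<eta> b a \<alpha> \<beta> \<gamma> = rho5 m l e \<eta> a \<alpha> \<beta> \<gamma>"
      "K7 m 0 l e \<eta> b a \<alpha> \<beta> = K5 m l e \<eta> a \<alpha> \<beta>"
      "Delta7 m 0 l \<eta> \<alpha> \<beta> \<gamma> = Delta5 m l \<eta> \<alpha> \<beta> \<gamma>"
      by (simp_all add: fun_eq_iff rho7_def K7_def K3_def Delta7_def rho5_def K5_def K1_def Delta5_def S_sum_def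
          beta_upper_def stable_upper_def stable_lower_def)
    from laplace_rho7 show ?C
      by (simp add: laplace_is_wright_def moment_def Let_def eqs)
  qed
next
  case 7
  show ?case (is "_ \<longrightarrow> ?C")
  proof
    assume "p > 0 \<and> l > 0"
    with assms interpret fox_parameters 0 p l e \<eta> b a \<alpha> \<beta> \<gamma>
      by unfold_locales auto
    have eqs: "rho7 0 p l e \<eta> b a \<alpha> \<beta> \<gamma> = rho6 p l e \<eta> b a \<alpha> \<beta> \<gamma>"
      "K7 0 p l e \<eta> b a \<alpha> \<beta> = K6 p l e \<eta> b a \<alpha> \<beta>"
      "Delta7 0 p l \<eta> \<alpha> \<beta> \<gamma> = Delta6 l \<alpha> \<beta> \<gamma>"
      by (simp_all add: fun_eq_iff rho7_def K7_def K3_def Delta7_def rho6_def K6_def K2_def Delta6_def S_sum_def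
          beta_upper_def stable_upper_def stable_lower_def)
    from laplace_rho7 show ?C
      by (simp add: laplace_is_wright_def moment_def Let_def eqs)
  qed
next
  case 8
  show ?case (is "_ \<longrightarrow> ?C")
  proof
    assume "p > 0 \<and> m > 0 \<and> l > 0"
    with assms interpret fox_parameters m p l e \<eta> b a \<alpha> \<beta> \<gamma>
      by unfold_locales auto
    from laplace_rho7 show ?C
      by (simp add: laplace_is_wright_def moment_def Let_def)
  qed
qed

end
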